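(* Let $\mathbb B$ be the closed unit ball centered at $0$ in $\mathbb R^n$, let $\mathsf A$ be a compact metric space and $\sigma:\mathsf A\to\mathsf A$ a homeomorphism. Let $r\ge2$ be an integer and let $(f_{\mathsf a})_{\mathsf a\in\mathsf A}$ be a $C^0$-family of $C^r$-maps $f_{\mathsf a}:\mathbb B\to\mathbb B$ such that: (H1) for every $\mathsf a\in\mathsf A$, $f_{\mathsf a}$ is a contracting diffeomorphism from $\mathbb B$ into $\mathbb B$ which fixes $0$; (H2) for every $\mathsf a\in\mathsf A$, $D_0f_{\mathsf a}=\mathrm{diag}(\lambda_{\mathsf a,1},\dots,\lambda_{\mathsf a,n})$ is diagonal; (H3) for any $1\le i\le n$ and any multiindex $k\in\mathbb N^n$ with $|k|\ne1$, we have $|\lambda_{\mathsf a,i}|\ne|\lambda_{\mathsf a}^{k}|$ for all $\mathsf a\in\mathsf A$, and the sign of the difference does not depend on $\mathsf a$; (H4$^r$) for any $1\le i\le n$ and any multiindex $k$ with $|k|\ge r$, we have $|\lambda_{\mathsf a,i}|>|\lambda_{\mathsf a}^k|$ for all $\mathsf a\in\mathsf A$. Then there exists a unique $C^0$-family $(h_{\mathsf a})_{\mathsf a\in\mathsf A}$ of $C^r$-diffeomorphisms from $\mathbb B$ into $\mathbb R^n$ such that for every $\mathsf a\in\mathsf A$ $$D_0h_{\mathsf a}=\mathrm{id},\qquad h_{\mathsf a}(0)=0,\qquad h_{\sigma(\mathsf a)}\circ f_{\mathsf a}(x)=D_0f_{\mathsf a}\circ h_{\mathsf a}(x)\quad\forall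 x\in\mathbb B .$$ Moreover, $h$ depends continuously on $f$ (the map $f\mapsto h$, defined on the set of families satisfying (H1), (H2), (H3), (H4$^r$) in $C^0(\mathsf A,C^r(\mathbb B,\mathbb R^n))$ and with values in $C^0(\mathsf A,C^r(\mathbb B,\mathbb R^n))$, is continuous).
   Context: A map is a diffeomorphism "from $\mathbb B$ into" a space if it is a diffeomorphism onto its image. Contracting means $\|D_xf_{\mathsf a}\|<1$ for every $x\in\mathbb B$. A $C^0$-family of $C^r$-maps is an element of $C^0(\mathsf A,C^r(\mathbb B,\mathbb R^n))$, which is a Banach space with norm $\|(h_{\mathsf a})_{\mathsf a}\|_r=\max_{\mathsf a}\max_{0\le i\le r}\sup_{x\in\mathbb B}\|D_x^ih_{\mathsf a}\|$. For $k=(k_1,\dots,k_n)\in\mathbb N^n$, $|k|=k_1+\dots+k_n$ and $\lambda_{\mathsf a}^k=\prod_i\lambda_{\mathsf a,i}^{k_i}$. *)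

theory Defs
  imports "HOL-Analysis.Analysis"
begin

text \<open>
  For a list of vectors $v_1, \ldots, v_i$, this is $D^i_x f (v_1, \ldots, v_i)$, all derivatives
  being taken within \<open>S\<close>. It is only meaningful where derivatives within \<open>S\<close> are unique, as on
  a closed ball or on the image of one under a diffeomorphism.
\<close>

primrec iter_deriv ::
  "'v::real_normed_vector set \<Rightarrow> ('v \<Rightarrow> 'w::real_normed_vector) \<Rightarrow> 'v list \<Rightarrow> 'v \<Rightarrow> 'w" where
  "iter_deriv S f [] = f"
| "iter_deriv S f (v # vs) = (\<lambda>x. frechet_derivative (iter_deriv S f vs) (at x within S) v)"

text \<open>
  On finite-dimensional spaces, Frechet differentiability (continuity) of $x \mapsto D^i_x f$ in the
  operator norm amounts to that of $x \mapsto D^i_x f (v_1, \ldots, v_i)$ for all $v_1, \ldots, v_i$.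
\<close>

definition Cr_on ::
  "nat \<Rightarrow> 'v::euclidean_space set \<Rightarrow> ('v \<Rightarrow> 'w::euclidean_space) \<Rightarrow> bool" where
  "Cr_on r S f \<longleftrightarrow>
     (\<forall>vs. length vs < r \<longrightarrow> iter_deriv S f vs differentiable_on S) \<and>
     (\<forall>vs. length vs \<le> r \<longrightarrow> continuous_on S (iter_deriv S f vs))"

definition Cr_diffeo_into ::
  "nat \<Rightarrow> 'v::euclidean_space set \<Rightarrow> ('v \<Rightarrow> 'w::euclidean_space) \<Rightarrow> bool" where
  "Cr_diffeo_into r S f \<longleftrightarrow>
     Cr_on r S f \<and> inj_on f S \<and> Cr_on r (f ` S) (the_inv_into S f)"

definition deriv_norm ::
  "'v::euclidean_space set \<Rightarrow> nat \<Rightarrow> ('v \<Rightarrow> 'w::euclidean_space) \<Rightarrow> 'v \<Rightarrow> real" where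
  "deriv_norm S i f x =
     (SUP vs\<in>{vs. length vs = i \<and> (\<forall>v\<in>set vs. norm v \<le> 1)}. norm (iter_deriv S f vs x))"

definition Cr_norm ::
  "nat \<Rightarrow> 'v::euclidean_space set \<Rightarrow> ('v \<Rightarrow> 'w::euclidean_space) \<Rightarrow> real" where
  "Cr_norm r S f = Max ((\<lambda>i. SUP x\<in>S. deriv_norm S i f x) ` {..r})"

text \<open>
  The space $C^0(A, C^r(S, W))$. A family is a total function, of which only the
  restriction to \<open>A\<close> and \<open>S\<close> matters.
\<close>

definition Cr_families ::
  "nat \<Rightarrow> 'a::metric_space set \<Rightarrow> 'v::euclidean_space set \<Rightarrow>
     ('a \<Rightarrow> 'v \<Rightarrow> 'w::euclidean_space) set" where
  "Cr_families r A S =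
     {f. (\<forall>a\<in>A. Cr_on r S (f a)) \<and>
         (\<forall>a\<in>A. ((\<lambda>b. Cr_norm r S (\<lambda>x. f b x - f a x)) \<longlongrightarrow> 0) (at a within A))}"

definition family_norm ::
  "nat \<Rightarrow> 'a::metric_space set \<Rightarrow> 'v::euclidean_space set \<Rightarrow>
     ('a \<Rightarrow> 'v \<Rightarrow> 'w::euclidean_space) \<Rightarrow> real" where
  "family_norm r A S f = (SUP a\<in>A. Cr_norm r S (f a))"

abbreviation unit_cball :: "(real ^ 'n) set" where
  "unit_cball \<equiv> cball 0 1"

text \<open>$D_x g$ for a map \<open>g\<close> on the closed unit ball.\<close>

abbreviation D_ball :: "(real ^ 'n \<Rightarrow> real ^ 'n) \<Rightarrow> real ^ 'n \<Rightarrow> real ^ 'n \<Rightarrow> real ^ 'n" where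
  "D_ball g x \<equiv> frechet_derivative g (at x within unit_cball)"

definition eigval :: "('a \<Rightarrow> real ^ 'n \<Rightarrow> real ^ 'n) \<Rightarrow> 'a \<Rightarrow> 'n \<Rightarrow> real" where
  "eigval f a i = D_ball (f a) 0 (axis i 1) $ i"

definition eigval_power :: "('a \<Rightarrow> real ^ 'n \<Rightarrow> real ^ 'n) \<Rightarrow> 'a \<Rightarrow> ('n \<Rightarrow> nat) \<Rightarrow> real" where
  "eigval_power f a k = (\<Prod>i\<in>UNIV. eigval f a i ^ k i)"

definition H1 :: "nat \<Rightarrow> 'a set \<Rightarrow> ('a \<Rightarrow> real ^ 'n \<Rightarrow> real ^ 'n) \<Rightarrow> bool" where
  "H1 r A f \<longleftrightarrow>
     (\<forall>a\<in>A. f a ` unit_cball \<subseteq> unit_cball \<and> Cr_diffeo_into r unit_cball (f a) \<and>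
       (\<forall>x\<in>unit_cball. onorm (D_ball (f a) x) < 1) \<and> f a 0 = 0)"

definition H2 :: "'a set \<Rightarrow> ('a \<Rightarrow> real ^ 'n \<Rightarrow> real ^ 'n) \<Rightarrow> bool" where
  "H2 A f \<longleftrightarrow> (\<forall>a\<in>A. \<forall>v. D_ball (f a) 0 v = (\<chi> i. eigval f a i * v $ i))"

definition H3 :: "'a set \<Rightarrow> ('a \<Rightarrow> real ^ 'n \<Rightarrow> real ^ 'n) \<Rightarrow> bool" where
  "H3 A f \<longleftrightarrow>
     (\<forall>i. \<forall>k :: 'n \<Rightarrow> nat. sum k UNIV \<noteq> 1 \<longrightarrow>
       (\<forall>a\<in>A. \<bar>eigval f a i\<bar> \<noteq> \<bar>eigval_power f a k\<bar>) \<and>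
       (\<forall>a\<in>A. \<forall>b\<in>A. sgn (\<bar>eigval f a i\<bar> - \<bar>eigval_power f a k\<bar>) =
                      sgn (\<bar>eigval f b i\<bar> - \<bar>eigval_power f b k\<bar>)))"

definition H4 :: "nat \<Rightarrow> 'a set \<Rightarrow> ('a \<Rightarrow> real ^ 'n \<Rightarrow> real ^ 'n) \<Rightarrow> bool" where
  "H4 r A f \<longleftrightarrow>
     (\<forall>i. \<forall>k :: 'n \<Rightarrow> nat. sum k UNIV \<ge> r \<longrightarrow>
       (\<forall>a\<in>A. \<bar>eigval f a i\<bar> > \<bar>eigval_power f a k\<bar>))"

definition admissible_families ::
  "nat \<Rightarrow> 'a::metric_space set \<Rightarrow> ('a \<Rightarrow> real ^ 'n \<Rightarrow> real ^ 'n) set" where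
  "admissible_families r A =
     {f \<in> Cr_families r A unit_cball. H1 r A f \<and> H2 A f \<and> H3 A f \<and> H4 r A f}"

definition linearizes ::
  "nat \<Rightarrow> 'a::metric_space set \<Rightarrow> ('a \<Rightarrow> 'a) \<Rightarrow> ('a \<Rightarrow> real ^ 'n \<Rightarrow> real ^ 'n) \<Rightarrow>
     ('a \<Rightarrow> real ^ 'n \<Rightarrow> real ^ 'n) \<Rightarrow> bool" where
  "linearizes r A \<sigma> f h \<longleftrightarrow>
     h \<in> Cr_families r A unit_cball \<and>
     (\<forall>a\<in>A. Cr_diffeo_into r unit_cball (h a) \<and>
       D_ball (h a) 0 = id \<and> h a 0 = 0 \<and>
       (\<forall>x\<in>unit_cball. h (\<sigma> a) (f a x) = D_ball (f a) 0 (h a x)))"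

end

(* The equation is solved for each coordinate separately, as a fixed point of the operator
   T w a x = w (sigma a) (f a x) / lambda_{a,i}. On the k-jets at 0 it acts diagonally, with entries
   lambda_a^k / lambda_{a,i}: by (H3) each of the resulting cohomological equations over sigma is
   contracting either forwards or backwards, so a polynomial family P solves the problem up to order
   r - 1, uniquely. By (H4), T contracts the r-th derivatives of families whose (r-1)-jets vanish,
   first near 0 and then, since f contracts, on the whole ball. Hence T^n P converges. The family
   with these coordinates is a diffeomorphism near 0, and the conjugacy spreads this to the ball.
   Continuity in f is existence and uniqueness for the family that joins a sequence g_n to its
   limit f, parametrised by A times {0, 1, 1/2, 1/3, ...}. *)
theory Submission
  imports Defs
begin

text \<open>The dichotomy behind (H3) must be uniform: a cohomological equation is solved along
  \<open>\<sigma>\<close> or along its inverse, and the choice has to be the same for all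
  parameters, which is why the sign of the difference may not depend on \<open>a\<close>;
  compactness then gives a uniform rate. The contraction of \<open>T\<close> is delicate because the
  chain rule mixes orders. Away from 0 the lower derivatives enter with coefficients that are not
  small, but for a flat family these derivatives are themselves small on a small ball. Passing from
  that ball to the whole ball costs a constant factor, paid a fixed number of times. For continuity
  in \<open>f\<close>, all members of the joined family must share the same signs. (H4) settles the
  orders from \<open>r\<close> on, so finitely many gaps remain to be compared; by (H3) the sign of
  each can be read off at a single parameter, where it is stable under convergence. Derivatives live
  within a closed ball, and those of an inverse within a curved image of it, so uniqueness of
  derivatives is isolated as a property of sets.\<close>

subsection \<open>Families of differentiable maps\<close>

text \<open>It is enough to test uniqueness of the derivative within \<open>S\<close> on the zero function.\<close>

definition unique_deriv :: "'v::real_normed_vector set \<Rightarrow> bool" where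
  "unique_deriv S \<longleftrightarrow>
     (\<forall>x\<in>S. \<forall>L. ((\<lambda>_. 0::real) has_derivative L) (at x within S) \<longrightarrow> (\<forall>v. L v = 0))"

text \<open>A derivative of the zero map at \<open>x\<close> kills \<open>z - x\<close> for every
  \<open>z\<close> in \<open>S\<close>, because it restricts to the segment, where one-sided
  derivatives are unique. A ball inside \<open>S\<close> writes any direction, up to scale, as a
  difference of two such vectors.\<close>

lemma unique_deriv_convex:
  fixes S :: "'v::real_normed_vector set"
  assumes "convex S" "interior S \<noteq> {}"
  shows "unique_deriv S"
  unfolding unique_deriv_def
proof (intro ballI allI impI)
  fix x v :: 'v and L :: "'v \<Rightarrow> real"
  assume x: "x \<in> S" and L: "((\<lambda>_. 0::real) has_derivative L) (at x within S)"
  interpret L: bounded_linear L using L by (rule has_derivative_bounded_linear)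
  have zero: "L (z - x) = 0" if z: "z \<in> S" for z
  proof -
    let ?g = "\<lambda>t::real. x + t *\<^sub>R (z - x)"
    have sub: "?g ` {0..1} \<subseteq> S"
      using convexD_alt[OF \<open>convex S\<close> x z] by (auto simp: algebra_simps)
    have g: "(?g has_derivative (\<lambda>t. t *\<^sub>R (z - x))) (at 0 within {0..1})"
      by (auto intro!: derivative_eq_intros)
    have "((\<lambda>_. 0::real) has_derivative L) (at (?g 0) within ?g ` {0..1})"
      using has_derivative_subset[OF L sub] by simp
    from has_derivative_in_compose[OF g this]
    have "((\<lambda>_. 0::real) has_vector_derivative L (z - x)) (at 0 within {0..1})"
      by (simp add: has_vector_derivative_def L.scaleR)
    hence "((\<lambda>_. 0::real) has_vector_derivative L (z - x)) (at 0 within cbox 0 1)"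
      by (simp only: cbox_interval)
    from vector_derivative_unique_within_closed_interval[OF _ _ this has_vector_derivative_const]
    show ?thesis by simp
  qed
  obtain c e where "e > 0" and ce: "ball c e \<subseteq> S"
    using assms(2) mem_interior by blast
  \<comment> \<open>Small enough to keep \<open>c\<close> plus \<open>s\<close> times
    \<open>v\<close> in the ball; the summand 1 covers \<open>v = 0\<close>.\<close>
  define s where "s = e / (2 * (norm v + 1))"
  have "s > 0" using \<open>e > 0\<close> by (simp add: s_def add_nonneg_pos)
  have "norm (s *\<^sub>R v) < e"
  proof -
    have "norm (s *\<^sub>R v) = s * norm v"
      using \<open>s > 0\<close> by simp
    also have "\<dots> < s * (2 * (norm v + 1))"
      using \<open>s > 0\<close> by (intro mult_strict_left_mono) (auto simp: add_nonneg_pos intro: le_less_trans[OF _ less_add_one])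
    also have "\<dots> = e"
    proof -
      have "2 * (norm v + 1) \<noteq> 0" using norm_ge_zero[of v] by (smt (verit))
      thus ?thesis unfolding s_def by (rule nonzero_eq_divide_eq[THEN iffD1, OF _ refl])
    qed
    finally show ?thesis .
  qed
  hence "c + s *\<^sub>R v \<in> S" "c \<in> S"
    using ce \<open>e > 0\<close> by (auto simp: dist_norm)
  from zero[OF this(1)] zero[OF this(2)]
  have "L ((c + s *\<^sub>R v - x) - (c - x)) = 0" by (simp only: L.diff)
  hence "L (s *\<^sub>R v) = 0" by simp
  thus "L v = 0" using \<open>s > 0\<close> by (simp add: L.scaleR)
qed

lemma unique_deriv_cball: "e > 0 \<Longrightarrow> unique_deriv (cball x (e::real) :: 'v::real_normed_vector set)"
  by (rule unique_deriv_convex) (auto intro: interior_maximal[OF ball_subset_cball open_ball, THEN subsetD] centre_in_ball[THEN iffD2])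

text \<open>The inner product with \<open>L v - M v\<close> turns the zero map with derivative
  \<open>L - M\<close> into the scalar test function of \<open>unique_deriv\<close>; this is why
  values lie in an inner product space.\<close>

lemma unique_derivD:
  fixes f :: "'v::real_normed_vector \<Rightarrow> 'w::real_inner"
  assumes "unique_deriv S" "x \<in> S"
    and L: "(f has_derivative L) (at x within S)" and M: "(f has_derivative M) (at x within S)"
  shows "L = M"
proof
  fix v
  have "((\<lambda>_. 0) has_derivative (\<lambda>v. L v - M v)) (at x within S)"
    using has_derivative_diff[OF L M] by simp
  hence "((\<lambda>_. 0 \<bullet> (L v - M v)) has_derivative (\<lambda>u. (L u - M u) \<bullet> (L v - M v))) (at x within S)"
    by (rule has_derivative_inner_left)
  hence "((\<lambda>_. 0::real) has_derivative (\<lambda>u. (L u - M u) \<bullet> (L v - M v))) (at x within S)"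
    by simp
  hence "(L v - M v) \<bullet> (L v - M v) = 0"
    using assms(1,2) unfolding unique_deriv_def by blast
  thus "L v = M v" by simp
qed

abbreviation D_within ::
  "'v::real_normed_vector set \<Rightarrow> ('v \<Rightarrow> 'w::real_normed_vector) \<Rightarrow> 'v \<Rightarrow> 'v \<Rightarrow> 'w" where
  "D_within S f x \<equiv> frechet_derivative f (at x within S)"

lemma D_within_eq:
  fixes f :: "'v::real_normed_vector \<Rightarrow> 'w::real_inner"
  assumes "unique_deriv S" "x \<in> S" "(f has_derivative L) (at x within S)"
  shows "D_within S f x = L"
  using unique_derivD[OF assms(1,2) _ assms(3)] assms(3) frechet_derivative_works
  by (metis differentiableI)

lemma has_derivative_within_cong:
  assumes "\<And>y. y \<in> S \<Longrightarrow> f y = g y" "x \<in> S"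
  shows "(f has_derivative L) (at x within S) \<longleftrightarrow> (g has_derivative L) (at x within S)"
  using assms by (metis has_derivative_transform)

lemma D_within_cong:
  assumes "\<And>y. y \<in> S \<Longrightarrow> f y = g y" "x \<in> S"
  shows "D_within S f x = D_within S g x"
  unfolding frechet_derivative_def using has_derivative_within_cong[OF assms] by simp

lemma differentiable_on_cong:
  assumes "\<And>y. y \<in> S \<Longrightarrow> f y = g y"
  shows "f differentiable_on S \<longleftrightarrow> g differentiable_on S"
  unfolding differentiable_on_def differentiable_def
  by (intro ball_cong refl ex_cong1 has_derivative_within_cong assms)

lemma has_derivative_D_within:
  "f differentiable_on S \<Longrightarrow> x \<in> S \<Longrightarrow> (f has_derivative D_within S f x) (at x within S)"
  unfolding differentiable_on_def using frechet_derivative_works by blast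

lemma D_within_basis_sum:
  fixes f :: "'v::euclidean_space \<Rightarrow> 'w::real_normed_vector"
  assumes "f differentiable_on S" "x \<in> S"
  shows "D_within S f x v = (\<Sum>b\<in>Basis. (v \<bullet> b) *\<^sub>R D_within S f x b)"
proof -
  interpret L: bounded_linear "D_within S f x"
    using has_derivative_D_within[OF assms] by (rule has_derivative_bounded_linear)
  have "D_within S f x v = D_within S f x (\<Sum>b\<in>Basis. (v \<bullet> b) *\<^sub>R b)"
    by (simp only: euclidean_representation)
  thus ?thesis by (simp only: L.sum L.scaleR)
qed

text \<open>For compact \<open>S\<close> this is $C^0(A, C^k(S))$: continuity of $a \mapsto f_a$ in the $C^k$ norm
  is joint continuity of $(a, x) \mapsto D^i_x f_a$ for $i \le k$.\<close>

primrec Ck_fam ::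
  "nat \<Rightarrow> 'a::topological_space set \<Rightarrow> 'v::real_normed_vector set \<Rightarrow>
     ('a \<Rightarrow> 'v \<Rightarrow> 'w::real_inner) \<Rightarrow> bool" where
  "Ck_fam 0 A S f \<longleftrightarrow> continuous_on (A \<times> S) (\<lambda>(a, x). f a x)"
| "Ck_fam (Suc k) A S f \<longleftrightarrow> continuous_on (A \<times> S) (\<lambda>(a, x). f a x) \<and>
     (\<forall>a\<in>A. f a differentiable_on S) \<and> (\<forall>v. Ck_fam k A S (\<lambda>a x. D_within S (f a) x v))"

lemma Ck_fam_continuous: "Ck_fam k A S f \<Longrightarrow> continuous_on (A \<times> S) (\<lambda>(a, x). f a x)"
  by (cases k) auto

lemma Ck_fam_continuous_slice:
  assumes "Ck_fam k A S f" "a \<in> A"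
  shows "continuous_on S (f a)"
proof -
  have "continuous_on S ((\<lambda>(a, x). f a x) \<circ> (\<lambda>x. (a, x)))"
    by (intro continuous_on_compose continuous_intros
        continuous_on_subset[OF Ck_fam_continuous[OF assms(1)]]) (use assms in auto)
  thus ?thesis by (simp add: o_def)
qed

lemma Ck_fam_continuous_param:
  assumes "Ck_fam k A S f" "x \<in> S"
  shows "continuous_on A (\<lambda>a. f a x)"
proof -
  have "continuous_on A ((\<lambda>(a, x). f a x) \<circ> (\<lambda>a. (a, x)))"
    by (intro continuous_on_compose continuous_intros
        continuous_on_subset[OF Ck_fam_continuous[OF assms(1)]]) (use assms in auto)
  thus ?thesis by (simp add: o_def)
qed

lemma Ck_fam_Suc_D: "Ck_fam (Suc k) A S f \<Longrightarrow> Ck_fam k A S f"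
  by (induction k arbitrary: f) auto

lemma Ck_fam_mono: "Ck_fam k A S f \<Longrightarrow> j \<le> k \<Longrightarrow> Ck_fam j A S f"
  by (induction k) (auto simp: le_Suc_eq dest: Ck_fam_Suc_D simp del: Ck_fam.simps)

lemma Ck_fam_subset:
  assumes "Ck_fam k A S f" "B \<subseteq> A"
  shows "Ck_fam k B S f"
proof -
  have cont: "continuous_on (B \<times> S) g" if "continuous_on (A \<times> S) g" for g :: "'a \<times> 'b \<Rightarrow> 'c"
    by (rule continuous_on_subset[OF that]) (use assms(2) in auto)
  show ?thesis using assms
    by (induction k arbitrary: f) (auto intro: cont)
qed

lemma Ck_fam_differentiable:
  "Ck_fam k A S f \<Longrightarrow> k > 0 \<Longrightarrow> a \<in> A \<Longrightarrow> f a differentiable_on S"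
  by (cases k) auto

lemma Ck_fam_has_derivative:
  "Ck_fam k A S f \<Longrightarrow> k > 0 \<Longrightarrow> a \<in> A \<Longrightarrow> x \<in> S \<Longrightarrow>
     (f a has_derivative D_within S (f a) x) (at x within S)"
  by (meson Ck_fam_differentiable has_derivative_D_within)

lemma Ck_fam_D: "Ck_fam (Suc k) A S f \<Longrightarrow> Ck_fam k A S (\<lambda>a x. D_within S (f a) x v)"
  by simp

lemma Ck_fam_cong:
  assumes "\<And>a x. a \<in> A \<Longrightarrow> x \<in> S \<Longrightarrow> f a x = g a x"
  shows "Ck_fam k A S f \<longleftrightarrow> Ck_fam k A S g"
  using assms
proof (induction k arbitrary: f g)
  case 0
  show ?case unfolding Ck_fam.simps by (rule continuous_on_cong) (use 0 in auto)
next
  case (Suc k)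
  have "continuous_on (A \<times> S) (\<lambda>(a, x). f a x) \<longleftrightarrow> continuous_on (A \<times> S) (\<lambda>(a, x). g a x)"
    by (rule continuous_on_cong) (use Suc in auto)
  moreover have "(\<forall>a\<in>A. f a differentiable_on S) \<longleftrightarrow> (\<forall>a\<in>A. g a differentiable_on S)"
    by (intro ball_cong refl differentiable_on_cong) (use Suc in auto)
  moreover have "Ck_fam k A S (\<lambda>a x. D_within S (f a) x v) \<longleftrightarrow>
      Ck_fam k A S (\<lambda>a x. D_within S (g a) x v)" for v
  proof (rule Suc.IH)
    fix a x assume "a \<in> A" "x \<in> S"
    thus "D_within S (f a) x v = D_within S (g a) x v"
      using D_within_cong[of S "f a" "g a" x] Suc.prems by simp
  qed
  ultimately show ?case by simp
qed

text \<open>The closure properties below go through this rule: any derivative formula may be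
  supplied, since uniqueness identifies it with \<open>frechet_derivative\<close>, and smoothness of
  the formula comes from the induction hypothesis.\<close>

lemma Ck_fam_SucI:
  assumes U: "unique_deriv S"
    and cont: "Ck_fam 0 A S f"
    and der: "\<And>a x. a \<in> A \<Longrightarrow> x \<in> S \<Longrightarrow> (f a has_derivative f' a x) (at x within S)"
    and Ck: "\<And>v. Ck_fam k A S (\<lambda>a x. f' a x v)"
  shows "Ck_fam (Suc k) A S f"
proof -
  have "Ck_fam k A S (\<lambda>a x. D_within S (f a) x v)" for v
    using Ck[of v] by (subst Ck_fam_cong) (use D_within_eq[OF U _ der] in auto)
  thus ?thesis using cont der by (auto simp: differentiable_on_def differentiable_def)
qed

lemma Ck_fam_const:
  fixes c :: "'a::topological_space \<Rightarrow> 'w::real_inner"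
  assumes U: "unique_deriv S" and c: "continuous_on A c"
  shows "Ck_fam k A S (\<lambda>a x. c a)"
  using c
proof (induction k arbitrary: c)
  case 0
  thus ?case by (auto simp: case_prod_unfold intro!: continuous_on_compose2[OF 0] continuous_intros)
next
  case (Suc k)
  show ?case
  proof (rule Ck_fam_SucI[OF U])
    show "Ck_fam 0 A S (\<lambda>a x. c a)"
      using Suc.prems by (auto simp: case_prod_unfold intro!: continuous_on_compose2[OF Suc.prems] continuous_intros)
    show "Ck_fam k A S (\<lambda>a x. 0 :: 'w)" using Suc.IH[of "\<lambda>_. 0"] by auto
  qed auto
qed

lemma Ck_fam_linear:
  fixes L :: "'v::real_normed_vector \<Rightarrow> 'w::real_inner"
  assumes U: "unique_deriv S" and L: "bounded_linear L"
  shows "Ck_fam k A S (\<lambda>a. L)"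
proof (cases k)
  case 0
  thus ?thesis by (auto simp: case_prod_unfold intro!: bounded_linear.continuous_on[OF L] continuous_intros)
next
  case (Suc j)
  show ?thesis unfolding Suc
  proof (rule Ck_fam_SucI[OF U])
    show "Ck_fam 0 A S (\<lambda>a. L)"
      by (auto simp: case_prod_unfold intro!: bounded_linear.continuous_on[OF L] continuous_intros)
    show "(L has_derivative L) (at x within S)" for x
      by (rule bounded_linear.has_derivative[OF L has_derivative_ident, simplified])
    show "Ck_fam j A S (\<lambda>a x. L v)" for v
      by (rule Ck_fam_const[OF U]) auto
  qed
qed

lemma Ck_fam_add:
  assumes U: "unique_deriv S" and "Ck_fam k A S f" "Ck_fam k A S g"
  shows "Ck_fam k A S (\<lambda>a x. f a x + g a x)"
  using assms(2,3)
proof (induction k arbitrary: f g)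
  case 0
  thus ?case by (auto simp: case_prod_unfold intro!: continuous_intros)
next
  case (Suc k)
  show ?case
  proof (rule Ck_fam_SucI[OF U])
    show "Ck_fam 0 A S (\<lambda>a x. f a x + g a x)"
      using Suc.prems by (auto simp: case_prod_unfold intro!: continuous_intros)
    show "((\<lambda>x. f a x + g a x) has_derivative (\<lambda>v. D_within S (f a) x v + D_within S (g a) x v))
        (at x within S)" if "a \<in> A" "x \<in> S" for a x
      using that Suc.prems by (intro has_derivative_add Ck_fam_has_derivative) auto
    show "Ck_fam k A S (\<lambda>a x. D_within S (f a) x v + D_within S (g a) x v)" for v
      by (rule Suc.IH) (use Suc.prems in auto)
  qed
qed

lemma Ck_fam_sum:
  assumes U: "unique_deriv S" and f: "\<And>i. i \<in> I \<Longrightarrow> Ck_fam k A S (f i)"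
  shows "Ck_fam k A S (\<lambda>a x. \<Sum>i\<in>I. f i a x)"
  using f
proof (induction I rule: infinite_finite_induct)
  case (insert i I)
  thus ?case using Ck_fam_add[OF U, of k A "f i"] by simp
qed (auto intro: Ck_fam_const[OF U])

lemma Ck_fam_scaleR:
  assumes U: "unique_deriv S" and "Ck_fam k A S f" "Ck_fam k A S g"
  shows "Ck_fam k A S (\<lambda>a x. f a x *\<^sub>R g a x)"
  using assms(2,3)
proof (induction k arbitrary: f g)
  case 0
  thus ?case by (auto simp: case_prod_unfold intro!: continuous_intros)
next
  case (Suc k)
  show ?case
  proof (rule Ck_fam_SucI[OF U])
    show "Ck_fam 0 A S (\<lambda>a x. f a x *\<^sub>R g a x)"
      using Suc.prems by (auto simp: case_prod_unfold intro!: continuous_intros)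
    show "((\<lambda>x. f a x *\<^sub>R g a x) has_derivative
        (\<lambda>v. f a x *\<^sub>R D_within S (g a) x v + D_within S (f a) x v *\<^sub>R g a x))
        (at x within S)" if "a \<in> A" "x \<in> S" for a x
      using that Suc.prems by (intro has_derivative_scaleR Ck_fam_has_derivative) auto
    show "Ck_fam k A S (\<lambda>a x. f a x *\<^sub>R D_within S (g a) x v + D_within S (f a) x v *\<^sub>R g a x)" for v
      by (intro Ck_fam_add[OF U] Suc.IH) (use Suc.prems Ck_fam_Suc_D in \<open>auto simp del: Ck_fam.simps intro: Ck_fam_D\<close>)
  qed
qed

lemma Ck_fam_mult:
  fixes f g :: "'a::topological_space \<Rightarrow> 'v::real_normed_vector \<Rightarrow> real"
  assumes "unique_deriv S" "Ck_fam k A S f" "Ck_fam k A S g"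
  shows "Ck_fam k A S (\<lambda>a x. f a x * g a x)"
  using Ck_fam_scaleR[OF assms] by simp

lemma Ck_fam_prod:
  fixes f :: "'i \<Rightarrow> 'a::topological_space \<Rightarrow> 'v::real_normed_vector \<Rightarrow> real"
  assumes U: "unique_deriv S" and f: "\<And>i. i \<in> I \<Longrightarrow> Ck_fam k A S (f i)"
  shows "Ck_fam k A S (\<lambda>a x. \<Prod>i\<in>I. f i a x)"
  using f
proof (induction I rule: infinite_finite_induct)
  case (insert i I)
  thus ?case using Ck_fam_mult[OF U, of k A "f i"] by simp
qed (auto intro: Ck_fam_const[OF U])

lemma Ck_fam_power:
  fixes f :: "'a::topological_space \<Rightarrow> 'v::real_normed_vector \<Rightarrow> real"
  assumes U: "unique_deriv S" and f: "Ck_fam k A S f"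
  shows "Ck_fam k A S (\<lambda>a x. f a x ^ n)"
  by (induction n) (auto intro!: Ck_fam_mult[OF U] f Ck_fam_const[OF U])

lemma Ck_fam_inner_const:
  assumes U: "unique_deriv S" and "Ck_fam k A S f"
  shows "Ck_fam k A S (\<lambda>a x. f a x \<bullet> c)"
  using assms(2)
proof (induction k arbitrary: f)
  case 0
  thus ?case by (auto simp: case_prod_unfold intro!: continuous_intros)
next
  case (Suc k)
  show ?case
  proof (rule Ck_fam_SucI[OF U])
    show "Ck_fam 0 A S (\<lambda>a x. f a x \<bullet> c)"
      using Suc.prems by (auto simp: case_prod_unfold intro!: continuous_intros)
    show "((\<lambda>x. f a x \<bullet> c) has_derivative (\<lambda>v. D_within S (f a) x v \<bullet> c)) (at x within S)"
      if "a \<in> A" "x \<in> S" for a x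
      using that Suc.prems by (intro has_derivative_inner_left Ck_fam_has_derivative) auto
    show "Ck_fam k A S (\<lambda>a x. D_within S (f a) x v \<bullet> c)" for v
      by (rule Suc.IH) (use Suc.prems in auto)
  qed
qed

text \<open>The derivative of the inverse is a product of the inverse itself with the derivative of
  \<open>f\<close>, so the induction hypothesis for the same \<open>f\<close> is enough.\<close>

lemma Ck_fam_inverse:
  fixes f :: "'a::topological_space \<Rightarrow> 'v::real_normed_vector \<Rightarrow> real"
  assumes U: "unique_deriv S" and "Ck_fam k A S f"
    and nz: "\<And>a x. a \<in> A \<Longrightarrow> x \<in> S \<Longrightarrow> f a x \<noteq> 0"
  shows "Ck_fam k A S (\<lambda>a x. inverse (f a x))"
  using assms(2)
proof (induction k)
  case 0
  thus ?case using nz by (auto simp: case_prod_unfold intro!: continuous_intros)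
next
  case (Suc k)
  show ?case
  proof (rule Ck_fam_SucI[OF U])
    show "Ck_fam 0 A S (\<lambda>a x. inverse (f a x))"
      using Suc.prems nz by (auto simp: case_prod_unfold intro!: continuous_intros)
    show "((\<lambda>x. inverse (f a x)) has_derivative
        (\<lambda>v. - 1 * (inverse (f a x) * D_within S (f a) x v * inverse (f a x)))) (at x within S)"
      if "a \<in> A" "x \<in> S" for a x
      using that Suc.prems nz
        Deriv.has_derivative_inverse[OF nz[OF that] Ck_fam_has_derivative[OF Suc.prems _ that]] by simp
    have "Ck_fam k A S (\<lambda>a x. inverse (f a x))"
      by (rule Suc.IH) (rule Ck_fam_Suc_D[OF Suc.prems])
    thus "Ck_fam k A S (\<lambda>a x. - 1 * (inverse (f a x) * D_within S (f a) x v * inverse (f a x)))" for v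
      by (intro Ck_fam_mult[OF U] Ck_fam_D[OF Suc.prems] Ck_fam_const[OF U]) auto
  qed
qed

text \<open>The derivative of \<open>w\<close> is evaluated at a direction that itself depends on
  \<open>a\<close> and \<open>x\<close>. Expanding this direction along the basis leaves composites
  of \<open>f\<close> with derivatives of \<open>w\<close> in constant directions, to which the
  induction hypothesis applies; hence the induction generalises over \<open>w\<close>.\<close>

lemma Ck_fam_compose:
  fixes f :: "'a::topological_space \<Rightarrow> 'u::real_normed_vector \<Rightarrow> 'v::euclidean_space"
    and w :: "'b::topological_space \<Rightarrow> 'v \<Rightarrow> 'w::real_inner"
  assumes U: "unique_deriv S" and "Ck_fam k A S f" "Ck_fam k B S' w"
    and \<phi>: "continuous_on A \<phi>" "\<phi> ` A \<subseteq> B"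
    and f: "\<And>a x. a \<in> A \<Longrightarrow> x \<in> S \<Longrightarrow> f a x \<in> S'"
  shows "Ck_fam k A S (\<lambda>a x. w (\<phi> a) (f a x))"
proof -
  have zero: "Ck_fam 0 A S (\<lambda>a x. w (\<phi> a) (f a x))"
    if "Ck_fam 0 A S f" "Ck_fam 0 B S' w" for w :: "'b \<Rightarrow> 'v \<Rightarrow> 'w"
  proof -
    have "continuous_on (A \<times> S) (\<lambda>p. (\<phi> (fst p), case_prod f p))"
      using that(1) by (auto intro!: continuous_intros continuous_on_compose2[OF \<phi>(1)])
    with that(2) have "continuous_on (A \<times> S) (\<lambda>p. (\<lambda>(b, y). w b y) (\<phi> (fst p), case_prod f p))"
      unfolding Ck_fam.simps by (rule continuous_on_compose2) (use f \<phi> in auto)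
    thus ?thesis by (simp add: case_prod_unfold)
  qed
  show ?thesis using assms(2,3)
  proof (induction k arbitrary: w)
    case 0
    show ?case by (rule zero[OF 0])
  next
    case (Suc k)
    note f_k = Ck_fam_Suc_D[OF Suc.prems(1)]
    have D: "((\<lambda>x. w (\<phi> a) (f a x)) has_derivative
        (\<lambda>v. D_within S' (w (\<phi> a)) (f a x) (D_within S (f a) x v))) (at x within S)"
      if "a \<in> A" "x \<in> S" for a x
    proof -
      have 1: "(f a has_derivative D_within S (f a) x) (at x within S)"
        by (rule Ck_fam_has_derivative[OF Suc.prems(1) _ that]) auto
      have "(w (\<phi> a) has_derivative D_within S' (w (\<phi> a)) (f a x)) (at (f a x) within S')"
        by (rule Ck_fam_has_derivative[OF Suc.prems(2)]) (use that f \<phi> in auto)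
      hence 2: "(w (\<phi> a) has_derivative D_within S' (w (\<phi> a)) (f a x)) (at (f a x) within f a ` S)"
        by (rule has_derivative_subset) (use f that in auto)
      show ?thesis by (rule has_derivative_in_compose[OF 1 2])
    qed
    have Dsum: "D_within S' (w (\<phi> a)) (f a x) (D_within S (f a) x v) =
        (\<Sum>b\<in>Basis. (D_within S (f a) x v \<bullet> b) *\<^sub>R D_within S' (w (\<phi> a)) (f a x) b)"
      if "a \<in> A" "x \<in> S" for a x v
      by (rule D_within_basis_sum) (use f that \<phi> Suc.prems(2) in auto)
    show ?case
    proof (rule Ck_fam_SucI[OF U _ D])
      show "Ck_fam 0 A S (\<lambda>a x. w (\<phi> a) (f a x))"
        by (rule zero) (use Suc.prems in auto)
      fix v
      have "Ck_fam k A S (\<lambda>a x. \<Sum>b\<in>Basis. (D_within S (f a) x v \<bullet> b) *\<^sub>R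
          D_within S' (w (\<phi> a)) (f a x) b)"
        using Suc.IH[OF f_k Ck_fam_D[OF Suc.prems(2)]]
        by (intro Ck_fam_sum[OF U] Ck_fam_scaleR[OF U] Ck_fam_inner_const[OF U]
            Ck_fam_D[OF Suc.prems(1)])
      thus "Ck_fam k A S (\<lambda>a x. D_within S' (w (\<phi> a)) (f a x) (D_within S (f a) x v))"
        by (subst Ck_fam_cong[OF Dsum])
    qed
  qed
qed

lemma Ck_fam_basisI:
  fixes f :: "'a::topological_space \<Rightarrow> 'v::euclidean_space \<Rightarrow> 'w::real_inner"
  assumes U: "unique_deriv S" and cont: "Ck_fam 0 A S f"
    and diff: "\<And>a. a \<in> A \<Longrightarrow> f a differentiable_on S"
    and Ck: "\<And>b. b \<in> Basis \<Longrightarrow> Ck_fam k A S (\<lambda>a x. D_within S (f a) x b)"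
  shows "Ck_fam (Suc k) A S f"
proof -
  have "Ck_fam k A S (\<lambda>a x. D_within S (f a) x v)" for v
  proof -
    have "Ck_fam k A S (\<lambda>a x. \<Sum>b\<in>Basis. (v \<bullet> b) *\<^sub>R D_within S (f a) x b)"
      by (intro Ck_fam_sum[OF U] Ck_fam_scaleR[OF U] Ck Ck_fam_const[OF U]) auto
    thus ?thesis by (subst Ck_fam_cong[OF D_within_basis_sum]) (use diff in auto)
  qed
  thus ?thesis using cont diff by auto
qed

subsection \<open>Iterated derivatives and norms\<close>

text \<open>The head of the list is the direction differentiated last, whereas the recursion of
  \<open>Ck_fam\<close> strips the direction differentiated first; this equation moves between the
  two.\<close>

lemma iter_deriv_snoc:
  "iter_deriv S f (vs @ [v]) = iter_deriv S (\<lambda>x. D_within S f x v) vs"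
  by (induction vs) auto

lemma iter_deriv_cong:
  assumes "\<And>y. y \<in> S \<Longrightarrow> f y = g y" "x \<in> S"
  shows "iter_deriv S f vs x = iter_deriv S g vs x"
  using assms(2)
proof (induction vs arbitrary: x)
  case (Cons v vs)
  thus ?case using D_within_cong[of S "iter_deriv S f vs" "iter_deriv S g vs" x] by simp
qed (use assms in auto)

lemma Ck_fam_iter_deriv:
  assumes "Ck_fam k A S f" "length vs \<le> k"
  shows "Ck_fam (k - length vs) A S (\<lambda>a. iter_deriv S (f a) vs)"
  using assms(2)
proof (induction vs)
  case Nil
  thus ?case using assms(1) by simp
next
  case (Cons v vs)
  hence "k - length vs = Suc (k - length (v # vs))" by simp
  with Cons have "Ck_fam (Suc (k - length (v # vs))) A S (\<lambda>a. iter_deriv S (f a) vs)" by simp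
  from Ck_fam_D[OF this] show ?case by simp
qed

lemma Ck_fam_iter_deriv_0:
  assumes "Ck_fam k A S f" "length vs \<le> k"
  shows "continuous_on (A \<times> S) (\<lambda>(a, x). iter_deriv S (f a) vs x)"
  using Ck_fam_continuous[OF Ck_fam_iter_deriv[OF assms]] by simp

lemma iter_deriv_differentiable:
  assumes "Ck_fam k A S f" "length vs < k" "a \<in> A"
  shows "iter_deriv S (f a) vs differentiable_on S"
  using Ck_fam_differentiable[OF Ck_fam_iter_deriv[OF assms(1)], of vs] assms by simp

lemma Ck_fam_iff_iter_deriv:
  "Ck_fam k A S f \<longleftrightarrow>
     (\<forall>a\<in>A. \<forall>vs. length vs < k \<longrightarrow> iter_deriv S (f a) vs differentiable_on S) \<and>
     (\<forall>vs. length vs \<le> k \<longrightarrow> continuous_on (A \<times> S) (\<lambda>(a, x). iter_deriv S (f a) vs x))"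
    (is "_ \<longleftrightarrow> ?R k f")
proof
  show "Ck_fam k A S f \<Longrightarrow> ?R k f"
    using iter_deriv_differentiable Ck_fam_iter_deriv_0 by blast
  show "?R k f \<Longrightarrow> Ck_fam k A S f"
  proof (induction k arbitrary: f)
    case 0
    thus ?case using spec[of _ "[]"] by fastforce
  next
    case (Suc k)
    have "continuous_on (A \<times> S) (\<lambda>(a, x). iter_deriv S (f a) [] x)"
      and "\<forall>a\<in>A. iter_deriv S (f a) [] differentiable_on S"
      using Suc.prems by (metis list.size(3) zero_le) (metis Suc.prems list.size(3) zero_less_Suc)
    moreover have "Ck_fam k A S (\<lambda>a x. D_within S (f a) x v)" for v
    proof (rule Suc.IH, intro conjI ballI allI impI)
      show "iter_deriv S (\<lambda>x. D_within S (f a) x v) vs differentiable_on S"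
        if "a \<in> A" "length vs < k" for a vs
        using Suc.prems that by (simp flip: iter_deriv_snoc)
      show "continuous_on (A \<times> S) (\<lambda>(a, x). iter_deriv S (\<lambda>x. D_within S (f a) x v) vs x)"
        if "length vs \<le> k" for vs
        using Suc.prems that by (simp flip: iter_deriv_snoc)
    qed
    ultimately show ?case by simp
  qed
qed

text \<open>A single map is a family over a one-point space, so the calculus of families also serves
  for maps; the point is later taken to be \<open>0::real\<close>.\<close>

lemma Cr_on_iff_Ck_fam: "Cr_on r S f \<longleftrightarrow> Ck_fam r {a} S (\<lambda>_. f)"
proof -
  have "continuous_on ({a} \<times> S) (\<lambda>(a, x). g x) \<longleftrightarrow> continuous_on S g" for g :: "'a \<Rightarrow> 'b"
  proof
    assume "continuous_on ({a} \<times> S) (\<lambda>(a, x). g x)"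
    moreover have "continuous_on S (Pair a)" "Pair a ` S \<subseteq> {a} \<times> S"
      by (auto intro!: continuous_intros)
    ultimately show "continuous_on S g"
      using continuous_on_compose2[of "{a} \<times> S" "\<lambda>(a, x). g x" S "Pair a"] by simp
  next
    assume "continuous_on S g"
    thus "continuous_on ({a} \<times> S) (\<lambda>(a, x). g x)"
      unfolding case_prod_unfold
      by (rule continuous_on_compose2) (auto intro!: continuous_intros)
  qed
  thus ?thesis unfolding Cr_on_def Ck_fam_iff_iter_deriv by simp
qed

lemma Ck_fam_imp_Cr_on: 
  assumes "Ck_fam r A S f" "a \<in> A"
  shows "Cr_on r S (f a)"
proof -
  have "Ck_fam r {a} S f" using assms by (auto intro: Ck_fam_subset)
  hence "Ck_fam r {a} S (\<lambda>_. f a)" by (subst Ck_fam_cong[where g = f]) auto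
  thus ?thesis using Cr_on_iff_Ck_fam by blast
qed

lemma iter_deriv_add:
  assumes U: "unique_deriv S" and "Ck_fam k A S f" "Ck_fam k A S g" "length vs \<le> k"
    and "a \<in> A" "x \<in> S"
  shows "iter_deriv S (\<lambda>x. f a x + g a x) vs x = iter_deriv S (f a) vs x + iter_deriv S (g a) vs x"
  using assms(4,6)
proof (induction vs arbitrary: x)
  case (Cons v vs)
  have "D_within S (iter_deriv S (\<lambda>x. f a x + g a x) vs) x =
      D_within S (\<lambda>x. iter_deriv S (f a) vs x + iter_deriv S (g a) vs x) x"
    by (rule D_within_cong) (use Cons in auto)
  also have "\<dots> = (\<lambda>v. D_within S (iter_deriv S (f a) vs) x v + D_within S (iter_deriv S (g a) vs) x v)"
    using Cons.prems assms(2,3,5)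
    by (intro D_within_eq[OF U] has_derivative_add has_derivative_D_within
        iter_deriv_differentiable[where k = k and A = A]) auto
  finally show ?case by simp
qed simp

lemma iter_deriv_scaleR:
  assumes U: "unique_deriv S" and "Ck_fam k A S f" "length vs \<le> k" and "a \<in> A" "x \<in> S"
  shows "iter_deriv S (\<lambda>x. c *\<^sub>R f a x) vs x = c *\<^sub>R iter_deriv S (f a) vs x"
  using assms(3,5)
proof (induction vs arbitrary: x)
  case (Cons v vs)
  have "D_within S (iter_deriv S (\<lambda>x. c *\<^sub>R f a x) vs) x =
      D_within S (\<lambda>x. c *\<^sub>R iter_deriv S (f a) vs x) x"
    by (rule D_within_cong) (use Cons in auto)
  also have "\<dots> = (\<lambda>v. c *\<^sub>R D_within S (iter_deriv S (f a) vs) x v)"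
    using Cons.prems assms(2,4)
    by (intro D_within_eq[OF U] has_derivative_scaleR_right has_derivative_D_within
        iter_deriv_differentiable[where k = k and A = A]) auto
  finally show ?case by simp
qed simp

lemma iter_deriv_diff:
  assumes U: "unique_deriv S" and "Ck_fam k A S f" "Ck_fam k A S g" "length vs \<le> k"
    and "a \<in> A" "x \<in> S"
  shows "iter_deriv S (\<lambda>x. f a x - g a x) vs x = iter_deriv S (f a) vs x - iter_deriv S (g a) vs x"
proof -
  have "Ck_fam k A S (\<lambda>a x. (-1) *\<^sub>R g a x)"
    by (intro Ck_fam_scaleR[OF U] Ck_fam_const[OF U] assms) auto
  from iter_deriv_add[OF U assms(2) this assms(4,5,6)]
    iter_deriv_scaleR[OF U assms(3,4,5,6), of "-1"]
  show ?thesis by simp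
qed

lemma Ck_fam_diff:
  assumes U: "unique_deriv S" and "Ck_fam k A S f" "Ck_fam k A S g"
  shows "Ck_fam k A S (\<lambda>a x. f a x - g a x)"
proof -
  have "Ck_fam k A S (\<lambda>a x. (-1) *\<^sub>R g a x)"
    by (intro Ck_fam_scaleR[OF U] Ck_fam_const[OF U] assms) auto
  from Ck_fam_add[OF U assms(2) this] show ?thesis by simp
qed

lemma iter_deriv_sum:
  fixes f :: "'i \<Rightarrow> 'a::topological_space \<Rightarrow> 'v::real_normed_vector \<Rightarrow> 'w::real_inner"
  assumes U: "unique_deriv S" and "finite I" "\<And>i. i \<in> I \<Longrightarrow> Ck_fam k A S (f i)" "length vs \<le> k"
    and "a \<in> A" "x \<in> S"
  shows "iter_deriv S (\<lambda>x. \<Sum>i\<in>I. f i a x) vs x = (\<Sum>i\<in>I. iter_deriv S (f i a) vs x)"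
  using assms(2,3)
proof (induction I)
  case empty
  have "Ck_fam k A S (\<lambda>a x. 0 :: 'w)" by (intro Ck_fam_const[OF U]) auto
  from iter_deriv_scaleR[OF U this assms(4-6), of 0] show ?case by simp
next
  case (insert i I)
  have "Ck_fam k A S (\<lambda>a x. \<Sum>i\<in>I. f i a x)" by (intro Ck_fam_sum[OF U]) (use insert in auto)
  from iter_deriv_add[OF U _ this assms(4-6), of "f i"] insert show ?case by simp
qed

section \<open>Expansion of iterated derivatives along basis vectors\<close>

definition basis_lists :: "nat \<Rightarrow> 'v::euclidean_space list set" where
  "basis_lists n = {bs. set bs \<subseteq> Basis \<and> length bs = n}"

lemma finite_basis_lists [simp]: "finite (basis_lists n)"
  unfolding basis_lists_def by (rule finite_lists_length_eq) simp

lemma card_basis_lists: "card (basis_lists n :: 'v::euclidean_space list set) = DIM('v) ^ n"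
  unfolding basis_lists_def by (rule card_lists_length_eq) simp

lemma sum_basis_lists_Suc:
  "(\<Sum>bs\<in>basis_lists (Suc n). g bs) = (\<Sum>bs\<in>basis_lists n. \<Sum>b\<in>Basis. g (b # bs))"
proof -
  have "(\<Sum>bs\<in>basis_lists (Suc n). g bs) =
      sum g ((\<lambda>(bs, b). b # bs) ` (basis_lists n \<times> Basis))"
    unfolding basis_lists_def lists_length_Suc_eq ..
  also have "\<dots> = (\<Sum>(bs, b)\<in>basis_lists n \<times> Basis. g (b # bs))"
    by (subst sum.reindex) (auto intro!: sum.cong inj_onI)
  finally show ?thesis by (simp add: sum.cartesian_product)
qed

text \<open>The coefficient of a basis list in the multilinear expansion of an iterated
  derivative.\<close>

fun inner_lists :: "'v::real_inner list \<Rightarrow> 'v list \<Rightarrow> real" where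
  "inner_lists (v # vs) (b # bs) = (v \<bullet> b) * inner_lists vs bs"
| "inner_lists _ _ = 1"

lemma abs_inner_lists_le:
  assumes "\<And>v. v \<in> set vs \<Longrightarrow> norm v \<le> 1" "set bs \<subseteq> Basis"
  shows "\<bar>inner_lists vs bs\<bar> \<le> 1"
  using assms
proof (induction vs bs rule: inner_lists.induct)
  case (1 v vs b bs)
  have "\<bar>v \<bullet> b\<bar> \<le> norm v" using "1.prems" by (intro Basis_le_norm) auto
  also have "\<dots> \<le> 1" using "1.prems" by auto
  finally show ?case using 1 by (auto simp: abs_mult intro!: mult_le_one)
qed auto

lemma iter_deriv_basis_expansion:
  fixes f :: "'a::topological_space \<Rightarrow> 'v::euclidean_space \<Rightarrow> 'w::real_inner"
  assumes U: "unique_deriv S" and f: "Ck_fam k A S f" and "length vs \<le> k" "a \<in> A" "x \<in> S"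
  shows "iter_deriv S (f a) vs x =
    (\<Sum>bs\<in>basis_lists (length vs). inner_lists vs bs *\<^sub>R iter_deriv S (f a) bs x)"
  using assms(3,5)
proof (induction vs arbitrary: x)
  case Nil
  have "basis_lists 0 = {[] :: 'v list}" by (auto simp: basis_lists_def)
  thus ?case by simp
next
  case (Cons v vs)
  have diff: "iter_deriv S (f a) bs differentiable_on S" if "bs \<in> basis_lists (length vs)" for bs
    using iter_deriv_differentiable[OF f _ \<open>a \<in> A\<close>, of bs] that Cons.prems
    by (simp add: basis_lists_def)
  have "D_within S (iter_deriv S (f a) vs) x =
    D_within S (\<lambda>x. \<Sum>bs\<in>basis_lists (length vs). inner_lists vs bs *\<^sub>R iter_deriv S (f a) bs x) x"
    by (rule D_within_cong) (use Cons in auto)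
  also have "\<dots> = (\<lambda>v. \<Sum>bs\<in>basis_lists (length vs). inner_lists vs bs *\<^sub>R D_within S (iter_deriv S (f a) bs) x v)"
    using Cons.prems diff
    by (intro D_within_eq[OF U] has_derivative_sum has_derivative_scaleR_right
        has_derivative_D_within) auto
  finally have "D_within S (iter_deriv S (f a) vs) x v =
      (\<Sum>bs\<in>basis_lists (length vs). inner_lists vs bs *\<^sub>R D_within S (iter_deriv S (f a) bs) x v)"
    by simp
  also have "\<dots> = (\<Sum>bs\<in>basis_lists (length vs). \<Sum>b\<in>Basis.
      inner_lists (v # vs) (b # bs) *\<^sub>R iter_deriv S (f a) (b # bs) x)"
    by (intro sum.cong refl, subst D_within_basis_sum)
      (use diff Cons.prems in \<open>auto simp: scaleR_sum_right mult_ac\<close>)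
  finally show ?case by (simp only: iter_deriv.simps length_Cons sum_basis_lists_Suc)
qed

text \<open>The expansion has \<open>DIM('v) ^ length vs\<close> terms with coefficients at most 1.
  The exponent is raised to \<open>k\<close> so that one constant serves all orders.\<close>

lemma norm_iter_deriv_le_basis:
  fixes f :: "'a::topological_space \<Rightarrow> 'v::euclidean_space \<Rightarrow> 'w::real_inner"
  assumes U: "unique_deriv S" and f: "Ck_fam k A S f" and "length vs \<le> k" "a \<in> A" "x \<in> S"
    and v: "\<And>v. v \<in> set vs \<Longrightarrow> norm v \<le> 1"
    and e: "\<And>bs. bs \<in> basis_lists (length vs) \<Longrightarrow> norm (iter_deriv S (f a) bs x) \<le> e" "0 \<le> e"
  shows "norm (iter_deriv S (f a) vs x) \<le> real DIM('v) ^ k * e"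
proof -
  have "norm (iter_deriv S (f a) vs x) \<le>
    (\<Sum>bs\<in>basis_lists (length vs). norm (inner_lists vs bs *\<^sub>R iter_deriv S (f a) bs x))"
    unfolding iter_deriv_basis_expansion[OF U f assms(3-5)] by (rule norm_sum)
  also have "\<dots> \<le> (\<Sum>bs\<in>(basis_lists (length vs) :: 'v list set). (1::real) * e)"
    unfolding norm_scaleR
    by (intro sum_mono mult_mono e) (use abs_inner_lists_le[OF v] e in \<open>auto simp: basis_lists_def\<close>)
  also have "\<dots> = real DIM('v) ^ length vs * e" by (simp add: card_basis_lists)
  also have "\<dots> \<le> real DIM('v) ^ k * e"
    using assms(3) e(2) by (intro mult_right_mono power_increasing) auto
  finally show ?thesis .
qed

section \<open>The norm of $C^r$ and joint continuity of the derivatives\<close>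

lemma Ck_fam_bounded_basis:
  fixes f :: "'a::topological_space \<Rightarrow> 'v::euclidean_space \<Rightarrow> 'w::real_inner"
  assumes "compact A" "compact S" and f: "Ck_fam k A S f"
  obtains M where "M \<ge> 0"
    "\<And>bs a x. set bs \<subseteq> Basis \<Longrightarrow> length bs \<le> k \<Longrightarrow> a \<in> A \<Longrightarrow> x \<in> S \<Longrightarrow>
      norm (iter_deriv S (f a) bs x) \<le> M"
proof -
  let ?B = "{bs :: 'v list. set bs \<subseteq> Basis \<and> length bs \<le> k}"
  have fin: "finite ?B" by (rule finite_lists_length_le) simp
  have "compact (\<Union>bs\<in>?B. (\<lambda>(a, x). iter_deriv S (f a) bs x) ` (A \<times> S))"
    by (intro compact_UN fin compact_continuous_image compact_Times assms Ck_fam_iter_deriv_0[OF f]) auto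
  hence "bounded (\<Union>bs\<in>?B. (\<lambda>(a, x). iter_deriv S (f a) bs x) ` (A \<times> S))"
    by (rule compact_imp_bounded)
  then obtain M where "\<forall>y\<in>(\<Union>bs\<in>?B. (\<lambda>(a, x). iter_deriv S (f a) bs x) ` (A \<times> S)). norm y \<le> M"
    unfolding bounded_iff by blast
  hence M: "norm (iter_deriv S (f a) bs x) \<le> M"
    if "set bs \<subseteq> Basis" "length bs \<le> k" "a \<in> A" "x \<in> S" for bs a x
    using that by (auto simp: ball_Un)
  show ?thesis by (rule that[of "max M 0"]) (auto intro: M max.coboundedI1)
qed

text \<open>The suprema in \<open>Cr_norm\<close> run over infinitely many points and lists, and
  dominate their members only once they are known to be bounded. Compactness of \<open>S\<close>
  bounds the finitely many basis derivatives, and these bound all others.\<close>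

lemma norm_iter_deriv_le_Cr_norm:
  fixes g :: "'v::euclidean_space \<Rightarrow> 'w::euclidean_space"
  assumes U: "unique_deriv S" and "compact S" and g: "Cr_on r S g"
    and "length vs \<le> r" "\<And>v. v \<in> set vs \<Longrightarrow> norm v \<le> 1" "x \<in> S"
  shows "norm (iter_deriv S g vs x) \<le> Cr_norm r S g"
proof -
  note g' = g[unfolded Cr_on_iff_Ck_fam[where a = "0::real"]]
  obtain M where M: "M \<ge> 0" "\<And>bs x. set bs \<subseteq> Basis \<Longrightarrow> length bs \<le> r \<Longrightarrow> x \<in> S \<Longrightarrow>
      norm (iter_deriv S g bs x) \<le> M"
    using Ck_fam_bounded_basis[OF compact_sing \<open>compact S\<close> g'] by (metis singletonI)
  let ?K = "real DIM('v) ^ r * M"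
  let ?V = "\<lambda>i. {vs::'v list. length vs = i \<and> (\<forall>v\<in>set vs. norm v \<le> 1)}"
  have le: "norm (iter_deriv S g vs x) \<le> ?K" if "vs \<in> ?V i" "i \<le> r" "x \<in> S" for vs i x
    using that norm_iter_deriv_le_basis[OF U g', of vs "0::real" x M] M
    by (auto simp: basis_lists_def)
  have bdd: "bdd_above ((\<lambda>vs. norm (iter_deriv S g vs x)) ` ?V i)" if "i \<le> r" "x \<in> S" for i x
    by (rule bdd_aboveI2[of _ _ ?K]) (rule le[OF _ that])
  have "replicate i 0 \<in> ?V i" for i by auto
  hence ne: "?V i \<noteq> {}" for i by blast
  have d_le: "deriv_norm S i g x \<le> ?K" if "i \<le> r" "x \<in> S" for i x
    unfolding deriv_norm_def by (rule cSUP_least[OF ne le[OF _ that]])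
  have "norm (iter_deriv S g vs x) \<le> deriv_norm S (length vs) g x"
    unfolding deriv_norm_def by (rule cSUP_upper[OF _ bdd]) (use assms in auto)
  also have "\<dots> \<le> (SUP x\<in>S. deriv_norm S (length vs) g x)"
    by (rule cSUP_upper[OF \<open>x \<in> S\<close> bdd_aboveI2[of _ _ ?K]]) (rule d_le[OF assms(4)])
  also have "\<dots> \<le> Cr_norm r S g"
    unfolding Cr_norm_def by (rule Max_ge) (use assms(4) in auto)
  finally show ?thesis .
qed

lemma Cr_norm_le:
  fixes g :: "'v::euclidean_space \<Rightarrow> 'w::euclidean_space"
  assumes U: "unique_deriv S" and "S \<noteq> {}" and g: "Cr_on r S g"
    and e: "\<And>bs x. set bs \<subseteq> Basis \<Longrightarrow> length bs \<le> r \<Longrightarrow> x \<in> S \<Longrightarrow> norm (iter_deriv S g bs x) \<le> e"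
    "0 \<le> e"
  shows "Cr_norm r S g \<le> real DIM('v) ^ r * e"
proof -
  note g' = g[unfolded Cr_on_iff_Ck_fam[where a = "0::real"]]
  let ?V = "\<lambda>i. {vs::'v list. length vs = i \<and> (\<forall>v\<in>set vs. norm v \<le> 1)}"
  have "replicate i 0 \<in> ?V i" for i by auto
  hence ne: "?V i \<noteq> {}" for i by blast
  have "deriv_norm S i g x \<le> real DIM('v) ^ r * e" if "i \<le> r" "x \<in> S" for i x
    unfolding deriv_norm_def
  proof (rule cSUP_least[OF ne])
    fix vs assume "vs \<in> ?V i"
    thus "norm (iter_deriv S g vs x) \<le> real DIM('v) ^ r * e"
      using norm_iter_deriv_le_basis[OF U g', of vs "0::real" x e] e that by (auto simp: basis_lists_def)
  qed
  hence "(SUP x\<in>S. deriv_norm S i g x) \<le> real DIM('v) ^ r * e" if "i \<le> r" for i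
    using that by (intro cSUP_least \<open>S \<noteq> {}\<close>) auto
  thus ?thesis unfolding Cr_norm_def by (subst Max_le_iff) auto
qed

text \<open>By compactness of \<open>S\<close>, joint continuity makes the derivatives at
  \<open>b\<close> uniformly close on \<open>S\<close> to those at \<open>a\<close> for
  \<open>b\<close> near \<open>a\<close>. It is enough to do this for the finitely many basis
  lists.\<close>

lemma Ck_fam_imp_Cr_families:
  fixes f :: "'a::metric_space \<Rightarrow> 'v::euclidean_space \<Rightarrow> 'w::euclidean_space"
  assumes U: "unique_deriv S" and "compact S" "S \<noteq> {}" and f: "Ck_fam r A S f"
  shows "f \<in> Cr_families r A S"
  unfolding Cr_families_def
proof (intro CollectI conjI ballI)
  fix a assume a: "a \<in> A"
  show "Cr_on r S (f a)" by (rule Ck_fam_imp_Cr_on[OF f a])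
  have C: "Cr_on r S (\<lambda>x. f b x - f a x)" if "b \<in> A" for b
  proof -
    have "Ck_fam r {b} S f" using f that by (auto intro: Ck_fam_subset)
    moreover have "Ck_fam r {b} S (\<lambda>_. f a)"
      using Ck_fam_imp_Cr_on[OF f a] Cr_on_iff_Ck_fam by blast
    ultimately have "Ck_fam r {b} S (\<lambda>b x. f b x - f a x)" by (rule Ck_fam_diff[OF U])
    from Ck_fam_imp_Cr_on[OF this] show ?thesis by simp
  qed
  have D: "iter_deriv S (\<lambda>x. f b x - f a x) bs x = iter_deriv S (f b) bs x - iter_deriv S (f a) bs x"
    if "b \<in> A" "length bs \<le> r" "x \<in> S" for b bs x
  proof -
    have "Ck_fam r {b} S f" using f that by (auto intro: Ck_fam_subset)
    moreover have "Ck_fam r {b} S (\<lambda>_. f a)"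
      using Ck_fam_imp_Cr_on[OF f a] Cr_on_iff_Ck_fam by blast
    ultimately show ?thesis using iter_deriv_diff[OF U _ _ that(2), of "{b}" f "\<lambda>_. f a" b x] that by simp
  qed
  show "((\<lambda>b. Cr_norm r S (\<lambda>x. f b x - f a x)) \<longlongrightarrow> 0) (at a within A)"
  proof (rule tendstoI)
    fix e :: real assume "e > 0"
    \<comment> \<open>The power of the dimension offsets the loss in \<open>Cr_norm_le\<close>; the
      factor 2 makes the final inequality strict.\<close>
    define d where "d = e / (2 * real DIM('v) ^ r)"
    have "d > 0" using \<open>e > 0\<close> by (simp add: d_def)
    let ?B = "{bs :: 'v list. set bs \<subseteq> Basis \<and> length bs \<le> r}"
    have fin: "finite ?B" by (rule finite_lists_length_le) simp
    have "\<forall>\<^sub>F b in at a within A. \<forall>x\<in>S. norm (iter_deriv S (f b) bs x - iter_deriv S (f a) bs x) \<le> d"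
      if bs: "bs \<in> ?B" for bs
    proof -
      have "continuous_on (A \<times> S) (\<lambda>(a, x). iter_deriv S (f a) bs x)"
        by (rule Ck_fam_iter_deriv_0[OF f]) (use bs in auto)
      from continuous_on_prod_compactE[OF this \<open>compact S\<close> a \<open>d > 0\<close>]
      obtain X where "a \<in> X" "open X" "\<forall>b\<in>X \<inter> A. \<forall>x\<in>S.
          dist (case (b, x) of (a, x) \<Rightarrow> iter_deriv S (f a) bs x)
            (case (a, x) of (a, x) \<Rightarrow> iter_deriv S (f a) bs x) \<le> d"
        by metis
      thus ?thesis unfolding eventually_at_topological dist_norm by auto
    qed
    hence "\<forall>\<^sub>F b in at a within A. \<forall>bs\<in>?B. \<forall>x\<in>S.
        norm (iter_deriv S (f b) bs x - iter_deriv S (f a) bs x) \<le> d"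
      by - (rule eventually_ball_finite[OF fin], blast)
    moreover have "\<forall>\<^sub>F b in at a within A. b \<in> A" by (simp add: eventually_at_filter)
    ultimately show "\<forall>\<^sub>F b in at a within A. dist (Cr_norm r S (\<lambda>x. f b x - f a x)) 0 < e"
    proof eventually_elim
      case (elim b)
      have "Cr_norm r S (\<lambda>x. f b x - f a x) \<le> real DIM('v) ^ r * d"
        by (rule Cr_norm_le[OF U \<open>S \<noteq> {}\<close> C]) (use elim D \<open>d > 0\<close> in auto)
      also have "\<dots> < e" using \<open>e > 0\<close> by (simp add: d_def)
      finally have "Cr_norm r S (\<lambda>x. f b x - f a x) < e" .
      moreover obtain x where "x \<in> S" using \<open>S \<noteq> {}\<close> by blast
      hence "0 \<le> Cr_norm r S (\<lambda>x. f b x - f a x)"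
        using norm_iter_deriv_le_Cr_norm[OF U \<open>compact S\<close> C, of b "[]" x] elim
        by (smt (verit) all_not_in_conv list.set(1) list.size(3) norm_ge_zero zero_le)
      ultimately show ?case by (simp add: dist_real_def)
    qed
  qed
qed

lemma Ck_fam_basis_listsI:
  fixes f :: "'a::topological_space \<Rightarrow> 'v::euclidean_space \<Rightarrow> 'w::euclidean_space"
  assumes U: "unique_deriv S" and C: "\<And>a. a \<in> A \<Longrightarrow> Cr_on r S (f a)"
    and basis: "\<And>bs. set bs \<subseteq> Basis \<Longrightarrow> length bs \<le> r \<Longrightarrow>
      continuous_on (A \<times> S) (\<lambda>(a, x). iter_deriv S (f a) bs x)"
  shows "Ck_fam r A S f"
  unfolding Ck_fam_iff_iter_deriv
proof (intro conjI ballI allI impI)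
  show "iter_deriv S (f a) vs differentiable_on S" if "a \<in> A" "length vs < r" for a vs
    using C that by (simp add: Cr_on_def)
  fix vs :: "'v list" assume vs: "length vs \<le> r"
  have C': "Ck_fam r {0::real} S (\<lambda>_. f a)" if "a \<in> A" for a
    using C[OF that] Cr_on_iff_Ck_fam by blast
  have "continuous_on (A \<times> S) (\<lambda>p. \<Sum>bs\<in>basis_lists (length vs). inner_lists vs bs *\<^sub>R
      (case p of (a, x) \<Rightarrow> iter_deriv S (f a) bs x))"
    by (intro continuous_on_sum continuous_on_scaleR continuous_on_const basis)
      (use vs in \<open>auto simp: basis_lists_def\<close>)
  moreover have "iter_deriv S (f a) vs x =
      (\<Sum>bs\<in>basis_lists (length vs). inner_lists vs bs *\<^sub>R iter_deriv S (f a) bs x)"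
    if "a \<in> A" "x \<in> S" for a x
    using iter_deriv_basis_expansion[OF U C'[OF that(1)] vs _ that(2)] by simp
  ultimately show "continuous_on (A \<times> S) (\<lambda>(a, x). iter_deriv S (f a) vs x)"
    by (subst continuous_on_cong[OF refl]) auto
qed

text \<open>Half of \<open>e\<close> is spent on changing the parameter, uniformly in the point by
  the norm, and half on moving the point for the fixed parameter \<open>a\<close>.\<close>

lemma Cr_families_imp_Ck_fam:
  fixes f :: "'a::metric_space \<Rightarrow> 'v::euclidean_space \<Rightarrow> 'w::euclidean_space"
  assumes U: "unique_deriv S" and "compact S" and f: "f \<in> Cr_families r A S"
  shows "Ck_fam r A S f"
proof (rule Ck_fam_basis_listsI[OF U])
  show C: "Cr_on r S (f a)" if "a \<in> A" for a using f that by (simp add: Cr_families_def)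
  have C': "Ck_fam r {b} S (\<lambda>_. f a)" if "a \<in> A" for a and b :: real
    using C[OF that] Cr_on_iff_Ck_fam by blast
  show "continuous_on (A \<times> S) (\<lambda>(a, x). iter_deriv S (f a) bs x)"
    if bs: "set bs \<subseteq> Basis" and len: "length bs \<le> r" for bs
    unfolding continuous_on_iff
  proof (intro ballI allI impI, clarify)
    fix a x and e :: real assume a: "a \<in> A" and x: "x \<in> S" and "0 < e"
    have "((\<lambda>b. Cr_norm r S (\<lambda>x. f b x - f a x)) \<longlongrightarrow> 0) (at a within A)"
      using f a by (simp add: Cr_families_def)
    from tendstoD[OF this half_gt_zero[OF \<open>0 < e\<close>]] obtain d where d: "d > 0"
      "\<And>b. b \<in> A \<Longrightarrow> b \<noteq> a \<Longrightarrow> dist b a < d \<Longrightarrow> \<bar>Cr_norm r S (\<lambda>x. f b x - f a x)\<bar> < e / 2"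
      unfolding eventually_at by auto
    have "continuous_on S (iter_deriv S (f a) bs)"
      using C[OF a] len by (simp add: Cr_on_def)
    then obtain d' where d': "d' > 0"
      "\<And>y. y \<in> S \<Longrightarrow> dist y x < d' \<Longrightarrow> dist (iter_deriv S (f a) bs y) (iter_deriv S (f a) bs x) < e / 2"
      using x \<open>0 < e\<close> unfolding continuous_on_iff by (meson half_gt_zero)
    have "dist (iter_deriv S (f b) bs y) (iter_deriv S (f a) bs x) < e"
      if b: "b \<in> A" and y: "y \<in> S" and dist: "dist (b, y) (a, x) < min d d'" for b y
    proof -
      have "dist b a < d" "dist y x < d'"
        using dist dist_fst_le[of "(b, y)" "(a, x)"] dist_snd_le[of "(b, y)" "(a, x)"] by auto
      have "dist (iter_deriv S (f b) bs y) (iter_deriv S (f a) bs y) < e / 2"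
      \<comment> \<open>The limit along \<open>at a within A\<close> says nothing at
        \<open>a\<close> itself.\<close>
      proof (cases "b = a")
        case False
        have "Cr_on r S (\<lambda>x. f b x - f a x)"
          unfolding Cr_on_iff_Ck_fam[where a = "0::real"] by (rule Ck_fam_diff[OF U C' C']) (use a b in auto)
        moreover have "norm v \<le> 1" if "v \<in> set bs" for v
          using bs that by auto
        ultimately have "norm (iter_deriv S (\<lambda>x. f b x - f a x) bs y) \<le> Cr_norm r S (\<lambda>x. f b x - f a x)"
          by (intro norm_iter_deriv_le_Cr_norm[OF U \<open>compact S\<close> _ len _ y])
        moreover have "iter_deriv S (\<lambda>x. f b x - f a x) bs y = iter_deriv S (f b) bs y - iter_deriv S (f a) bs y"
          by (rule iter_deriv_diff[OF U C'[OF b] C'[OF a] len _ y]) auto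
        ultimately show ?thesis using d(2)[OF b False \<open>dist b a < d\<close>] by (simp add: dist_norm)
      qed (use \<open>0 < e\<close> in auto)
      with d'(2)[OF y \<open>dist y x < d'\<close>] show ?thesis
        by (meson dist_triangle_half_r dist_commute_lessI dist_triangle_half_l)
    qed
    thus "\<exists>d>0. \<forall>y\<in>A \<times> S. dist y (a, x) < d \<longrightarrow>
        dist (case y of (a, x) \<Rightarrow> iter_deriv S (f a) bs x) (iter_deriv S (f a) bs x) < e"
      using d(1) d'(1) by (intro exI[of _ "min d d'"]) auto
  qed
qed

lemma Cr_norm_le_family_norm:
  fixes g :: "'a::metric_space \<Rightarrow> 'v::euclidean_space \<Rightarrow> 'w::euclidean_space"
  assumes U: "unique_deriv S" and "compact S" "S \<noteq> {}" "compact A" and g: "Ck_fam r A S g"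
    and a: "a \<in> A"
  shows "Cr_norm r S (g a) \<le> family_norm r A S g"
proof -
  obtain M where M: "M \<ge> 0" "\<And>bs a x. set bs \<subseteq> Basis \<Longrightarrow> length bs \<le> r \<Longrightarrow> a \<in> A \<Longrightarrow> x \<in> S \<Longrightarrow>
      norm (iter_deriv S (g a) bs x) \<le> M"
    using Ck_fam_bounded_basis[OF \<open>compact A\<close> \<open>compact S\<close> g] by metis
  have "Cr_norm r S (g a) \<le> real DIM('v) ^ r * M" if "a \<in> A" for a
    by (rule Cr_norm_le[OF U \<open>S \<noteq> {}\<close> Ck_fam_imp_Cr_on[OF g that]]) (use M that in auto)
  thus ?thesis unfolding family_norm_def by (intro cSUP_upper a bdd_aboveI2)
qed

lemma family_norm_le:
  fixes g :: "'a::metric_space \<Rightarrow> 'v::euclidean_space \<Rightarrow> 'w::euclidean_space"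
  assumes U: "unique_deriv S" and "S \<noteq> {}" "A \<noteq> {}" and g: "Ck_fam r A S g"
    and e: "\<And>bs a x. set bs \<subseteq> Basis \<Longrightarrow> length bs \<le> r \<Longrightarrow> a \<in> A \<Longrightarrow> x \<in> S \<Longrightarrow>
      norm (iter_deriv S (g a) bs x) \<le> e" "0 \<le> e"
  shows "family_norm r A S g \<le> real DIM('v) ^ r * e"
  unfolding family_norm_def
  by (intro cSUP_least \<open>A \<noteq> {}\<close> Cr_norm_le[OF U \<open>S \<noteq> {}\<close> Ck_fam_imp_Cr_on[OF g]]) (use e in auto)

subsection \<open>Limits, cohomological equations and mixed derivatives\<close>

lemma uniform_limit_geometric:
  fixes s :: "nat \<Rightarrow> 'x \<Rightarrow> 'w::banach"
  assumes s: "\<And>n x. x \<in> X \<Longrightarrow> norm (s (Suc n) x - s n x) \<le> M * \<theta> ^ n" and "0 \<le> \<theta>" "\<theta> < 1"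
  obtains l where "uniform_limit X s l sequentially"
proof -
  have "uniform_limit X (\<lambda>n x. \<Sum>i<n. s (Suc i) x - s i x) (\<lambda>x. \<Sum>i. s (Suc i) x - s i x) sequentially"
    by (rule Weierstrass_m_test[OF s]) (use assms in \<open>auto intro!: summable_mult summable_geometric\<close>)
  hence "uniform_limit X (\<lambda>n x. (\<Sum>i<n. s (Suc i) x - s i x) + s 0 x)
      (\<lambda>x. (\<Sum>i. s (Suc i) x - s i x) + s 0 x) sequentially"
    by (intro uniform_limit_intros)
  hence "uniform_limit X s (\<lambda>x. (\<Sum>i. s (Suc i) x - s i x) + s 0 x) sequentially"
    by (simp add: sum_lessThan_telescope[of "\<lambda>i. s i _"])
  thus ?thesis by (rule that)
qed

lemma compact_uniform_less:
  fixes g :: "'x::topological_space \<Rightarrow> real"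
  assumes "compact K" "continuous_on K g" "\<And>x. x \<in> K \<Longrightarrow> g x < c"
  obtains c' where "c' < c" "\<And>x. x \<in> K \<Longrightarrow> g x \<le> c'"
proof (cases "K = {}")
  case True
  thus ?thesis using that[of "c - 1"] by simp
next
  case False
  from continuous_attains_sup[OF assms(1) False assms(2)] obtain x where
    "x \<in> K" "\<forall>y\<in>K. g y \<le> g x" by blast
  thus ?thesis using that[of "g x"] assms(3) by blast
qed

text \<open>The right-hand side is a contraction of the continuous functions on \<open>A\<close>,
  with a uniform rate by compactness; its iterates from 0 converge uniformly. The map
  \<open>\<phi>\<close> stands for either direction of the dynamics.\<close>

lemma cohomological_solution:
  fixes \<nu> b :: "'a::topological_space \<Rightarrow> real"
  assumes "compact A" and \<phi>: "continuous_on A \<phi>" "\<phi> ` A \<subseteq> A"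
    and \<nu>: "continuous_on A \<nu>" "\<And>a. a \<in> A \<Longrightarrow> \<bar>\<nu> a\<bar> < 1" and b: "continuous_on A b"
  obtains q where "continuous_on A q" "\<And>a. a \<in> A \<Longrightarrow> q a = \<nu> a * q (\<phi> a) + b a"
proof -
  obtain \<theta>' where "\<theta>' < 1" "\<And>a. a \<in> A \<Longrightarrow> \<bar>\<nu> a\<bar> \<le> \<theta>'"
    using compact_uniform_less[OF \<open>compact A\<close>, of "\<lambda>a. \<bar>\<nu> a\<bar>" 1] \<nu>
    by (metis continuous_on_rabs)
  \<comment> \<open>The rate has to be nonnegative for the geometric series; the bound found so far
    may be negative when \<open>A\<close> is empty.\<close>
  then obtain \<theta> where \<theta>: "0 \<le> \<theta>" "\<theta> < 1" "\<And>a. a \<in> A \<Longrightarrow> \<bar>\<nu> a\<bar> \<le> \<theta>"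
    by (metis linorder_le_cases order_trans zero_less_one)
  have "bounded (b ` A)"
    by (intro compact_imp_bounded compact_continuous_image b assms)
  then obtain B where B: "\<And>a. a \<in> A \<Longrightarrow> \<bar>b a\<bar> \<le> B" unfolding bounded_iff by auto
  define s where "s = rec_nat (\<lambda>_. 0) (\<lambda>_ f a. \<nu> a * f (\<phi> a) + b a)"
  have s0: "s 0 = (\<lambda>_. 0)" and sS: "s (Suc n) = (\<lambda>a. \<nu> a * s n (\<phi> a) + b a)" for n
    by (auto simp: s_def)
  have cont: "continuous_on A (s n)" for n
    by (induction n) (use \<phi> in \<open>auto simp: s0 sS intro!: continuous_intros \<nu> b intro: continuous_on_compose2\<close>)
  have "norm (s (Suc n) a - s n a) \<le> B * \<theta> ^ n" if "a \<in> A" for n a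
    using that
  proof (induction n arbitrary: a)
    case 0
    thus ?case using B by (simp add: s0 sS)
  next
    case (Suc n)
    have "s (Suc (Suc n)) a - s (Suc n) a = \<nu> a * (s (Suc n) (\<phi> a) - s n (\<phi> a))"
      by (simp only: sS) (simp add: algebra_simps)
    hence "norm (s (Suc (Suc n)) a - s (Suc n) a) = \<bar>\<nu> a\<bar> * norm (s (Suc n) (\<phi> a) - s n (\<phi> a))"
      by (simp add: abs_mult)
    also have "\<dots> \<le> \<theta> * (B * \<theta> ^ n)"
      using Suc \<phi> \<theta> by (intro mult_mono) auto
    finally show ?case by (simp add: mult_ac)
  qed
  from uniform_limit_geometric[OF this \<theta>(1,2)] obtain q where q: "uniform_limit A s q sequentially" .
  show ?thesis
  proof (rule that)
    show "continuous_on A q"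
      by (rule uniform_limit_theorem[OF _ q]) (use cont in auto)
    fix a assume a: "a \<in> A"
    hence "\<phi> a \<in> A" using \<phi> by auto
    have "(\<lambda>n. s (Suc n) a) \<longlonglongrightarrow> \<nu> a * q (\<phi> a) + b a"
      unfolding sS by (intro tendsto_intros tendsto_uniform_limitI[OF q] \<open>\<phi> a \<in> A\<close>)
    moreover have "(\<lambda>n. s (Suc n) a) \<longlonglongrightarrow> q a"
      using tendsto_uniform_limitI[OF q a] by (rule LIMSEQ_Suc)
    ultimately show "q a = \<nu> a * q (\<phi> a) + b a" using LIMSEQ_unique by blast
  qed
qed

text \<open>Maximum principle: where \<open>\<bar>u\<bar>\<close> is largest, the equation bounds it
  by a proper fraction of itself.\<close>

lemma cohomological_unique:
  fixes \<nu> u :: "'a::topological_space \<Rightarrow> real"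
  assumes "compact A" and \<phi>: "\<phi> ` A \<subseteq> A"
    and \<nu>: "\<And>a. a \<in> A \<Longrightarrow> \<bar>\<nu> a\<bar> < 1"
    and u: "continuous_on A u" "\<And>a. a \<in> A \<Longrightarrow> u a = \<nu> a * u (\<phi> a)" and a: "a \<in> A"
  shows "u a = 0"
proof -
  from continuous_attains_sup[OF \<open>compact A\<close>, of "\<lambda>a. \<bar>u a\<bar>"] a u(1)
  obtain m where m: "m \<in> A" "\<And>a. a \<in> A \<Longrightarrow> \<bar>u a\<bar> \<le> \<bar>u m\<bar>" by (force intro: continuous_intros)
  have "\<bar>u m\<bar> = \<bar>\<nu> m\<bar> * \<bar>u (\<phi> m)\<bar>" using u(2)[OF m(1)] by (metis abs_mult)
  also have "\<dots> \<le> \<bar>\<nu> m\<bar> * \<bar>u m\<bar>" using m \<phi> by (intro mult_left_mono) auto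
  finally have "\<bar>u m\<bar> * (1 - \<bar>\<nu> m\<bar>) \<le> 0" by (simp add: algebra_simps)
  hence "\<bar>u m\<bar> \<le> 0" using \<nu>[OF m(1)] by (auto simp: mult_le_0_iff)
  thus ?thesis using m(2)[OF a] by simp
qed

text \<open>Limits and derivatives commute when the derivatives converge uniformly on a convex set.
  The limits \<open>l\<close> are indexed by basis lists, so that the induction can pass to the
  families of first derivatives, whose limits are again of this shape.\<close>

lemma Ck_fam_uniform_limit:
  fixes h :: "nat \<Rightarrow> 'a::topological_space \<Rightarrow> 'v::euclidean_space \<Rightarrow> 'w::euclidean_space"
  assumes U: "unique_deriv S" and S: "convex S"
    and "\<And>n. Ck_fam k A S (h n)"
    and "\<And>bs. set bs \<subseteq> Basis \<Longrightarrow> length bs \<le> k \<Longrightarrow>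
      uniform_limit (A \<times> S) (\<lambda>n (a, x). iter_deriv S (h n a) bs x) (\<lambda>(a, x). l bs a x) sequentially"
  shows "Ck_fam k A S (l []) \<and>
    (\<forall>bs. set bs \<subseteq> Basis \<longrightarrow> length bs \<le> k \<longrightarrow>
      (\<forall>a\<in>A. \<forall>x\<in>S. iter_deriv S (l [] a) bs x = l bs a x))"
  using assms(3,4)
proof (induction k arbitrary: h l)
  case 0
  have "continuous_on (A \<times> S) (\<lambda>(a, x). l [] a x)"
    by (rule uniform_limit_theorem[OF _ 0(2)[of "[]"]]) (use 0(1) in auto)
  thus ?case by simp
next
  case (Suc k)
  have lim: "uniform_limit (A \<times> S) (\<lambda>n (a, x). h n a x) (\<lambda>(a, x). l [] a x) sequentially"
    using Suc.prems(2)[of "[]"] by simp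
  have cont: "continuous_on (A \<times> S) (\<lambda>(a, x). l [] a x)"
    by (rule uniform_limit_theorem[OF _ lim])
      (use Ck_fam_continuous[OF Suc.prems(1)] in auto)
  have der: "(l [] a has_derivative (\<lambda>v. \<Sum>b\<in>Basis. (v \<bullet> b) *\<^sub>R l [b] a x)) (at x within S)"
    if a: "a \<in> A" and x: "x \<in> S" for a x
  proof -
    have diff: "h n a differentiable_on S" for n using Suc.prems(1)[of n] a by auto
    have "\<exists>g. \<forall>x\<in>S. (\<lambda>n. h n a x) \<longlonglongrightarrow> g x \<and>
        (g has_derivative (\<lambda>v. \<Sum>b\<in>Basis. (v \<bullet> b) *\<^sub>R l [b] a x)) (at x within S)"
    proof (rule has_derivative_sequence[OF S _ _ x])
      show "(h n a has_derivative D_within S (h n a) y) (at y within S)" if "y \<in> S" for n y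
        by (rule has_derivative_D_within[OF diff that])
      show "(\<lambda>n. h n a x) \<longlonglongrightarrow> l [] a x"
        using tendsto_uniform_limitI[OF lim, of "(a, x)"] a x by simp
      fix e :: real assume "e > 0"
      \<comment> \<open>The derivative in direction \<open>v\<close> is a sum of
        \<open>DIM('v)\<close> terms, each off by at most \<open>norm v * d\<close>.\<close>
      define d where "d = e / DIM('v)"
      have "d > 0" using \<open>e > 0\<close> by (simp add: d_def)
      have "\<forall>\<^sub>F n in sequentially. \<forall>p\<in>A \<times> S. dist (case p of (a, x) \<Rightarrow> D_within S (h n a) x b)
          (case p of (a, x) \<Rightarrow> l [b] a x) < d" if "b \<in> Basis" for b
        using uniform_limitD[OF Suc.prems(2)[of "[b]"] \<open>d > 0\<close>] that by simp
      hence "\<forall>\<^sub>F n in sequentially. \<forall>b\<in>Basis. \<forall>p\<in>A \<times> S. dist (case p of (a, x) \<Rightarrow> D_within S (h n a) x b)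
          (case p of (a, x) \<Rightarrow> l [b] a x) < d"
        by (simp add: eventually_ball_finite)
      thus "\<forall>\<^sub>F n in sequentially. \<forall>y\<in>S. \<forall>v. norm (D_within S (h n a) y v -
          (\<Sum>b\<in>Basis. (v \<bullet> b) *\<^sub>R l [b] a y)) \<le> e * norm v"
      proof eventually_elim
        case (elim n)
        show ?case
        proof (intro ballI allI)
          fix y v assume y: "y \<in> S"
          have "norm (D_within S (h n a) y v - (\<Sum>b\<in>Basis. (v \<bullet> b) *\<^sub>R l [b] a y)) =
              norm (\<Sum>b\<in>Basis. (v \<bullet> b) *\<^sub>R (D_within S (h n a) y b - l [b] a y))"
            unfolding D_within_basis_sum[OF diff y, of n v]
            by (simp add: sum_subtractf scaleR_diff_right)
          also have "\<dots> \<le> (\<Sum>b\<in>(Basis :: 'v set). norm v * d)"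
          proof (intro sum_norm_le)
            fix b :: 'v assume b: "b \<in> Basis"
            have "norm (D_within S (h n a) y b - l [b] a y) \<le> d"
              using elim b a y by (force simp: dist_norm)
            thus "norm ((v \<bullet> b) *\<^sub>R (D_within S (h n a) y b - l [b] a y)) \<le> norm v * d"
              using Basis_le_norm[OF b, of v] \<open>d > 0\<close> by (auto intro!: mult_mono)
          qed
          also have "\<dots> = e * norm v" by (simp add: d_def)
          finally show "norm (D_within S (h n a) y v - (\<Sum>b\<in>Basis. (v \<bullet> b) *\<^sub>R l [b] a y)) \<le> e * norm v" .
        qed
      qed
    qed
    then obtain g where g: "\<And>x. x \<in> S \<Longrightarrow> (\<lambda>n. h n a x) \<longlonglongrightarrow> g x"
      "\<And>x. x \<in> S \<Longrightarrow> (g has_derivative (\<lambda>v. \<Sum>b\<in>Basis. (v \<bullet> b) *\<^sub>R l [b] a x)) (at x within S)" by blast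
    have "g y = l [] a y" if "y \<in> S" for y
      using tendsto_uniform_limitI[OF lim, of "(a, y)"] a that g(1)[OF that]
      by (auto intro: LIMSEQ_unique)
    thus ?thesis using g(2)[OF x] has_derivative_within_cong[of S g "l [] a" x] x by simp
  qed
  have D: "D_within S (l [] a) x b = l [b] a x" if "a \<in> A" "x \<in> S" "b \<in> Basis" for a x b
    unfolding D_within_eq[OF U that(2) der[OF that(1,2)]] using that(3)
    by (simp add: inner_Basis if_distrib[of "\<lambda>c. c *\<^sub>R _"] cong: if_cong)
  have IH: "Ck_fam k A S (l [b]) \<and> (\<forall>bs. set bs \<subseteq> Basis \<longrightarrow> length bs \<le> k \<longrightarrow>
      (\<forall>a\<in>A. \<forall>x\<in>S. iter_deriv S (l [b] a) bs x = l (bs @ [b]) a x))" if b: "b \<in> Basis" for b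
  proof -
    \<comment> \<open>The derivative along \<open>b\<close> is taken first, so it sits at the end of
      the list; the limits for the derived family are those of the lists ending in
      \<open>b\<close>.\<close>
    have "Ck_fam k A S ((\<lambda>bs. l (bs @ [b])) []) \<and> (\<forall>bs. set bs \<subseteq> Basis \<longrightarrow> length bs \<le> k \<longrightarrow>
      (\<forall>a\<in>A. \<forall>x\<in>S. iter_deriv S ((\<lambda>bs. l (bs @ [b])) [] a) bs x = (\<lambda>bs. l (bs @ [b])) bs a x))"
    proof (rule Suc.IH)
      show "Ck_fam k A S (\<lambda>a x. D_within S (h n a) x b)" for n
        by (rule Ck_fam_D[OF Suc.prems(1)])
      show "uniform_limit (A \<times> S) (\<lambda>n (a, x). iter_deriv S (\<lambda>x. D_within S (h n a) x b) bs x)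
        (\<lambda>(a, x). l (bs @ [b]) a x) sequentially" if "set bs \<subseteq> Basis" "length bs \<le> k" for bs
        using Suc.prems(2)[of "bs @ [b]"] that b by (simp add: iter_deriv_snoc)
    qed
    thus ?thesis by simp
  qed
  have "Ck_fam (Suc k) A S (l [])"
  proof (rule Ck_fam_basisI[OF U])
    show "Ck_fam 0 A S (l [])" using cont by simp
    show "l [] a differentiable_on S" if "a \<in> A" for a
      using der[OF that] unfolding differentiable_on_def differentiable_def by blast
    show "Ck_fam k A S (\<lambda>a x. D_within S (l [] a) x b)" if "b \<in> Basis" for b
      using IH[OF that] by (subst Ck_fam_cong[OF D]) (use that in auto)
  qed
  moreover have "iter_deriv S (l [] a) bs x = l bs a x"
    if bs: "set bs \<subseteq> Basis" "length bs \<le> Suc k" and a: "a \<in> A" and x: "x \<in> S" for bs a x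
  proof (cases bs rule: rev_cases)
    case (snoc cs b)
    have "iter_deriv S (l [] a) bs x = iter_deriv S (\<lambda>x. D_within S (l [] a) x b) cs x"
      unfolding snoc iter_deriv_snoc ..
    also have "\<dots> = iter_deriv S (l [b] a) cs x"
      by (rule iter_deriv_cong) (use D a bs snoc x in auto)
    also have "\<dots> = l bs a x" using IH[of b] bs a x snoc by auto
    finally show ?thesis .
  qed simp
  ultimately show ?case by blast
qed

section \<open>Symmetry of mixed derivatives\<close>

lemma has_real_derivative_along_line:
  assumes "(g has_derivative L) (at (p + s *\<^sub>R u))"
  shows "((\<lambda>s::real. g (p + s *\<^sub>R u)) has_real_derivative L u) (at s)"
proof -
  interpret L: bounded_linear L using assms by (rule has_derivative_bounded_linear)
  have "((\<lambda>s. p + s *\<^sub>R u) has_derivative (\<lambda>t. t *\<^sub>R u)) (at s)"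
    by (auto intro!: derivative_eq_intros)
  from has_derivative_compose[OF this assms] show ?thesis
    by (simp add: has_field_derivative_def L.scaleR mult_commute_abs)
qed

text \<open>The second difference over a parallelogram is an increment in \<open>s\<close> of the
  function \<open>?F\<close>, itself a difference in direction \<open>v\<close>. The mean value
  theorem along \<open>u\<close> and then along \<open>v\<close> turns it into a mixed derivative at
  a nearby point.\<close>

lemma second_difference_mvt:
  fixes g :: "'v::real_normed_vector \<Rightarrow> real"
  assumes d: "ball x d \<subseteq> S"
    and g: "g differentiable_on S" "(\<lambda>x. D_within S g x u) differentiable_on S"
    and h: "h > 0" "h * (norm u + norm v) < d"
  obtains y where "dist x y < d"
    "g (x + h *\<^sub>R u + h *\<^sub>R v) - g (x + h *\<^sub>R u) - g (x + h *\<^sub>R v) + g x =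
      h * (h * D_within S (\<lambda>x. D_within S g x u) y v)"
proof -
  have in_ball: "x + s *\<^sub>R u + t *\<^sub>R v \<in> ball x d" if "0 \<le> s" "s \<le> h" "0 \<le> t" "t \<le> h" for s t
  proof -
    have "norm (s *\<^sub>R u + t *\<^sub>R v) \<le> s * norm u + t * norm v"
      using norm_triangle_ineq[of "s *\<^sub>R u" "t *\<^sub>R v"] that by simp
    also have "\<dots> \<le> h * norm u + h * norm v"
      using that by (intro add_mono mult_right_mono) auto
    also have "\<dots> < d" using h by (simp add: algebra_simps)
    finally show ?thesis by (simp add: dist_norm norm_minus_commute add.commute)
  qed
  have at: "at y within S = at y" if "y \<in> ball x d" for y
    using d that by (meson at_within_interior interior_maximal open_ball subset_iff)
  have D1: "(g has_derivative D_within S g y) (at y)" if "y \<in> ball x d" for y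
    using has_derivative_D_within[OF g(1), of y] that d at by (simp add: subset_iff)
  have D2: "((\<lambda>x. D_within S g x u) has_derivative D_within S (\<lambda>x. D_within S g x u) y) (at y)"
    if "y \<in> ball x d" for y
    using has_derivative_D_within[OF g(2), of y] that d at by (simp add: subset_iff)
  let ?F = "\<lambda>s. g (x + h *\<^sub>R v + s *\<^sub>R u) - g (x + s *\<^sub>R u)"
  have "\<exists>s>0. s < h \<and> ?F h - ?F 0 =
      (h - 0) * (D_within S g (x + h *\<^sub>R v + s *\<^sub>R u) u - D_within S g (x + s *\<^sub>R u) u)"
  proof (rule MVT2[OF h(1)])
    fix s assume s: "0 \<le> s" "s \<le> h"
    show "(?F has_real_derivative (D_within S g (x + h *\<^sub>R v + s *\<^sub>R u) u - D_within S g (x + s *\<^sub>R u) u)) (at s)"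
      using in_ball[of s h] in_ball[of s 0] s h(1)
      by (intro DERIV_diff has_real_derivative_along_line D1) (auto simp: algebra_simps)
  qed
  then obtain s where s: "0 < s" "s < h" and Fs: "?F h - ?F 0 =
      h * (D_within S g (x + h *\<^sub>R v + s *\<^sub>R u) u - D_within S g (x + s *\<^sub>R u) u)" by auto
  let ?G = "\<lambda>t. D_within S g (x + s *\<^sub>R u + t *\<^sub>R v) u"
  have "\<exists>t>0. t < h \<and> ?G h - ?G 0 = (h - 0) * D_within S (\<lambda>x. D_within S g x u) (x + s *\<^sub>R u + t *\<^sub>R v) v"
  proof (rule MVT2[OF h(1)])
    fix t assume "0 \<le> t" "t \<le> h"
    thus "(?G has_real_derivative D_within S (\<lambda>x. D_within S g x u) (x + s *\<^sub>R u + t *\<^sub>R v) v) (at t)"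
      by (intro has_real_derivative_along_line[of "\<lambda>x. D_within S g x u"] D2 in_ball)
        (use s in auto)
  qed
  then obtain t where t: "0 < t" "t < h" and Gt: "?G h - ?G 0 =
      h * D_within S (\<lambda>x. D_within S g x u) (x + s *\<^sub>R u + t *\<^sub>R v) v" by auto
  show ?thesis
  proof (rule that)
    show "dist x (x + s *\<^sub>R u + t *\<^sub>R v) < d" using in_ball[of s t] s t by simp
    have "?F h - ?F 0 = h * (?G h - ?G 0)" unfolding Fs by (simp add: algebra_simps)
    thus "g (x + h *\<^sub>R u + h *\<^sub>R v) - g (x + h *\<^sub>R u) - g (x + h *\<^sub>R v) + g x =
        h * (h * D_within S (\<lambda>x. D_within S g x u) (x + s *\<^sub>R u + t *\<^sub>R v) v)"
      unfolding Gt by (simp add: algebra_simps)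
  qed
qed

text \<open>The second difference is symmetric in \<open>u\<close> and \<open>v\<close>, so both
  mixed derivatives take a common value at points arbitrarily near \<open>x\<close>. With
  \<open>e\<close> half of the supposed gap, continuity at \<open>x\<close> is contradicted.\<close>

lemma mixed_derivatives_interior:
  fixes g :: "'v::real_normed_vector \<Rightarrow> real"
  assumes g: "Ck_fam 2 A S (\<lambda>_::'a::topological_space. g)" "A \<noteq> {}" and x: "x \<in> interior S"
  shows "iter_deriv S g [u, v] x = iter_deriv S g [v, u] x"
proof (rule ccontr)
  assume neq: "iter_deriv S g [u, v] x \<noteq> iter_deriv S g [v, u] x"
  define e where "e = \<bar>iter_deriv S g [u, v] x - iter_deriv S g [v, u] x\<bar> / 2"
  have "e > 0" using neq by (simp add: e_def)
  obtain a where a: "a \<in> A" using g(2) by blast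
  have xS: "x \<in> S" using x interior_subset by auto
  have cont: "continuous_on S (iter_deriv S g [w, w'])" for w w'
    using Ck_fam_continuous_slice[OF Ck_fam_iter_deriv[OF g(1), of "[w, w']"] a] by simp
  have diff: "g differentiable_on S" "(\<lambda>x. D_within S g x w) differentiable_on S" for w
    using iter_deriv_differentiable[OF g(1), of "[]" a] iter_deriv_differentiable[OF g(1), of "[w]" a] a
    by auto
  have "\<exists>d>0. \<forall>y\<in>S. dist y x < d \<longrightarrow> dist (iter_deriv S g [w, w'] y) (iter_deriv S g [w, w'] x) < e" for w w'
    using cont[of w w'] xS \<open>e > 0\<close> unfolding continuous_on_iff by blast
  then obtain d1 d2 where d: "d1 > 0" "d2 > 0"
    "\<And>y. y \<in> S \<Longrightarrow> dist y x < d1 \<Longrightarrow> dist (iter_deriv S g [u, v] y) (iter_deriv S g [u, v] x) < e"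
    "\<And>y. y \<in> S \<Longrightarrow> dist y x < d2 \<Longrightarrow> dist (iter_deriv S g [v, u] y) (iter_deriv S g [v, u] x) < e"
    by metis
  obtain d3 where d3: "d3 > 0" "ball x d3 \<subseteq> S" using x mem_interior by blast
  define d where "d = min d1 (min d2 d3)"
  have "d > 0" and sub: "ball x d \<subseteq> S" using d d3 by (auto simp: d_def)
  define h where "h = d / (2 * (norm u + norm v + 1))"
  have pos: "norm u + norm v + 1 > 0" by (simp add: add_nonneg_pos)
  have "h > 0" unfolding h_def using \<open>d > 0\<close> pos by simp
  have "h * (norm u + norm v) < h * (2 * (norm u + norm v + 1))"
    using \<open>h > 0\<close> pos by (intro mult_strict_left_mono) (smt (verit) norm_ge_zero)+
  also have "\<dots> = d" using pos by (simp add: h_def)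
  finally have hd: "h * (norm u + norm v) < d" .
  obtain y where y: "dist x y < d" "g (x + h *\<^sub>R u + h *\<^sub>R v) - g (x + h *\<^sub>R u) - g (x + h *\<^sub>R v) + g x =
      h * (h * iter_deriv S g [v, u] y)"
    using second_difference_mvt[OF sub diff(1,2) \<open>h > 0\<close> hd, of thesis] by auto
  obtain z where z: "dist x z < d" "g (x + h *\<^sub>R v + h *\<^sub>R u) - g (x + h *\<^sub>R v) - g (x + h *\<^sub>R u) + g x =
      h * (h * iter_deriv S g [u, v] z)"
    using second_difference_mvt[OF sub diff(1,2) \<open>h > 0\<close>, of v u thesis] hd by (auto simp: add.commute)
  have "h * (h * iter_deriv S g [v, u] y) = h * (h * iter_deriv S g [u, v] z)"
    unfolding y(2)[symmetric] z(2)[symmetric] by (simp add: algebra_simps)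
  hence "iter_deriv S g [v, u] y = iter_deriv S g [u, v] z" using \<open>h > 0\<close> by simp
  moreover have "y \<in> S" "z \<in> S" "dist y x < d2" "dist z x < d1"
    using y(1) z(1) sub by (auto simp: d_def dist_commute)
  ultimately show False
    using d(3)[of z] d(4)[of y] unfolding dist_real_def e_def by (smt (verit) field_sum_of_halves)
qed

text \<open>Boundary points are limits of interior ones, and both sides are continuous on
  \<open>S\<close>.\<close>

lemma mixed_derivatives:
  fixes g :: "'v::euclidean_space \<Rightarrow> real"
  assumes S: "convex S" "closed S" "interior S \<noteq> {}"
    and g: "Ck_fam 2 A S (\<lambda>_::'a::topological_space. g)" "A \<noteq> {}" and x: "x \<in> S"
  shows "iter_deriv S g [u, v] x = iter_deriv S g [v, u] x"
proof -
  obtain a where a: "a \<in> A" using g(2) by blast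
  have cl: "closure (interior S) = S"
    using convex_closure_interior[OF S(1,3)] S(2) by simp
  have cont: "continuous_on S (iter_deriv S g [w, w'])" for w w'
    using Ck_fam_continuous_slice[OF Ck_fam_iter_deriv[OF g(1), of "[w, w']"] a] by simp
  have "continuous_on (closure (interior S)) (\<lambda>x. iter_deriv S g [u, v] x - iter_deriv S g [v, u] x)"
    unfolding cl by (intro continuous_on_diff cont)
  from continuous_constant_on_closure[OF this, of 0 x] mixed_derivatives_interior[OF g] x
  show ?thesis unfolding cl by simp
qed

text \<open>An adjacent swap at the head is \<open>mixed_derivatives\<close> for a derivative of
  lower order, and differentiating such an identity carries it deeper into the list. Jets can thus
  be matched with polynomials, whose coefficients are indexed by multisets.\<close>

lemma iter_deriv_perm:
  fixes g :: "'v::euclidean_space \<Rightarrow> real"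
  assumes S: "convex S" "closed S" "interior S \<noteq> {}"
    and g: "Ck_fam k A S (\<lambda>_::'a::topological_space. g)" "A \<noteq> {}"
    and "mset us = mset vs" "length us \<le> k" "x \<in> S"
  shows "iter_deriv S g us x = iter_deriv S g vs x"
proof -
  have swap: "iter_deriv S g (u # v # ws) x = iter_deriv S g (v # u # ws) x"
    if "length (u # v # ws) \<le> k" "x \<in> S" for u v ws x
  proof -
    have "Ck_fam (k - length ws) A S (\<lambda>_. iter_deriv S g ws)"
      by (rule Ck_fam_iter_deriv[OF g(1)]) (use that in auto)
    hence "Ck_fam 2 A S (\<lambda>_. iter_deriv S g ws)"
      by (rule Ck_fam_mono) (use that in auto)
    from mixed_derivatives[OF S this g(2) that(2)] show ?thesis by simp
  qed
  have front: "iter_deriv S g (ps @ u # qs) x = iter_deriv S g (u # ps @ qs) x"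
    if "length (ps @ u # qs) \<le> k" "x \<in> S" for ps u qs x
    using that
  proof (induction ps arbitrary: x)
    case (Cons p ps)
    have "iter_deriv S g ((p # ps) @ u # qs) x = iter_deriv S g (p # u # ps @ qs) x"
      using D_within_cong[of S "iter_deriv S g (ps @ u # qs)" "iter_deriv S g (u # ps @ qs)" x] Cons
      by simp
    also have "\<dots> = iter_deriv S g (u # (p # ps) @ qs) x"
      using swap[of p u "ps @ qs" x] Cons.prems by simp
    finally show ?case .
  qed simp
  show ?thesis using assms(6-8)
  proof (induction us arbitrary: vs x)
    case (Cons u us)
    hence "u \<in> set vs" by (metis list.set_intros(1) set_mset_mset)
    then obtain ps qs where vs: "vs = ps @ u # qs" by (meson split_list)
    have mset: "mset us = mset (ps @ qs)" using Cons.prems(1) unfolding vs by simp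
    have "length vs = length (u # us)" using Cons.prems(1) by (metis size_mset)
    hence "iter_deriv S g vs x = iter_deriv S g (u # ps @ qs) x"
      unfolding vs using front[of ps u qs x] Cons.prems by simp
    also have "\<dots> = iter_deriv S g (u # us) x"
      using D_within_cong[of S "iter_deriv S g (ps @ qs)" "iter_deriv S g us" x]
        Cons.IH[OF mset] Cons.prems by simp
    finally show ?case ..
  qed simp
qed

subsection \<open>Embeddings of compact sets\<close>

lemma Ck_fam_vec:
  fixes f :: "'a::topological_space \<Rightarrow> 'v::real_normed_vector \<Rightarrow> real ^ 'n"
  assumes U: "unique_deriv S" and f: "\<And>i. Ck_fam k A S (\<lambda>a x. f a x $ i)"
  shows "Ck_fam k A S f"
proof -
  have "Ck_fam k A S (\<lambda>a x. \<Sum>i\<in>UNIV. f a x $ i *\<^sub>R axis i (1::real))"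
    by (intro Ck_fam_sum[OF U] Ck_fam_scaleR[OF U] f Ck_fam_const[OF U]) auto
  thus ?thesis by (simp add: basis_expansion flip: scalar_mult_eq_scaleR)
qed

lemma Ck_fam_nth:
  fixes f :: "'a::topological_space \<Rightarrow> 'v::real_normed_vector \<Rightarrow> real ^ 'n"
  assumes U: "unique_deriv S" and f: "Ck_fam k A S f"
  shows "Ck_fam k A S (\<lambda>a x. f a x $ i)"
  using Ck_fam_inner_const[OF U f, of "axis i 1"] by (simp add: inner_axis)

lemma D_within_axis_sum:
  fixes f :: "real ^ 'n \<Rightarrow> 'w::real_normed_vector"
  assumes "f differentiable_on S" "x \<in> S"
  shows "D_within S f x v = (\<Sum>i\<in>UNIV. v $ i *\<^sub>R D_within S f x (axis i 1))"
proof -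
  interpret L: bounded_linear "D_within S f x"
    using has_derivative_D_within[OF assms] by (rule has_derivative_bounded_linear)
  have "D_within S f x v = D_within S f x (\<Sum>i\<in>UNIV. v $ i *\<^sub>R axis i 1)"
    by (simp add: basis_expansion flip: scalar_mult_eq_scaleR)
  thus ?thesis by (simp only: L.sum L.scaleR)
qed

lemma Ck_fam_det:
  fixes M :: "'a::topological_space \<Rightarrow> 'v::real_normed_vector \<Rightarrow> real ^ 'n ^ 'n"
  assumes U: "unique_deriv S" and M: "\<And>i j. Ck_fam k A S (\<lambda>a x. M a x $ i $ j)"
  shows "Ck_fam k A S (\<lambda>a x. det (M a x))"
  unfolding det_def
  by (intro Ck_fam_sum[OF U] Ck_fam_mult[OF U] Ck_fam_prod[OF U] Ck_fam_const[OF U] M) auto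

locale embedding =
  fixes S :: "(real ^ 'n) set" and F :: "real ^ 'n \<Rightarrow> real ^ 'n" and r :: nat
  assumes S: "compact S" and U: "unique_deriv S" and r: "r \<ge> 1"
    and F: "Ck_fam r {0::real} S (\<lambda>_. F)"
    and inj: "inj_on F S"
    and D_inj: "\<And>x v. x \<in> S \<Longrightarrow> D_within S F x v = 0 \<Longrightarrow> v = 0"
begin

abbreviation "G \<equiv> the_inv_into S F"

text \<open>Cramer's rule for the inverse of the derivative of \<open>F\<close> at \<open>x\<close>:
  as a quotient of determinants it has the smoothness of the matrix entries.\<close>

definition J :: "real ^ 'n \<Rightarrow> real ^ 'n \<Rightarrow> real ^ 'n" where
  "J x v = (\<chi> k. det (\<chi> i j. if j = k then v $ i else matrix (D_within S F x) $ i $ j) /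
     det (matrix (D_within S F x)))"

lemma G_F: "x \<in> S \<Longrightarrow> G (F x) = x"
  by (rule the_inv_into_f_f[OF inj])

lemma F_has_derivative: "x \<in> S \<Longrightarrow> (F has_derivative D_within S F x) (at x within S)"
  using Ck_fam_has_derivative[OF F, of 0 x] r by simp

lemma linear_D: "x \<in> S \<Longrightarrow> linear (D_within S F x)"
  by (rule has_derivative_linear[OF F_has_derivative])

lemma inj_D: "x \<in> S \<Longrightarrow> inj (D_within S F x)"
  using linear_injective_0[OF linear_D] D_inj by blast

lemma det_nz: "x \<in> S \<Longrightarrow> det (matrix (D_within S F x)) \<noteq> 0"
  using det_nz_iff_inj[OF linear_D] inj_D by blast

lemma D_J: "x \<in> S \<Longrightarrow> D_within S F x (J x v) = v"
  using cramer[OF det_nz, of x "J x v" v] matrix_works[of "D_within S F x"] linear_D[of x]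
  by (simp add: J_def linear_matrix_vector_mul_eq)

lemma J_D: "x \<in> S \<Longrightarrow> J x (D_within S F x v) = v"
  using injD[OF inj_D] D_J by blast

lemma linear_J: "x \<in> S \<Longrightarrow> linear (J x)"
proof -
  assume x: "x \<in> S"
  interpret L: linear "D_within S F x" by (rule linear_D[OF x])
  show ?thesis
  proof (rule linearI)
    show "J x (u + v) = J x u + J x v" for u v
      by (rule injD[OF inj_D[OF x]]) (simp add: L.add D_J[OF x])
    show "J x (c *\<^sub>R u) = c *\<^sub>R J x u" for c u
      by (rule injD[OF inj_D[OF x]]) (simp add: L.scale D_J[OF x])
  qed
qed

lemma continuous_G: "continuous_on (F ` S) G"
proof (rule continuous_on_inv[OF _ S])
  show "continuous_on S F" using Ck_fam_continuous_slice[OF F, of 0] by simp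
qed (use G_F in auto)

lemma G_has_derivative:
  assumes x: "x \<in> S"
  shows "(G has_derivative J x) (at (F x) within F ` S)"
proof (rule has_derivative_inverse_within[OF F_has_derivative[OF x]])
  show "continuous (at (F x) within F ` S) G"
    using continuous_G x by (simp add: continuous_on_eq_continuous_within)
qed (use x G_F linear_J[OF x] J_D[OF x] in auto)

text \<open>A derivative of the zero map within the image pulls back through \<open>F\<close> to one
  within \<open>S\<close>, and the derivative of \<open>F\<close> is onto.\<close>

lemma unique_deriv_image: "unique_deriv (F ` S)"
  unfolding unique_deriv_def
proof (intro ballI allI impI)
  fix y v :: "real ^ 'n" and L :: "real ^ 'n \<Rightarrow> real"
  assume y: "y \<in> F ` S" and L: "((\<lambda>_. 0::real) has_derivative L) (at y within F ` S)"
  then obtain x where x: "x \<in> S" "y = F x" by auto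
  have "((\<lambda>_. 0) has_derivative (\<lambda>v. L (D_within S F x v))) (at x within S)"
    by (rule has_derivative_in_compose[OF F_has_derivative[OF x(1)] L[unfolded x(2)]])
  hence "L (D_within S F x (J x v)) = 0"
    using U x(1) unfolding unique_deriv_def by blast
  thus "L v = 0" by (simp add: D_J[OF x(1)])
qed

lemma Ck_fam_J: "Ck_fam (r - 1) {0::real} S (\<lambda>_ x. J x v)"
proof (rule Ck_fam_vec[OF U])
  have F': "Ck_fam (Suc (r - 1)) {0::real} S (\<lambda>_. F)" using F r by simp
  have *: "Ck_fam (r - 1) {0::real} S (\<lambda>_ x. matrix (D_within S F x) $ i $ j)" for i j
    using Ck_fam_nth[OF U Ck_fam_D[OF F']] by (simp add: matrix_def)
  have **: "Ck_fam (r - 1) {0::real} S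
      (\<lambda>_ x. (\<chi> i j. if j = k then v $ i else matrix (D_within S F x) $ i $ j) $ i $ j)" for i j k
    using * by (cases "j = k") (auto intro!: Ck_fam_const[OF U])
  show "Ck_fam (r - 1) {0::real} S (\<lambda>_ x. J x v $ k)" for k
    unfolding J_def vec_lambda_beta divide_inverse
    by (intro Ck_fam_mult[OF U] Ck_fam_inverse[OF U] Ck_fam_det[OF U] * **) (use det_nz in auto)
qed

text \<open>The derivative of \<open>k\<close> at \<open>F x\<close> is that of the pullback
  \<open>k (F x)\<close> applied to \<open>J x v\<close>, whose own pullback is visibly one order
  less smooth. Inducting on pullbacks avoids composing with \<open>G\<close>, whose smoothness is
  the goal: for \<open>k = G\<close> the pullback is the identity.\<close>

lemma Ck_fam_pullback:
  fixes k :: "real ^ 'n \<Rightarrow> 'w::euclidean_space"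
  assumes "Ck_fam j {0::real} S (\<lambda>_ x. k (F x))" "j \<le> r"
  shows "Ck_fam j {0::real} (F ` S) (\<lambda>_. k)"
  using assms
proof (induction j arbitrary: k)
  case 0
  have "continuous_on S (\<lambda>x. k (F x))" using Ck_fam_continuous_slice[OF 0(1), of 0] by simp
  hence "continuous_on (F ` S) (\<lambda>y. k (F (G y)))"
    by (rule continuous_on_compose2[OF _ continuous_G]) (use G_F in auto)
  hence "continuous_on (F ` S) k"
    by (subst (asm) continuous_on_cong[OF refl, of _ _ k]) (use G_F in auto)
  hence "Cr_on 0 (F ` S) k" by (simp add: Cr_on_def)
  thus ?case using Cr_on_iff_Ck_fam by blast
next
  case (Suc j)
  let ?q = "\<lambda>x. k (F x)"
  have q: "(?q has_derivative D_within S ?q x) (at x within S)" if "x \<in> S" for x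
    using Ck_fam_has_derivative[OF Suc.prems(1), of 0 x] that by simp
  have der: "(k has_derivative (\<lambda>v. D_within S ?q (G y) (J (G y) v))) (at y within F ` S)"
    if y: "y \<in> F ` S" for y
  proof -
    obtain x where x: "x \<in> S" "y = F x" using y by blast
    have "(?q has_derivative D_within S ?q x) (at (G y) within G ` F ` S)"
      using q[OF x(1)] G_F x by (auto simp: image_image)
    from has_derivative_in_compose[OF G_has_derivative[OF x(1)] this[unfolded x(2)]]
    have "((\<lambda>y. ?q (G y)) has_derivative (\<lambda>v. D_within S ?q x (J x v))) (at y within F ` S)"
      unfolding x(2) .
    hence "(k has_derivative (\<lambda>v. D_within S ?q x (J x v))) (at y within F ` S)"
      by (subst (asm) has_derivative_within_cong[of _ _ k]) (use G_F y in auto)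
    thus ?thesis using x G_F by simp
  qed
  show ?case
  proof (rule Ck_fam_SucI[OF unique_deriv_image _ der])
    show "Ck_fam 0 {0::real} (F ` S) (\<lambda>_. k)"
      by (rule Ck_fam_mono[OF Suc.IH[OF Ck_fam_Suc_D[OF Suc.prems(1)]]]) (use Suc.prems(2) in auto)
    fix v
    show "Ck_fam j {0::real} (F ` S) (\<lambda>_ y. D_within S ?q (G y) (J (G y) v))"
    proof (rule Suc.IH)
      have J: "Ck_fam j {0::real} S (\<lambda>_ x. J x v)"
        by (rule Ck_fam_mono[OF Ck_fam_J]) (use Suc.prems(2) in auto)
      have "Ck_fam j {0::real} S (\<lambda>_ x. \<Sum>b\<in>Basis. (J x v \<bullet> b) *\<^sub>R D_within S ?q x b)"
        by (intro Ck_fam_sum[OF U] Ck_fam_scaleR[OF U] Ck_fam_inner_const[OF U] J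
            Ck_fam_D[OF Suc.prems(1)])
      moreover have "D_within S ?q (G (F x)) (J (G (F x)) v) =
          (\<Sum>b\<in>Basis. (J x v \<bullet> b) *\<^sub>R D_within S ?q x b)" if "x \<in> S" for x
        unfolding G_F[OF that]
        by (rule D_within_basis_sum[OF _ that]) (use Ck_fam_differentiable[OF Suc.prems(1)] in auto)
      ultimately show "Ck_fam j {0::real} S (\<lambda>_ x. D_within S ?q (G (F x)) (J (G (F x)) v))"
        by (subst Ck_fam_cong) auto
    qed (use Suc.prems(2) in auto)
  qed
qed

lemma Cr_diffeo_into: "Cr_diffeo_into r S F"
proof -
  have "Ck_fam r {0::real} S (\<lambda>_ x. x)"
    by (rule Ck_fam_linear[OF U bounded_linear_ident])
  hence "Ck_fam r {0::real} S (\<lambda>_ x. G (F x))"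
    by (subst Ck_fam_cong[where g = "\<lambda>_ x. x"]) (use G_F in auto)
  hence "Cr_on r (F ` S) G" using Ck_fam_pullback Cr_on_iff_Ck_fam by blast
  thus ?thesis unfolding Cr_diffeo_into_def using F inj Cr_on_iff_Ck_fam by blast
qed

end

text \<open>Differentiating the identity \<open>the_inv_into S F (F x) = x\<close> exhibits a left
  inverse of the derivative.\<close>

lemma Cr_diffeo_into_D_inj:
  fixes F :: "'v::euclidean_space \<Rightarrow> 'w::euclidean_space"
  assumes U: "unique_deriv S" and "Cr_diffeo_into r S F" "r \<ge> 1" "x \<in> S"
    and v: "D_within S F x v = 0"
  shows "v = 0"
proof -
  let ?G = "the_inv_into S F"
  have inj: "inj_on F S" and F: "Cr_on r S F" and G: "Cr_on r (F ` S) ?G"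
    using assms(2) by (auto simp: Cr_diffeo_into_def)
  have "iter_deriv S F [] differentiable_on S" "iter_deriv (F ` S) ?G [] differentiable_on F ` S"
    using F G \<open>r \<ge> 1\<close> unfolding Cr_on_def by (metis less_le_trans less_one list.size(3))+
  hence 1: "(F has_derivative D_within S F x) (at x within S)"
    and 2: "(?G has_derivative D_within (F ` S) ?G (F x)) (at (F x) within F ` S)"
    using \<open>x \<in> S\<close> by (auto intro: has_derivative_D_within)
  interpret L: bounded_linear "D_within (F ` S) ?G (F x)" using 2 by (rule has_derivative_bounded_linear)
  have "((\<lambda>x. ?G (F x)) has_derivative (\<lambda>v. D_within (F ` S) ?G (F x) (D_within S F x v))) (at x within S)"
    by (rule has_derivative_in_compose[OF 1 2])
  hence "((\<lambda>x. x) has_derivative (\<lambda>v. D_within (F ` S) ?G (F x) (D_within S F x v))) (at x within S)"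
    by (subst (asm) has_derivative_within_cong[of _ _ "\<lambda>x. x"]) (use the_inv_into_f_f[OF inj] \<open>x \<in> S\<close> in auto)
  from fun_cong[OF unique_derivD[OF U \<open>x \<in> S\<close> this has_derivative_ident], of v]
  show ?thesis using v L.zero by simp
qed

subsection \<open>Contracting families and the chain rule\<close>

lemma finite_common_radius:
  assumes "finite V" and "\<And>v. v \<in> V \<Longrightarrow> \<exists>d>0::real. P v d"
    and mono: "\<And>v d d'. P v d \<Longrightarrow> 0 < d' \<Longrightarrow> d' \<le> d \<Longrightarrow> P v d'"
  shows "\<exists>d>0. \<forall>v\<in>V. P v d"
  using assms(1,2)
proof (induction V)
  case empty
  show ?case by (intro exI[of _ 1]) auto
next
  case (insert v V)
  then obtain d d' where "d > 0" "\<forall>v\<in>V. P v d" "d' > 0" "P v d'" by (metis insert_iff)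
  thus ?case using mono by (intro exI[of _ "min d d'"]) (auto intro: mono)
qed

lemma uniformly_close_to_0:
  fixes F :: "'a::metric_space \<Rightarrow> 'v::real_normed_vector \<Rightarrow> 'w::metric_space"
  assumes "compact A" "compact S" "0 \<in> S" and F: "continuous_on (A \<times> S) (\<lambda>(a, x). F a x)" and "e > 0"
  shows "\<exists>d>0. \<forall>a\<in>A. \<forall>x\<in>S. norm x \<le> d \<longrightarrow> dist (F a x) (F a 0) < e"
proof -
  have "uniformly_continuous_on (A \<times> S) (\<lambda>(a, x). F a x)"
    by (intro compact_uniformly_continuous F compact_Times assms)
  then obtain d where d: "d > 0" "\<And>p q. p \<in> A \<times> S \<Longrightarrow> q \<in> A \<times> S \<Longrightarrow> dist q p < d \<Longrightarrow>
      dist (case q of (a, x) \<Rightarrow> F a x) (case p of (a, x) \<Rightarrow> F a x) < e"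
    using \<open>e > 0\<close> unfolding uniformly_continuous_on_def by metis
  have "dist (F a x) (F a 0) < e" if "a \<in> A" "x \<in> S" "norm x \<le> d / 2" for a x
    using d(2)[of "(a, 0)" "(a, x)"] that \<open>0 \<in> S\<close> \<open>d > 0\<close> by (simp add: dist_Pair_Pair)
  thus ?thesis using \<open>d > 0\<close> by (intro exI[of _ "d / 2"]) auto
qed

abbreviation pd :: "'n list \<Rightarrow> (real ^ 'n \<Rightarrow> real) \<Rightarrow> real ^ 'n \<Rightarrow> real" where
  "pd ms g \<equiv> iter_deriv unit_cball g (map (\<lambda>m. axis m 1) ms)"

lemma Basis_list_axis:
  assumes "set bs \<subseteq> (Basis :: (real ^ 'n) set)"
  obtains ms where "bs = map (\<lambda>m. axis m 1) ms"
proof -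
  have "\<exists>m. b = axis m 1" if "b \<in> set bs" for b
    using assms that by (auto simp: Basis_vec_def)
  thus ?thesis using ex_map_conv[of bs "\<lambda>m. axis m 1"] that by blast
qed

lemma unique_deriv_unit_cball: "unique_deriv (unit_cball :: (real ^ 'n) set)"
  by (rule unique_deriv_cball) simp

lemma finite_lists_le: "finite {ms :: 'n::finite list. length ms \<le> d}"
  using finite_lists_length_le[of "UNIV :: 'n set" d] by simp

lemma sum_lists_le_Suc:
  fixes g :: "'n::finite list \<Rightarrow> real"
  shows "(\<Sum>ms | length ms \<le> Suc d. g ms) = g [] + (\<Sum>ms | length ms \<le> d. \<Sum>m\<in>UNIV. g (m # ms))"
proof -
  let ?h = "\<lambda>(ms, m). m # ms :: 'n list"
  have eq: "{ms :: 'n list. length ms \<le> Suc d} = insert [] (?h ` ({ms. length ms \<le> d} \<times> UNIV))"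
    (is "?L = ?R")
  proof (intro equalityI subsetI)
    fix ms assume "ms \<in> ?L" thus "ms \<in> ?R" by (cases ms) force+
  qed auto
  have "sum g (?h ` ({ms. length ms \<le> d} \<times> UNIV)) = (\<Sum>(ms, m)\<in>{ms. length ms \<le> d} \<times> UNIV. g (m # ms))"
    by (subst sum.reindex) (auto intro!: sum.cong inj_onI)
  thus ?thesis unfolding eq
    by (subst sum.insert) (auto simp: finite_lists_le sum.cartesian_product)
qed

text \<open>The parameter space is left abstract because it will also be
  \<open>A \<times> reciprocals\<close>. Lists replace multiindices to match iterated derivatives.
  With (H4) deciding the signs from order \<open>r\<close> on, \<open>resonance\<close> concerns
  finitely many lists, hence persists along a convergent sequence from some index on.\<close>

locale contracting_family =
  fixes A :: "'a::metric_space set" and \<sigma> \<tau> :: "'a \<Rightarrow> 'a" and r :: nat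
    and f :: "'a \<Rightarrow> real ^ 'n \<Rightarrow> real ^ 'n" and lam :: "'a \<Rightarrow> 'n \<Rightarrow> real"
  assumes A: "compact A"
    and \<sigma>: "continuous_on A \<sigma>" "\<And>a. a \<in> A \<Longrightarrow> \<sigma> a \<in> A"
    and \<tau>: "continuous_on A \<tau>" "\<And>a. a \<in> A \<Longrightarrow> \<tau> a \<in> A"
    and \<tau>\<sigma>: "\<And>a. a \<in> A \<Longrightarrow> \<tau> (\<sigma> a) = a" and \<sigma>\<tau>: "\<And>a. a \<in> A \<Longrightarrow> \<sigma> (\<tau> a) = a"
    and r: "r \<ge> 2"
    and f: "Ck_fam r A unit_cball f"
    and f_ball: "\<And>a x. a \<in> A \<Longrightarrow> x \<in> unit_cball \<Longrightarrow> f a x \<in> unit_cball"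
    and f_0: "\<And>a. a \<in> A \<Longrightarrow> f a 0 = 0"
    and D_f_0: "\<And>a v. a \<in> A \<Longrightarrow> D_ball (f a) 0 v = (\<chi> i. lam a i * v $ i)"
    and D_f_less: "\<And>a x. a \<in> A \<Longrightarrow> x \<in> unit_cball \<Longrightarrow> onorm (D_ball (f a) x) < 1"
    and f_inj: "\<And>a. a \<in> A \<Longrightarrow> inj_on (f a) unit_cball"
    and D_f_inj: "\<And>a x v. a \<in> A \<Longrightarrow> x \<in> unit_cball \<Longrightarrow> D_ball (f a) x v = 0 \<Longrightarrow> v = 0"
    and lam_nz: "\<And>a i. a \<in> A \<Longrightarrow> lam a i \<noteq> 0"
    and resonance: "\<And>i ms. length ms \<noteq> 1 \<Longrightarrow> length ms < r \<Longrightarrow>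
      (\<forall>a\<in>A. \<bar>prod_list (map (lam a) ms)\<bar> < \<bar>lam a i\<bar>) \<or>
      (\<forall>a\<in>A. \<bar>prod_list (map (lam a) ms)\<bar> > \<bar>lam a i\<bar>)"
    and domination: "\<And>i ms a. length ms = r \<Longrightarrow> a \<in> A \<Longrightarrow>
      \<bar>prod_list (map (lam a) ms)\<bar> < \<bar>lam a i\<bar>"
begin

abbreviation "lamp a ms \<equiv> prod_list (map (lam a) ms)"
abbreviation "Ck k w \<equiv> Ck_fam k A unit_cball w"

lemmas UB = unique_deriv_unit_cball[where 'n = 'n]

lemma zero_in_ball [simp]: "0 \<in> (unit_cball :: (real ^ 'n) set)" by simp

lemma \<sigma>_image: "\<sigma> ` A \<subseteq> A" using \<sigma> by auto

lemma continuous_lam: "continuous_on A (\<lambda>a. lam a i)"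
proof -
  have "Ck_fam (Suc (r - 1)) A unit_cball f" using f r by simp
  from Ck_fam_continuous_param[OF Ck_fam_nth[OF UB Ck_fam_D[OF this, of "axis i 1"], of i] zero_in_ball]
  have "continuous_on A (\<lambda>a. D_ball (f a) 0 (axis i 1) $ i)" .
  thus ?thesis by (subst (asm) continuous_on_cong[OF refl, of _ _ "\<lambda>a. lam a i"]) (auto simp: D_f_0)
qed

lemma continuous_lamp: "continuous_on A (\<lambda>a. lamp a ms)"
  by (induction ms) (auto intro!: continuous_intros continuous_lam)

definition T :: "'n \<Rightarrow> ('a \<Rightarrow> real ^ 'n \<Rightarrow> real) \<Rightarrow> 'a \<Rightarrow> real ^ 'n \<Rightarrow> real" where
  "T i w a x = w (\<sigma> a) (f a x) / lam a i"

lemma Ck_comp: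
  fixes w :: "'a \<Rightarrow> real ^ 'n \<Rightarrow> real"
  assumes "Ck k w" "k \<le> r"
  shows "Ck k (\<lambda>a x. w (\<sigma> a) (f a x))"
  by (rule Ck_fam_compose[OF UB Ck_fam_mono[OF f assms(2)] assms(1) \<sigma>(1) \<sigma>_image f_ball])

lemma Ck_T: "Ck k w \<Longrightarrow> k \<le> r \<Longrightarrow> Ck k (T i w)"
  unfolding T_def divide_inverse
  by (intro Ck_fam_mult[OF UB] Ck_comp Ck_fam_const[OF UB] continuous_intros continuous_lam)
    (use lam_nz in auto)

lemma Ck_T_pow: "Ck k w \<Longrightarrow> k \<le> r \<Longrightarrow> Ck k ((T i ^^ n) w)"
  by (induction n) (auto intro: Ck_T)

lemma T_diff: "T i (\<lambda>a x. u a x - v a x) = (\<lambda>a x. T i u a x - T i v a x)"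
  by (intro ext) (simp add: T_def diff_divide_distrib)

lemma T_pow_diff: "(T i ^^ n) (\<lambda>a x. u a x - v a x) = (\<lambda>a x. (T i ^^ n) u a x - (T i ^^ n) v a x)"
  by (induction n) (simp_all add: T_diff)

lemma pd_differentiable: "Ck k w \<Longrightarrow> length ms < k \<Longrightarrow> a \<in> A \<Longrightarrow> pd ms (w a) differentiable_on unit_cball"
  by (rule iter_deriv_differentiable) auto

text \<open>The coefficients of the chain rule: \<open>\<partial>\<^sub>v\<^sub>s (w \<circ> f\<^sub>a) = (\<Sum>ms. cc vs ms a \<cdot> (\<partial>\<^sub>m\<^sub>s w) \<circ> f\<^sub>a)\<close>.\<close>

primrec cc :: "'n list \<Rightarrow> 'n list \<Rightarrow> 'a \<Rightarrow> real ^ 'n \<Rightarrow> real" where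
  "cc [] ms = (\<lambda>a x. if ms = [] then 1 else 0)"
| "cc (v # vs) ms = (\<lambda>a x. D_within unit_cball (cc vs ms a) x (axis v 1) +
     (case ms of [] \<Rightarrow> 0 | m # ms' \<Rightarrow> cc vs ms' a x * D_ball (f a) x (axis v 1) $ m))"

lemma Ck_cc: "length vs \<le> r \<Longrightarrow> Ck (r - length vs) (cc vs ms)"
proof (induction vs arbitrary: ms)
  case Nil
  show ?case by (auto intro: Ck_fam_const[OF UB])
next
  case (Cons v vs)
  obtain k where k: "r - length vs = Suc k" "r - length (v # vs) = k"
    using Cons.prems by (metis Suc_diff_Suc Suc_le_lessD length_Cons)
  have IH: "Ck (Suc k) (cc vs ms)" for ms using Cons k(1) by simp
  have f': "Ck_fam (Suc k) A unit_cball f" by (rule Ck_fam_mono[OF f]) (use k in auto)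
  have 1: "Ck k (\<lambda>a x. D_within unit_cball (cc vs ms a) x (axis v 1))" by (rule Ck_fam_D[OF IH])
  have 2: "Ck k (\<lambda>a x. case ms of [] \<Rightarrow> 0 | m # ms' \<Rightarrow> cc vs ms' a x * D_ball (f a) x (axis v 1) $ m)"
  proof (cases ms)
    case Nil
    thus ?thesis by (auto intro: Ck_fam_const[OF UB])
  next
    case (Cons m ms')
    have "Ck k (\<lambda>a x. cc vs ms' a x * D_ball (f a) x (axis v 1) $ m)"
      by (intro Ck_fam_mult[OF UB] Ck_fam_nth[OF UB] Ck_fam_Suc_D[OF IH] Ck_fam_D[OF f'])
    thus ?thesis unfolding Cons by simp
  qed
  show ?case unfolding cc.simps k(2) by (rule Ck_fam_add[OF UB 1 2])
qed

lemma cc_continuous: "length vs \<le> r \<Longrightarrow> continuous_on (A \<times> unit_cball) (\<lambda>(a, x). cc vs ms a x)"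
  using Ck_fam_continuous[OF Ck_cc] .

lemma D_zero_on: 
  assumes "\<And>y. y \<in> unit_cball \<Longrightarrow> g y = 0" "x \<in> (unit_cball :: (real ^ 'n) set)"
  shows "D_within unit_cball g x = (\<lambda>_. 0 :: real)"
  using D_within_cong[of unit_cball g "\<lambda>_. 0" x] D_within_eq[OF UB assms(2) has_derivative_const] assms
  by simp

lemma cc_eq_0: "length vs < length ms \<Longrightarrow> a \<in> A \<Longrightarrow> x \<in> unit_cball \<Longrightarrow> cc vs ms a x = 0"
proof (induction vs arbitrary: ms x)
  case (Cons v vs)
  have "D_within unit_cball (cc vs ms a) x (axis v 1) = 0"
    by (subst D_zero_on) (use Cons in auto)
  thus ?case using Cons by (auto split: list.splits)
qed auto

text \<open>At top order only products of first derivatives of \<open>f a\<close> survive, and these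
  are diagonal at 0. The derivative of \<open>cc vs ms\<close> drops out because \<open>ms\<close>
  is longer than \<open>vs\<close>, so that this coefficient vanishes identically.\<close>

lemma cc_at_0: "length vs = length ms \<Longrightarrow> a \<in> A \<Longrightarrow> cc vs ms a 0 = (if ms = vs then lamp a vs else 0)"
proof (induction vs arbitrary: ms)
  case (Cons v vs)
  then obtain m ms' where ms: "ms = m # ms'" by (cases ms) auto
  have "D_within unit_cball (cc vs ms a) 0 (axis v 1) = 0"
    by (subst D_zero_on) (use Cons cc_eq_0 in auto)
  thus ?case using Cons by (auto simp: ms D_f_0 axis_def)
qed auto

lemma has_derivative_comp_f:
  assumes "q differentiable_on unit_cball" "a \<in> A" "x \<in> unit_cball"
  shows "((\<lambda>x. q (f a x)) has_derivative
    (\<lambda>v. D_within unit_cball q (f a x) (D_ball (f a) x v))) (at x within unit_cball)"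
proof -
  have 1: "(f a has_derivative D_ball (f a) x) (at x within unit_cball)"
    using Ck_fam_has_derivative[OF f _ assms(2,3)] r by simp
  have "(q has_derivative D_within unit_cball q (f a x)) (at (f a x) within unit_cball)"
    by (rule has_derivative_D_within[OF assms(1) f_ball[OF assms(2,3)]])
  hence "(q has_derivative D_within unit_cball q (f a x)) (at (f a x) within f a ` unit_cball)"
    by (rule has_derivative_subset) (use f_ball assms in auto)
  from has_derivative_in_compose[OF 1 this] show ?thesis .
qed

text \<open>The formula of Faa di Bruno in recursive form: one more derivative either falls on the
  coefficient or prepends an index \<open>m\<close> to \<open>ms\<close>, with factor the component
  \<open>m\<close> of the derivative of \<open>f a\<close>.\<close>

lemma pd_comp:
  assumes w: "Ck k w" and "k \<le> r" "length vs \<le> k" "a \<in> A" "x \<in> unit_cball"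
  shows "pd vs (\<lambda>x. w (\<sigma> a) (f a x)) x =
    (\<Sum>ms | length ms \<le> length vs. cc vs ms a x * pd ms (w (\<sigma> a)) (f a x))"
  using assms(3,5)
proof (induction vs arbitrary: x)
  case (Cons v vs)
  let ?d = "length vs" and ?p = "\<lambda>ms. pd ms (w (\<sigma> a))" and ?B = "unit_cball :: (real ^ 'n) set"
  have x: "x \<in> ?B" by (rule Cons.prems(2))
  have diff: "?p ms differentiable_on ?B" if "length ms \<le> ?d" for ms
    by (rule pd_differentiable[OF w]) (use that Cons.prems \<sigma> assms in auto)
  have cc_diff: "cc vs ms a differentiable_on ?B" for ms
    by (rule Ck_fam_differentiable[OF Ck_cc]) (use assms Cons.prems in auto)
  have "D_within ?B (pd vs (\<lambda>x. w (\<sigma> a) (f a x))) x =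
      D_within ?B (\<lambda>x. \<Sum>ms | length ms \<le> ?d. cc vs ms a x * ?p ms (f a x)) x"
    by (rule D_within_cong) (use Cons in auto)
  also have "\<dots> = (\<lambda>u. \<Sum>ms | length ms \<le> ?d.
      cc vs ms a x * D_within ?B (?p ms) (f a x) (D_ball (f a) x u) +
      D_within ?B (cc vs ms a) x u * ?p ms (f a x))"
    by (intro D_within_eq[OF UB x] has_derivative_sum has_derivative_mult has_derivative_comp_f
        has_derivative_D_within cc_diff) (use diff x assms in auto)
  finally have "pd (v # vs) (\<lambda>x. w (\<sigma> a) (f a x)) x = (\<Sum>ms | length ms \<le> ?d.
      cc vs ms a x * D_within ?B (?p ms) (f a x) (D_ball (f a) x (axis v 1)) +
      D_within ?B (cc vs ms a) x (axis v 1) * ?p ms (f a x))" by simp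
  also have "\<dots> = (\<Sum>ms | length ms \<le> ?d. D_within ?B (cc vs ms a) x (axis v 1) * ?p ms (f a x)) +
      (\<Sum>ms | length ms \<le> ?d. \<Sum>m\<in>UNIV. cc vs ms a x * D_ball (f a) x (axis v 1) $ m * ?p (m # ms) (f a x))"
    unfolding sum.distrib[symmetric]
  proof (intro sum.cong refl)
    fix ms :: "'n list" assume "ms \<in> {ms. length ms \<le> ?d}"
    hence "D_within ?B (?p ms) (f a x) (D_ball (f a) x (axis v 1)) =
        (\<Sum>m\<in>UNIV. D_ball (f a) x (axis v 1) $ m * ?p (m # ms) (f a x))"
      using D_within_axis_sum[OF diff[of ms] f_ball[OF \<open>a \<in> A\<close> x], of "D_ball (f a) x (axis v 1)"]
      by (simp only: mem_Collect_eq real_scaleR_def list.map iter_deriv.simps)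
    thus "cc vs ms a x * D_within ?B (?p ms) (f a x) (D_ball (f a) x (axis v 1)) +
        D_within ?B (cc vs ms a) x (axis v 1) * ?p ms (f a x) =
      D_within ?B (cc vs ms a) x (axis v 1) * ?p ms (f a x) +
        (\<Sum>m\<in>UNIV. cc vs ms a x * D_ball (f a) x (axis v 1) $ m * ?p (m # ms) (f a x))"
      by (simp only: sum_distrib_left mult.assoc add.commute)
  qed
  \<comment> \<open>Padding with lists of length \<open>Suc ?d\<close>, on which
    \<open>cc vs ms\<close> is identically 0, gives both sums the same index set.\<close>
  also have "(\<Sum>ms | length ms \<le> ?d. D_within ?B (cc vs ms a) x (axis v 1) * ?p ms (f a x)) =
      (\<Sum>ms | length ms \<le> Suc ?d. D_within ?B (cc vs ms a) x (axis v 1) * ?p ms (f a x))"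
  proof (intro sum.mono_neutral_left finite_lists_le ballI)
    fix ms assume "ms \<in> {ms :: 'n list. length ms \<le> Suc ?d} - {ms. length ms \<le> ?d}"
    hence "D_within ?B (cc vs ms a) x (axis v 1) = 0"
      by (subst D_zero_on) (use cc_eq_0 assms x in auto)
    thus "D_within ?B (cc vs ms a) x (axis v 1) * ?p ms (f a x) = 0" by simp
  qed auto
  \<comment> \<open>The lists \<open>m # ms\<close> are exactly the nonempty lists of length at most
    \<open>Suc ?d\<close>; the empty list contributes 0.\<close>
  also have "(\<Sum>ms | length ms \<le> ?d. \<Sum>m\<in>UNIV. cc vs ms a x * D_ball (f a) x (axis v 1) $ m * ?p (m # ms) (f a x)) =
      (\<Sum>ms | length ms \<le> Suc ?d. (case ms of [] \<Rightarrow> 0 | m # ms' \<Rightarrow> cc vs ms' a x * D_ball (f a) x (axis v 1) $ m) * ?p ms (f a x))"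
    by (simp add: sum_lists_le_Suc)
  finally show ?case by (simp add: sum.distrib distrib_right)
qed (simp add: assms)

lemma pd_T:
  assumes w: "Ck k w" and "k \<le> r" "length vs \<le> k" "a \<in> A" "x \<in> unit_cball"
  shows "pd vs (T i w a) x =
    (\<Sum>ms | length ms \<le> length vs. cc vs ms a x * pd ms (w (\<sigma> a)) (f a x)) / lam a i"
  using iter_deriv_scaleR[OF UB Ck_comp[OF w \<open>k \<le> r\<close>] _ assms(4,5), of "map (\<lambda>m. axis m 1) vs" "1 / lam a i"]
    pd_comp[OF assms] assms(3) by (simp add: T_def[abs_def])

text \<open>Vanishing of the jet of order \<open>d - 1\<close>: a family with \<open>flat r\<close>
  may have nonzero derivatives of order \<open>r\<close>, the ones that \<open>T\<close>
  contracts.\<close>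

definition flat :: "nat \<Rightarrow> ('a \<Rightarrow> real ^ 'n \<Rightarrow> real) \<Rightarrow> bool" where
  "flat d w \<longleftrightarrow> (\<forall>ms a. length ms < d \<longrightarrow> a \<in> A \<longrightarrow> pd ms (w a) 0 = 0)"

lemma flatD: "flat d w \<Longrightarrow> length ms < d \<Longrightarrow> a \<in> A \<Longrightarrow> pd ms (w a) 0 = 0"
  by (simp add: flat_def)

lemma flat_mono: "flat d w \<Longrightarrow> d' \<le> d \<Longrightarrow> flat d' w"
  by (simp add: flat_def)

text \<open>Flatness removes the lower orders and \<open>cc_at_0\<close> the off-diagonal terms.
  What remains is the multiplier of the cohomological equation for the coefficient
  \<open>vs\<close>.\<close>

lemma pd_T_at_0:
  assumes w: "Ck k w" and "k \<le> r" and fl: "flat (length vs) w" and "length vs \<le> k" "a \<in> A"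
  shows "pd vs (T i w a) 0 = lamp a vs / lam a i * pd vs (w (\<sigma> a)) 0"
proof -
  have "(\<Sum>ms | length ms \<le> length vs. cc vs ms a 0 * pd ms (w (\<sigma> a)) 0) =
      (\<Sum>ms\<in>{vs}. cc vs ms a 0 * pd ms (w (\<sigma> a)) 0)"
  proof (intro sum.mono_neutral_right finite_lists_le ballI)
    fix ms assume ms: "ms \<in> {ms. length ms \<le> length vs} - {vs}"
    show "cc vs ms a 0 * pd ms (w (\<sigma> a)) 0 = 0"
    proof (cases "length ms = length vs")
      case True
      thus ?thesis using ms cc_at_0[of vs ms a] assms by simp
    next
      case False
      thus ?thesis using ms flatD[OF fl, of ms "\<sigma> a"] \<sigma> assms by simp
    qed
  qed auto
  thus ?thesis using pd_T[OF w assms(2,4,5) zero_in_ball] cc_at_0[of vs vs a] f_0 assms by simp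
qed

lemma flat_T:
  assumes "Ck k w" "k \<le> r" "flat d w" "d \<le> Suc k"
  shows "flat d (T i w)"
  unfolding flat_def
proof (intro allI impI)
  fix ms :: "'n list" and a assume ms: "length ms < d" "a \<in> A"
  have "pd ms (T i w a) 0 = lamp a ms / lam a i * pd ms (w (\<sigma> a)) 0"
    by (rule pd_T_at_0[OF assms(1,2) flat_mono[OF assms(3)]]) (use ms assms in auto)
  thus "pd ms (T i w a) 0 = 0" using flatD[OF assms(3) ms(1)] \<sigma> ms by simp
qed

lemma flat_T_pow: "Ck k w \<Longrightarrow> k \<le> r \<Longrightarrow> flat d w \<Longrightarrow> d \<le> Suc k \<Longrightarrow> flat d ((T i ^^ n) w)"
  by (induction n) (auto intro: flat_T Ck_T_pow)

lemma cc_bounded: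
  obtains K where "K \<ge> 0" "\<And>vs ms a x. length vs \<le> r \<Longrightarrow> length ms \<le> r \<Longrightarrow> a \<in> A \<Longrightarrow> x \<in> unit_cball \<Longrightarrow>
    \<bar>cc vs ms a x / lam a i\<bar> \<le> K"
proof -
  let ?L = "{ms :: 'n list. length ms \<le> r}"
  let ?g = "\<lambda>q (a, x). cc (fst q) (snd q) a x / lam a i"
  have lam': "continuous_on (A \<times> (unit_cball :: (real ^ 'n) set)) (\<lambda>p. lam (fst p) i)"
    by (rule continuous_on_compose2[OF continuous_lam]) (auto intro!: continuous_intros)
  have "compact (\<Union>q\<in>?L \<times> ?L. ?g q ` (A \<times> unit_cball))"
  proof (intro compact_UN finite_cartesian_product finite_lists_le compact_continuous_image compact_Times A)
    fix q assume "q \<in> ?L \<times> ?L"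
    thus "continuous_on (A \<times> unit_cball) (?g q)"
      using cc_continuous[of "fst q" "snd q"] lam_nz lam'
      by (auto simp: case_prod_unfold intro!: continuous_on_divide)
  qed auto
  hence "bounded (\<Union>q\<in>?L \<times> ?L. ?g q ` (A \<times> unit_cball))" by (rule compact_imp_bounded)
  then obtain K where K: "\<forall>y\<in>(\<Union>q\<in>?L \<times> ?L. ?g q ` (A \<times> unit_cball)). norm y \<le> K"
    unfolding bounded_iff by blast
  have "\<bar>cc vs ms a x / lam a i\<bar> \<le> K"
    if "length vs \<le> r" "length ms \<le> r" "a \<in> A" "x \<in> unit_cball" for vs ms a x
  proof -
    have "?g (vs, ms) (a, x) \<in> (\<Union>q\<in>?L \<times> ?L. ?g q ` (A \<times> unit_cball))"
      by (intro UN_I[of "(vs, ms)"] imageI) (use that in auto)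
    with K have "norm (?g (vs, ms) (a, x)) \<le> K" by blast
    thus ?thesis by simp
  qed
  thus ?thesis by (intro that[of "max K 0"]) (auto intro: max.coboundedI1)
qed

text \<open>Descending induction on the order: a derivative that vanishes at 0 and whose partial
  derivatives are at most \<open>M\<close> is at most \<open>CARD('n) * M\<close> times the distance
  to 0. Since \<open>CARD('n) * \<rho> \<le> 1\<close>, the bound \<open>M\<close> is available
  again one order below, and the small factor \<open>\<rho>\<close> is kept for every order.\<close>

lemma flat_bound:
  fixes \<rho> M :: real
  assumes w: "Ck r w" "flat r w" and \<rho>: "0 \<le> \<rho>" "\<rho> \<le> 1" "CARD('n) * \<rho> \<le> 1" and "M \<ge> 0"
    and M: "\<And>ms a x. length ms = r \<Longrightarrow> a \<in> A \<Longrightarrow> norm x \<le> \<rho> \<Longrightarrow> \<bar>pd ms (w a) x\<bar> \<le> M"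
    and "length ms < r" "a \<in> A" "norm x \<le> \<rho>"
  shows "\<bar>pd ms (w a) x\<bar> \<le> CARD('n) * \<rho> * M"
  using assms(8,9,10)
proof (induction "r - length ms" arbitrary: ms a x rule: less_induct)
  case less
  let ?N = "CARD('n) * M"
  have le: "\<bar>pd (m # ms) (w a) y\<bar> \<le> M" if "norm y \<le> \<rho>" for m y
  proof (cases "length (m # ms) = r")
    case True
    thus ?thesis by (rule M[OF _ less.prems(2) that])
  next
    case False
    have "\<bar>pd (m # ms) (w a) y\<bar> \<le> CARD('n) * \<rho> * M"
      by (rule less.hyps) (use False less.prems that in auto)
    also have "\<dots> \<le> (1::real) * M" by (intro mult_right_mono \<rho> \<open>M \<ge> 0\<close>)
    finally show ?thesis by simp
  qed
  have sub: "cball 0 \<rho> \<subseteq> (unit_cball :: (real ^ 'n) set)" using \<rho> by auto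
  have diff: "pd ms (w a) differentiable_on unit_cball"
    by (rule pd_differentiable[OF w(1)]) (use less.prems in auto)
  have "norm (pd ms (w a) x - pd ms (w a) 0) \<le> ?N * norm (x - 0)"
  proof (rule differentiable_bound[where S = "cball 0 \<rho>"])
    fix y assume y: "y \<in> cball (0 :: real ^ 'n) \<rho>"
    hence y': "y \<in> unit_cball" using sub by blast
    show "(pd ms (w a) has_derivative D_within unit_cball (pd ms (w a)) y) (at y within cball 0 \<rho>)"
      by (rule has_derivative_subset[OF has_derivative_D_within[OF diff y'] sub])
    show "onorm (D_within unit_cball (pd ms (w a)) y) \<le> ?N"
    proof (rule onorm_bound)
      fix v :: "real ^ 'n"
      have "norm (D_within unit_cball (pd ms (w a)) y v) \<le> (\<Sum>m\<in>UNIV. norm (v $ m *\<^sub>R pd (m # ms) (w a) y))"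
        unfolding D_within_axis_sum[OF diff y', of v] using norm_sum by simp
      also have "\<dots> \<le> (\<Sum>m\<in>(UNIV :: 'n set). norm v * M)"
        using component_le_norm_cart[of v] le[of y] y
        by (intro sum_mono) (auto simp: abs_mult intro!: mult_mono)
      finally show "norm (D_within unit_cball (pd ms (w a)) y v) \<le> ?N * norm v" by (simp add: mult_ac)
    qed (use \<open>M \<ge> 0\<close> in auto)
  qed (use less.prems \<rho> in auto)
  also have "\<dots> \<le> ?N * \<rho>" using less.prems \<open>M \<ge> 0\<close> by (intro mult_left_mono) auto
  finally show ?case using flatD[OF w(2) less.prems(1,2)] by (simp add: mult_ac)
qed

text \<open>Compactness makes the bound on the derivatives uniform. The unit sphere is included as a
  factor, since the value of the derivative on a vector is jointly continuous by its expansion along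
  the axes. The mean value inequality on the convex ball does the rest.\<close>

lemma contraction_rate:
  obtains \<kappa> where "0 \<le> \<kappa>" "\<kappa> < 1" "\<And>a x. a \<in> A \<Longrightarrow> x \<in> unit_cball \<Longrightarrow> norm (f a x) \<le> \<kappa> * norm x"
proof -
  let ?B = "unit_cball :: (real ^ 'n) set" and ?S = "sphere (0 :: real ^ 'n) 1"
  have diff: "f a differentiable_on ?B" if "a \<in> A" for a
    using Ck_fam_differentiable[OF f _ that] r by simp
  have f1: "Ck_fam (Suc (r - 1)) A ?B f" using f r by simp
  have "continuous_on ((A \<times> ?B) \<times> ?S) (\<lambda>(p, v). \<Sum>m\<in>UNIV. v $ m *\<^sub>R (case p of (a, x) \<Rightarrow> D_ball (f a) x (axis m 1)))"
    unfolding split_beta'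
    by (intro continuous_on_sum continuous_on_scaleR continuous_intros
        continuous_on_compose2[OF Ck_fam_continuous[OF Ck_fam_D[OF f1], unfolded split_beta']]) auto
  hence cont: "continuous_on ((A \<times> ?B) \<times> ?S) (\<lambda>q. norm (case q of (p, v) \<Rightarrow> \<Sum>m\<in>UNIV. v $ m *\<^sub>R (case p of (a, x) \<Rightarrow> D_ball (f a) x (axis m 1))))"
    by (rule continuous_on_norm)
  have comp: "compact ((A \<times> ?B) \<times> ?S)" by (intro compact_Times A) auto
  have less: "norm (case q of (p, v) \<Rightarrow> \<Sum>m\<in>UNIV. v $ m *\<^sub>R (case p of (a, x) \<Rightarrow> D_ball (f a) x (axis m 1))) < 1"
    if q: "q \<in> (A \<times> ?B) \<times> ?S" for q
  proof -
    obtain a x v where q': "q = ((a, x), v)" "a \<in> A" "x \<in> ?B" "norm v = 1" using q by auto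
    have "(f a has_derivative D_ball (f a) x) (at x within ?B)"
      by (rule has_derivative_D_within[OF diff]) (use q' in auto)
    from onorm[OF has_derivative_bounded_linear[OF this], of v]
    have "norm (D_ball (f a) x v) < 1" using D_f_less[OF q'(2,3)] q'(4) by simp
    thus ?thesis using D_within_axis_sum[OF diff q'(3), of a v] q' by simp
  qed
  obtain c where c: "c < 1" "\<And>q. q \<in> (A \<times> ?B) \<times> ?S \<Longrightarrow>
      norm (case q of (p, v) \<Rightarrow> \<Sum>m\<in>UNIV. v $ m *\<^sub>R (case p of (a, x) \<Rightarrow> D_ball (f a) x (axis m 1))) \<le> c"
    using compact_uniform_less[OF comp cont less] by blast
  \<comment> \<open>The constant \<open>c\<close> may be negative when \<open>A\<close> is
    empty.\<close>
  define \<kappa> where "\<kappa> = max c 0"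
  have unit: "norm (D_ball (f a) x v) \<le> \<kappa>" if "a \<in> A" "x \<in> ?B" "norm v = 1" for a x v
    using c(2)[of "((a, x), v)"] D_within_axis_sum[OF diff that(2), of a v] that by (simp add: \<kappa>_def)
  have bound: "norm (D_ball (f a) x v) \<le> \<kappa> * norm v" if a: "a \<in> A" and x: "x \<in> ?B" for a x v
  proof (cases "v = 0")
    case True
    thus ?thesis using linear_0[OF has_derivative_linear[OF has_derivative_D_within[OF diff[OF a] x]]] by simp
  next
    case False
    interpret L: linear "D_ball (f a) x"
      by (rule has_derivative_linear[OF has_derivative_D_within[OF diff[OF a] x]])
    have "D_ball (f a) x v = norm v *\<^sub>R D_ball (f a) x (v /\<^sub>R norm v)"
      using False by (simp flip: L.scale)
    hence "norm (D_ball (f a) x v) = norm (norm v *\<^sub>R D_ball (f a) x (v /\<^sub>R norm v))" by (rule arg_cong)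
    also have "\<dots> = norm v * norm (D_ball (f a) x (v /\<^sub>R norm v))" by simp
    finally have "norm (D_ball (f a) x v) = norm v * norm (D_ball (f a) x (v /\<^sub>R norm v))" .
    also have "\<dots> \<le> norm v * \<kappa>" using unit[OF a x, of "v /\<^sub>R norm v"] False by (intro mult_left_mono) auto
    finally show ?thesis by (simp add: mult.commute)
  qed
  show ?thesis
  proof (rule that)
    show "0 \<le> \<kappa>" "\<kappa> < 1" using c(1) by (auto simp: \<kappa>_def)
    fix a x assume a: "a \<in> A" and x: "x \<in> ?B"
    have "norm (f a x - f a 0) \<le> \<kappa> * norm (x - 0)"
    proof (rule differentiable_bound[where S = ?B])
      show "(f a has_derivative D_ball (f a) y) (at y within ?B)" if "y \<in> ?B" for y
        by (rule has_derivative_D_within[OF diff[OF a] that])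
      show "onorm (D_ball (f a) y) \<le> \<kappa>" if "y \<in> ?B" for y
        by (rule onorm_bound[OF \<open>0 \<le> \<kappa>\<close> bound[OF a that]])
    qed (use x in auto)
    thus "norm (f a x) \<le> \<kappa> * norm x" using f_0[OF a] by simp
  qed
qed

lemma norm_f_le: "a \<in> A \<Longrightarrow> x \<in> unit_cball \<Longrightarrow> norm (f a x) \<le> norm x"
proof -
  assume a: "a \<in> A" "x \<in> unit_cball"
  obtain \<kappa> where \<kappa>: "0 \<le> \<kappa>" "\<kappa> < 1" "\<And>a x. a \<in> A \<Longrightarrow> x \<in> unit_cball \<Longrightarrow> norm (f a x) \<le> \<kappa> * norm x"
    using contraction_rate by metis
  have "\<kappa> * norm x \<le> 1 * norm x" using \<kappa> by (intro mult_right_mono) auto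
  thus ?thesis using \<kappa>(3)[OF a] by simp
qed

subsection \<open>The linearization operator on flat families\<close>

definition bounded_pd :: "nat set \<Rightarrow> real \<Rightarrow> ('a \<Rightarrow> real ^ 'n \<Rightarrow> real) \<Rightarrow> real \<Rightarrow> bool" where
  "bounded_pd L s w M \<longleftrightarrow>
     (\<forall>ms a x. length ms \<in> L \<longrightarrow> a \<in> A \<longrightarrow> norm x \<le> s \<longrightarrow> \<bar>pd ms (w a) x\<bar> \<le> M)"

lemma bounded_pdD:
  "bounded_pd L s w M \<Longrightarrow> length ms \<in> L \<Longrightarrow> a \<in> A \<Longrightarrow> norm x \<le> s \<Longrightarrow> \<bar>pd ms (w a) x\<bar> \<le> M"
  by (simp add: bounded_pd_def)

text \<open>At 0 the coefficients of order \<open>r\<close> are diagonal with entries below 1 by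
  \<open>domination\<close>, and by continuity their row sums stay below 1 nearby. The coefficients
  of lower order are merely bounded, but they multiply derivatives that \<open>flat_bound\<close>
  makes small with \<open>\<rho>\<close>.\<close>

lemma T_contracts:
  obtains \<rho> \<theta> :: real where "0 < \<rho>" "\<rho> \<le> 1" "real CARD('n) * \<rho> \<le> 1" "0 \<le> \<theta>" "\<theta> < 1"
    "\<And>w M. Ck r w \<Longrightarrow> flat r w \<Longrightarrow> 0 \<le> M \<Longrightarrow> bounded_pd {r} \<rho> w M \<Longrightarrow> bounded_pd {r} \<rho> (T i w) (\<theta> * M)"
proof -
  let ?E = "{ms :: 'n list. length ms = r}" and ?E' = "{ms :: 'n list. length ms < r}"
  have finE: "finite ?E" "finite ?E'"
    by (rule finite_subset[OF _ finite_lists_le[of r]], auto)+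
  \<comment> \<open>The row sum of the block of order \<open>r\<close>: the factor by which this
    block can enlarge a bound valid for all derivatives of order \<open>r\<close>.\<close>
  define R where "R vs a x = (\<Sum>ms\<in>?E. \<bar>cc vs ms a x / lam a i\<bar>)" for vs a x
  have lam': "continuous_on (A \<times> (unit_cball :: (real ^ 'n) set)) (\<lambda>p. lam (fst p) i)"
    by (rule continuous_on_compose2[OF continuous_lam]) (auto intro!: continuous_intros)
  have R_cont: "continuous_on (A \<times> unit_cball) (\<lambda>(a, x). R vs a x)" if "vs \<in> ?E" for vs
    unfolding R_def split_beta'
    using that lam_nz by (intro continuous_on_sum continuous_on_rabs continuous_on_divide lam'
        cc_continuous[unfolded split_beta']) auto
  have R0: "R vs a 0 = \<bar>lamp a vs / lam a i\<bar>" if "vs \<in> ?E" "a \<in> A" for vs a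
  proof -
    have "R vs a 0 = (\<Sum>ms\<in>?E. if ms = vs then \<bar>lamp a vs / lam a i\<bar> else 0)"
      unfolding R_def by (intro sum.cong refl) (use that cc_at_0 in auto)
    thus ?thesis using finE that by simp
  qed
  have "\<exists>d>0. \<forall>vs\<in>?E. \<forall>a\<in>A. R vs a 0 \<le> 1 - d"
  proof (rule finite_common_radius[OF finE(1)])
    fix vs assume vs: "vs \<in> ?E"
    have "continuous_on A (\<lambda>a. \<bar>lamp a vs / lam a i\<bar>)"
      by (intro continuous_on_rabs continuous_on_divide continuous_lamp continuous_lam) (use lam_nz in auto)
    moreover have "\<bar>lamp a vs / lam a i\<bar> < 1" if "a \<in> A" for a
      using domination[of vs a i] vs that lam_nz[OF that, of i] by (simp add: divide_less_eq abs_divide)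
    ultimately obtain c where "c < 1" "\<And>a. a \<in> A \<Longrightarrow> \<bar>lamp a vs / lam a i\<bar> \<le> c"
      using compact_uniform_less[OF A] by blast
    thus "\<exists>d>0. \<forall>a\<in>A. R vs a 0 \<le> 1 - d"
      using R0[OF vs] by (intro exI[of _ "1 - c"]) auto
  qed force
  then obtain d1 where d1: "d1 > 0" "\<And>vs a. vs \<in> ?E \<Longrightarrow> a \<in> A \<Longrightarrow> R vs a 0 \<le> 1 - d1" by blast
  have "\<exists>d>0. \<forall>vs\<in>?E. \<forall>a\<in>A. \<forall>x\<in>unit_cball. norm x \<le> d \<longrightarrow> dist (R vs a x) (R vs a 0) < d1 / 2"
    by (rule finite_common_radius[OF finE(1)], rule uniformly_close_to_0[OF A])
      (use R_cont d1 in auto)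
  then obtain d2 where d2: "d2 > 0" "\<And>vs a x. vs \<in> ?E \<Longrightarrow> a \<in> A \<Longrightarrow> x \<in> unit_cball \<Longrightarrow>
      norm x \<le> d2 \<Longrightarrow> dist (R vs a x) (R vs a 0) < d1 / 2" by blast
  obtain K where K: "K \<ge> 0" "\<And>vs ms a x. length vs \<le> r \<Longrightarrow> length ms \<le> r \<Longrightarrow> a \<in> A \<Longrightarrow> x \<in> unit_cball \<Longrightarrow>
      \<bar>cc vs ms a x / lam a i\<bar> \<le> K" using cc_bounded by metis
  define c where "c = real (card ?E') * K * CARD('n)"
  have "c \<ge> 0" using K by (simp add: c_def)
  \<comment> \<open>The four bounds serve in turn: row sums within \<open>d1 / 2\<close> of those at
    0, the unit ball, the premise of \<open>flat_bound\<close>, and lower orders contributing at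
    most \<open>d1 / 4\<close>.\<close>
  define \<rho> where "\<rho> = min (min d2 1) (min (1 / CARD('n)) (d1 / (4 * (c + 1))))"
  \<comment> \<open>The row sums leave \<open>1 - d1 / 2\<close> and the lower orders add
    \<open>d1 / 4\<close>; the maximum keeps the rate nonnegative.\<close>
  define \<theta> where "\<theta> = max 0 (1 - d1 / 4)"
  have \<rho>: "0 < \<rho>" "\<rho> \<le> 1" "\<rho> \<le> d2" "\<rho> \<le> 1 / CARD('n)" "\<rho> \<le> d1 / (4 * (c + 1))"
    using d1(1) d2(1) \<open>c \<ge> 0\<close> by (auto simp: \<rho>_def)
  have n\<rho>: "real CARD('n) * \<rho> \<le> 1" using \<rho>(4) by (simp add: field_simps)
  have "c * \<rho> \<le> (c + 1) * (d1 / (4 * (c + 1)))"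
    using \<rho> \<open>c \<ge> 0\<close> by (intro mult_mono) auto
  also have "\<dots> = d1 / 4" using \<open>c \<ge> 0\<close> by (simp add: field_simps)
  finally have c\<rho>: "c * \<rho> \<le> d1 / 4" .
  show ?thesis
  proof (rule that[OF \<rho>(1,2) n\<rho>])
    show "0 \<le> \<theta>" "\<theta> < 1" using d1 by (auto simp: \<theta>_def)
    fix w :: "'a \<Rightarrow> real ^ 'n \<Rightarrow> real" and M :: real
    assume w: "Ck r w" "flat r w" and M: "0 \<le> M" and bd: "bounded_pd {r} \<rho> w M"
    show "bounded_pd {r} \<rho> (T i w) (\<theta> * M)"
      unfolding bounded_pd_def
    proof (intro allI impI)
      fix vs :: "'n list" and a and x :: "real ^ 'n"
      assume "length vs \<in> {r}" and a: "a \<in> A" and x: "norm x \<le> \<rho>"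
      hence vs: "length vs = r" by simp
      have x': "x \<in> unit_cball" and fx: "norm (f a x) \<le> \<rho>" and "\<sigma> a \<in> A"
        using x \<rho> norm_f_le[OF a, of x] \<sigma> a by auto
      let ?t = "\<lambda>ms. cc vs ms a x / lam a i * pd ms (w (\<sigma> a)) (f a x)"
      have "pd vs (T i w a) x = (\<Sum>ms | length ms \<le> r. ?t ms)"
        using pd_T[OF w(1) order_refl _ a x', of vs i] vs by (simp add: sum_divide_distrib)
      also have "{ms :: 'n list. length ms \<le> r} = ?E \<union> ?E'" by auto
      also have "(\<Sum>ms\<in>?E \<union> ?E'. ?t ms) = (\<Sum>ms\<in>?E. ?t ms) + (\<Sum>ms\<in>?E'. ?t ms)"
        by (rule sum.union_disjoint) (use finE in auto)
      finally have "\<bar>pd vs (T i w a) x\<bar> \<le> \<bar>\<Sum>ms\<in>?E. ?t ms\<bar> + \<bar>\<Sum>ms\<in>?E'. ?t ms\<bar>" by simp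
      also have "\<bar>\<Sum>ms\<in>?E. ?t ms\<bar> \<le> (\<Sum>ms\<in>?E. \<bar>cc vs ms a x / lam a i\<bar> * M)"
        by (intro order_trans[OF sum_abs] sum_mono, unfold abs_mult, intro mult_left_mono)
          (use M bounded_pdD[OF bd] fx \<open>\<sigma> a \<in> A\<close> in auto)
      also have "\<dots> = R vs a x * M" by (simp add: R_def sum_distrib_right)
      also have "\<dots> \<le> (1 - d1 / 2) * M"
      proof (intro mult_right_mono M)
        have "\<bar>R vs a x - R vs a 0\<bar> < d1 / 2" "R vs a 0 \<le> 1 - d1"
          using d1(2)[of vs a] d2(2)[of vs a x] vs a x' x \<rho> by (auto simp: dist_real_def)
        thus "R vs a x \<le> 1 - d1 / 2" by (smt (verit) field_sum_of_halves)
      qed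
      also have "\<bar>\<Sum>ms\<in>?E'. ?t ms\<bar> \<le> (\<Sum>ms\<in>?E'. K * (CARD('n) * \<rho> * M))"
      proof (intro order_trans[OF sum_abs] sum_mono)
        fix ms :: "'n list" assume ms: "ms \<in> ?E'"
        have "\<bar>pd ms (w (\<sigma> a)) (f a x)\<bar> \<le> CARD('n) * \<rho> * M"
          by (rule flat_bound[OF w _ \<rho>(2) n\<rho> M]) (use bounded_pdD[OF bd] ms \<rho> fx \<open>\<sigma> a \<in> A\<close> in auto)
        thus "\<bar>?t ms\<bar> \<le> K * (CARD('n) * \<rho> * M)"
          unfolding abs_mult[of "cc vs ms a x / lam a i"]
          using K ms vs a x' by (intro mult_mono) auto
      qed
      also have "\<dots> = c * \<rho> * M" by (simp add: c_def)
      also have "\<dots> \<le> d1 / 4 * M" by (intro mult_right_mono c\<rho> M)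
      finally have "\<bar>pd vs (T i w a) x\<bar> \<le> (1 - d1 / 4) * M" by (simp add: algebra_simps)
      also have "\<dots> \<le> \<theta> * M" by (intro mult_right_mono M) (simp add: \<theta>_def)
      finally show "\<bar>pd vs (T i w a) x\<bar> \<le> \<theta> * M" .
    qed
  qed
qed

text \<open>No contraction here, but a gain in domain: control on a ball of radius \<open>s'\<close>
  passes to any ball that every \<open>f a\<close> maps into it, at the cost of a factor.\<close>

lemma T_bounded:
  obtains K :: real where "0 \<le> K"
    "\<And>w M s s'. Ck r w \<Longrightarrow> 0 \<le> M \<Longrightarrow> s \<le> 1 \<Longrightarrow>
      \<forall>a\<in>A. \<forall>x. norm x \<le> s \<longrightarrow> norm (f a x) \<le> s' \<Longrightarrow>
      bounded_pd {..r} s' w M \<Longrightarrow> bounded_pd {..r} s (T i w) (K * M)"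
proof -
  let ?E = "{ms :: 'n list. length ms \<le> r}"
  obtain K where K: "K \<ge> 0" "\<And>vs ms a x. length vs \<le> r \<Longrightarrow> length ms \<le> r \<Longrightarrow> a \<in> A \<Longrightarrow> x \<in> unit_cball \<Longrightarrow>
      \<bar>cc vs ms a x / lam a i\<bar> \<le> K" using cc_bounded by metis
  show ?thesis
  proof (rule that[of "card ?E * K"])
    show "0 \<le> card ?E * K" using K by simp
    fix w :: "'a \<Rightarrow> real ^ 'n \<Rightarrow> real" and M s s' :: real
    assume w: "Ck r w" and M: "0 \<le> M" and s: "s \<le> 1"
      "\<forall>a\<in>A. \<forall>x. norm x \<le> s \<longrightarrow> norm (f a x) \<le> s'" and bd: "bounded_pd {..r} s' w M"
    show "bounded_pd {..r} s (T i w) (card ?E * K * M)"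
      unfolding bounded_pd_def
    proof (intro allI impI)
      fix vs :: "'n list" and a and x :: "real ^ 'n"
      assume "length vs \<in> {..r}" and a: "a \<in> A" and x: "norm x \<le> s"
      hence vs: "length vs \<le> r" by simp
      have x': "x \<in> unit_cball" using x s by simp
      have "\<bar>pd vs (T i w a) x\<bar> =
          \<bar>\<Sum>ms | length ms \<le> length vs. cc vs ms a x / lam a i * pd ms (w (\<sigma> a)) (f a x)\<bar>"
        using pd_T[OF w order_refl vs a x', of i] by (simp add: sum_divide_distrib)
      also have "\<dots> \<le> (\<Sum>ms\<in>{ms :: 'n list. length ms \<le> length vs}. K * M)"
        by (intro order_trans[OF sum_abs] sum_mono, unfold abs_mult[of "cc _ _ _ _ / lam _ _"], intro mult_mono)
          (use K vs a x' bounded_pdD[OF bd] s x \<sigma> in auto)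
      also have "\<dots> \<le> (\<Sum>ms\<in>?E. K * M)"
        by (rule sum_mono2[OF finite_lists_le]) (use vs K M in auto)
      finally show "\<bar>pd vs (T i w a) x\<bar> \<le> card ?E * K * M" by simp
    qed
  qed
qed

text \<open>On the ball of radius \<open>\<rho>\<close> the derivatives of order \<open>r\<close>
  decay geometrically, and \<open>flat_bound\<close> hands this down to the lower orders. Since
  \<open>N\<close> steps of the dynamics bring the unit ball into that ball, \<open>N\<close>
  further applications of \<open>T\<close> carry the decay to the unit ball, at the price of the
  constant \<open>K ^ N\<close>.\<close>

lemma T_pow_bound:
  assumes w: "Ck r w" "flat r w"
  obtains N :: nat and M \<theta> :: real where "0 \<le> \<theta>" "\<theta> < 1"
    "\<And>n vs a x. length vs \<le> r \<Longrightarrow> a \<in> A \<Longrightarrow> x \<in> unit_cball \<Longrightarrow>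
      \<bar>pd vs ((T i ^^ (N + n)) w a) x\<bar> \<le> M * \<theta> ^ n"
proof -
  obtain \<rho> \<theta> :: real where \<rho>: "0 < \<rho>" "\<rho> \<le> 1" "real CARD('n) * \<rho> \<le> 1" and \<theta>: "0 \<le> \<theta>" "\<theta> < 1"
    and contr: "\<And>w M. Ck r w \<Longrightarrow> flat r w \<Longrightarrow> 0 \<le> M \<Longrightarrow> bounded_pd {r} \<rho> w M \<Longrightarrow> bounded_pd {r} \<rho> (T i w) (\<theta> * M)"
    using T_contracts[where i = i] by blast
  obtain M where M: "M \<ge> 0" "\<And>bs a x. set bs \<subseteq> Basis \<Longrightarrow> length bs \<le> r \<Longrightarrow> a \<in> A \<Longrightarrow> x \<in> unit_cball \<Longrightarrow>
      norm (iter_deriv unit_cball (w a) bs x) \<le> M"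
    using Ck_fam_bounded_basis[OF A compact_cball w(1)] by blast
  have top: "bounded_pd {r} \<rho> ((T i ^^ n) w) (M * \<theta> ^ n)" for n
  proof (induction n)
    case 0
    show ?case using M(2)[of "map (\<lambda>m. axis m 1) _"] \<rho>
      by (auto simp: bounded_pd_def axis_in_Basis_iff image_subset_iff)
  next
    case (Suc n)
    have "bounded_pd {r} \<rho> (T i ((T i ^^ n) w)) (\<theta> * (M * \<theta> ^ n))"
      by (rule contr[OF Ck_T_pow[OF w(1) order_refl] flat_T_pow[OF w(1) order_refl w(2)] _ Suc.IH])
        (use M(1) \<theta> in auto)
    thus ?case by (simp add: mult_ac)
  qed
  have near: "bounded_pd {..r} \<rho> ((T i ^^ n) w) (M * \<theta> ^ n)" for n
    unfolding bounded_pd_def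
  proof (intro allI impI)
    fix ms :: "'n list" and a and x :: "real ^ 'n"
    assume ms: "length ms \<in> {..r}" "a \<in> A" "norm x \<le> \<rho>"
    show "\<bar>pd ms ((T i ^^ n) w a) x\<bar> \<le> M * \<theta> ^ n"
    proof (cases "length ms = r")
      case True
      thus ?thesis using bounded_pdD[OF top] ms by auto
    next
      case False
      have "\<bar>pd ms ((T i ^^ n) w a) x\<bar> \<le> CARD('n) * \<rho> * (M * \<theta> ^ n)"
        by (rule flat_bound[OF Ck_T_pow[OF w(1) order_refl] flat_T_pow[OF w(1) order_refl w(2)] _ \<rho>(2,3) _ bounded_pdD[OF top]])
          (use False ms \<rho> \<theta> M(1) in auto)
      also have "\<dots> \<le> 1 * (M * \<theta> ^ n)" using \<rho>(3) M(1) \<theta> by (intro mult_right_mono) auto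
      finally show ?thesis by simp
    qed
  qed
  obtain \<kappa> where \<kappa>: "0 \<le> \<kappa>" "\<kappa> < 1" "\<And>a x. a \<in> A \<Longrightarrow> x \<in> unit_cball \<Longrightarrow> norm (f a x) \<le> \<kappa> * norm x"
    using contraction_rate by metis
  obtain N where N: "\<kappa> ^ N < \<rho>" using real_arch_pow_inv[OF \<rho>(1) \<kappa>(2)] by blast
  obtain K :: real where K: "0 \<le> K"
    "\<And>w M s s'. Ck r w \<Longrightarrow> 0 \<le> M \<Longrightarrow> s \<le> 1 \<Longrightarrow>
      \<forall>a\<in>A. \<forall>x. norm x \<le> s \<longrightarrow> norm (f a x) \<le> s' \<Longrightarrow>
      bounded_pd {..r} s' w M \<Longrightarrow> bounded_pd {..r} s (T i w) (K * M)"
    using T_bounded[where i = i] by blast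
  \<comment> \<open>The number \<open>j\<close> counts the steps needed to bring the ball of radius
    \<open>s\<close> into the one of radius \<open>\<rho>\<close>; each costs one factor
    \<open>K\<close> and leaves the rate \<open>\<theta>\<close> untouched.\<close>
  have far: "bounded_pd {..r} s ((T i ^^ (j + n)) w) (K ^ j * (M * \<theta> ^ n))"
    if "\<kappa> ^ j * s \<le> \<rho>" "0 \<le> s" "s \<le> 1" for j s n
    using that
  proof (induction j arbitrary: s)
    case 0
    thus ?case using near[of n] by (auto simp: bounded_pd_def)
  next
    case (Suc j)
    have "bounded_pd {..r} s (T i ((T i ^^ (j + n)) w)) (K * (K ^ j * (M * \<theta> ^ n)))"
    proof (rule K(2)[of "(T i ^^ (j + n)) w" "K ^ j * (M * \<theta> ^ n)" s "\<kappa> * s"])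
      show "\<forall>a\<in>A. \<forall>x. norm x \<le> s \<longrightarrow> norm (f a x) \<le> \<kappa> * s"
      proof (intro ballI allI impI)
        fix a and x :: "real ^ 'n" assume "a \<in> A" "norm x \<le> s"
        thus "norm (f a x) \<le> \<kappa> * s"
          using \<kappa>(3)[of a x] mult_left_mono[OF _ \<kappa>(1), of "norm x" s] Suc.prems by auto
      qed
      show "bounded_pd {..r} (\<kappa> * s) ((T i ^^ (j + n)) w) (K ^ j * (M * \<theta> ^ n))"
      proof (rule Suc.IH)
        show "\<kappa> ^ j * (\<kappa> * s) \<le> \<rho>" using Suc.prems(1) by (simp add: mult_ac)
        show "0 \<le> \<kappa> * s" using \<kappa> Suc.prems by simp
        show "\<kappa> * s \<le> 1" using mult_mono[of \<kappa> 1 s 1] \<kappa> Suc.prems by simp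
      qed
    qed (use Suc.prems Ck_T_pow[OF w(1)] K(1) M(1) \<theta> in auto)
    thus ?case by (simp add: mult_ac)
  qed
  show ?thesis
  proof (rule that[OF \<theta>])
    fix n and vs :: "'n list" and a and x :: "real ^ 'n"
    assume *: "length vs \<le> r" "a \<in> A" "x \<in> unit_cball"
    show "\<bar>pd vs ((T i ^^ (N + n)) w a) x\<bar> \<le> (K ^ N * M) * \<theta> ^ n"
      using bounded_pdD[OF far[of N 1 n]] * N by (simp add: mult.assoc)
  qed
qed

end

text \<open>The monomial $x^k / k!$ with the multiindex as a multiset. In this normalisation a
  partial derivative removes one element, so a coefficient of a polynomial equals the corresponding
  derivative at 0.\<close>

definition taylor_monomial :: "'n::finite multiset \<Rightarrow> real ^ 'n \<Rightarrow> real" where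
  "taylor_monomial k x = (\<Prod>i\<in>UNIV. x $ i ^ count k i / fact (count k i))"

lemma Ck_fam_taylor_monomial: "Ck_fam j A unit_cball (\<lambda>_. taylor_monomial k)"
  unfolding taylor_monomial_def[abs_def] divide_inverse
  by (intro Ck_fam_prod[OF unique_deriv_unit_cball] Ck_fam_mult[OF unique_deriv_unit_cball]
      Ck_fam_power[OF unique_deriv_unit_cball] Ck_fam_linear[OF unique_deriv_unit_cball]
      Ck_fam_const[OF unique_deriv_unit_cball] bounded_linear_vec_nth) auto

lemma taylor_monomial_0: "taylor_monomial k 0 = (if k = {#} then 1 else 0)"
proof (cases "k = {#}")
  case False
  then obtain i where "i \<in># k" by blast
  thus ?thesis using False unfolding taylor_monomial_def
    by (auto intro!: bexI[of _ i] simp: power_0_left)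
qed (simp add: taylor_monomial_def)

lemma D_taylor_monomial:
  assumes "x \<in> (unit_cball :: (real ^ 'n) set)"
  shows "D_within unit_cball (taylor_monomial k) x (axis m 1) =
    (if m \<in># k then taylor_monomial (k - {#m#}) x else 0)"
proof -
  let ?g = "\<lambda>i x. x $ i ^ count k i / fact (count k i) :: real"
  let ?g' = "\<lambda>i v. of_nat (count k i) * v $ i * x $ i ^ (count k i - 1) / fact (count k i) :: real"
  have "((\<lambda>x. \<Prod>i\<in>UNIV. ?g i x) has_derivative (\<lambda>v. \<Sum>i\<in>UNIV. ?g' i v * (\<Prod>j\<in>UNIV - {i}. ?g j x)))
      (at x within unit_cball)"
    by (intro has_derivative_prod) (auto intro!: derivative_eq_intros bounded_linear.has_derivative[OF bounded_linear_vec_nth])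
  hence "(taylor_monomial k has_derivative (\<lambda>v. \<Sum>i\<in>UNIV. ?g' i v * (\<Prod>j\<in>UNIV - {i}. ?g j x)))
      (at x within unit_cball)" unfolding taylor_monomial_def[abs_def] .
  from D_within_eq[OF unique_deriv_unit_cball assms this]
  have "D_within unit_cball (taylor_monomial k) x (axis m 1) =
      (\<Sum>i\<in>UNIV. ?g' i (axis m 1) * (\<Prod>j\<in>UNIV - {i}. ?g j x))" by simp
  also have "\<dots> = (\<Sum>i\<in>{m}. ?g' i (axis m 1) * (\<Prod>j\<in>UNIV - {i}. ?g j x))"
    by (intro sum.mono_neutral_right) (auto simp: axis_def)
  finally have eq: "D_within unit_cball (taylor_monomial k) x (axis m 1) =
      ?g' m (axis m 1) * (\<Prod>j\<in>UNIV - {m}. ?g j x)" by simp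
  show ?thesis
  proof (cases "m \<in># k")
    case True
    then obtain c where c: "count k m = Suc c" by (metis count_greater_zero_iff gr0_implies_Suc)
    have "taylor_monomial (k - {#m#}) x = x $ m ^ c / fact c * (\<Prod>j\<in>UNIV - {m}. ?g j x)"
      unfolding taylor_monomial_def by (subst prod.remove[of _ m]) (auto simp: c)
    moreover have "?g' m (axis m 1) = x $ m ^ c / fact c" by (simp add: c del: of_nat_Suc)
    ultimately show ?thesis using eq True by simp
  next
    case False
    hence "count k m = 0" by (simp add: not_in_iff)
    thus ?thesis using eq False by simp
  qed
qed

lemma pd_taylor_monomial:
  "x \<in> (unit_cball :: (real ^ 'n) set) \<Longrightarrow> pd ms (taylor_monomial k) x =
    (if mset ms \<subseteq># k then taylor_monomial (k - mset ms) x else 0)"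
proof (induction ms arbitrary: x)
  case (Cons m ms)
  have "pd (m # ms) (taylor_monomial k) x =
      D_within unit_cball (\<lambda>x. if mset ms \<subseteq># k then taylor_monomial (k - mset ms) x else 0) x (axis m 1)"
    using D_within_cong[of unit_cball "pd ms (taylor_monomial k)"
        "\<lambda>x. if mset ms \<subseteq># k then taylor_monomial (k - mset ms) x else 0" x] Cons by simp
  also have "\<dots> = (if mset (m # ms) \<subseteq># k then taylor_monomial (k - mset (m # ms)) x else 0)"
  proof (cases "mset ms \<subseteq># k")
    case True
    hence "mset (m # ms) \<subseteq># k \<longleftrightarrow> m \<in># k - mset ms"
      by (auto simp: subseteq_mset_def in_diff_count Suc_le_eq)
    thus ?thesis using True D_taylor_monomial[OF Cons.prems, of "k - mset ms" m] by simp
  next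
    case False
    moreover have "mset ms \<subseteq># mset (m # ms)" by simp
    ultimately have "\<not> mset (m # ms) \<subseteq># k" using subset_mset.order_trans by blast
    thus ?thesis using False D_within_eq[OF unique_deriv_unit_cball Cons.prems has_derivative_const[of "0::real"]] by simp
  qed
  finally show ?case .
qed simp

subsection \<open>Linearization of one coordinate\<close>

context contracting_family
begin

lemma lamp_perm: "mset ms = mset ms' \<Longrightarrow> lamp a ms = lamp a ms'"
  by (metis mset_map prod_mset_prod_list)

text \<open>The multiplier is a contraction along \<open>\<sigma>\<close>, or its inverse is one
  along \<open>\<tau>\<close>. In the second case it is taken at \<open>\<tau> a\<close>, because
  the equation at \<open>\<tau> a\<close> is the one that determines the value at
  \<open>a\<close>.\<close>

lemma lamp_div_cases:
  assumes "length ms \<noteq> 1" "length ms < r"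
  shows "(\<forall>a\<in>A. \<bar>lamp a ms / lam a i\<bar> < 1) \<or>
    (\<forall>a\<in>A. lamp a ms \<noteq> 0 \<and> \<bar>lam (\<tau> a) i / lamp (\<tau> a) ms\<bar> < 1)"
  using resonance[OF assms, of i]
proof
  assume "\<forall>a\<in>A. \<bar>lamp a ms\<bar> < \<bar>lam a i\<bar>"
  thus ?thesis using lam_nz by (auto simp: abs_divide divide_less_eq)
next
  assume *: "\<forall>a\<in>A. \<bar>lamp a ms\<bar> > \<bar>lam a i\<bar>"
  hence "\<bar>lamp a ms\<bar> > 0" if "a \<in> A" for a using that by (meson abs_ge_zero le_less_trans)
  thus ?thesis using * \<tau> by (auto simp: abs_divide divide_less_eq)
qed

lemma cohomological_lamp:
  assumes ms: "length ms \<noteq> 1" "length ms < r" and b: "continuous_on A b"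
  shows "\<exists>q. continuous_on A q \<and> (\<forall>a\<in>A. lamp a ms / lam a i * q (\<sigma> a) - q a = - b a)"
  using lamp_div_cases[OF ms, of i]
proof
  assume "\<forall>a\<in>A. \<bar>lamp a ms / lam a i\<bar> < 1"
  moreover have "continuous_on A (\<lambda>a. lamp a ms / lam a i)"
    by (intro continuous_intros continuous_lam continuous_lamp) (use lam_nz in auto)
  ultimately obtain q where "continuous_on A q" "\<And>a. a \<in> A \<Longrightarrow> q a = lamp a ms / lam a i * q (\<sigma> a) + b a"
    using cohomological_solution[OF A \<sigma>(1) \<sigma>_image, of "\<lambda>a. lamp a ms / lam a i" b] b by blast
  thus ?thesis by (intro exI[of _ q]) auto
next
  assume *: "\<forall>a\<in>A. lamp a ms \<noteq> 0 \<and> \<bar>lam (\<tau> a) i / lamp (\<tau> a) ms\<bar> < 1"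
  \<comment> \<open>At \<open>\<tau> a\<close> the equation reads
    \<open>q a = ?\<nu> a * (q (\<tau> a) - b (\<tau> a))\<close>, which is contracting along
    \<open>\<tau>\<close>.\<close>
  let ?\<nu> = "\<lambda>a. lam (\<tau> a) i / lamp (\<tau> a) ms"
  have \<tau>A: "\<tau> ` A \<subseteq> A" using \<tau> by auto
  have \<nu>: "continuous_on A ?\<nu>"
    by (intro continuous_on_divide continuous_on_compose2[OF continuous_lam \<tau>(1) \<tau>A]
        continuous_on_compose2[OF continuous_lamp \<tau>(1) \<tau>A]) (use * \<tau> in auto)
  moreover have "continuous_on A (\<lambda>a. - (?\<nu> a * b (\<tau> a)))"
    by (intro continuous_on_minus continuous_on_mult \<nu> continuous_on_compose2[OF b \<tau>(1) \<tau>A])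
  ultimately obtain q where q: "continuous_on A q" "\<And>a. a \<in> A \<Longrightarrow> q a = ?\<nu> a * q (\<tau> a) + - (?\<nu> a * b (\<tau> a))"
    using cohomological_solution[OF A \<tau>(1) \<tau>A, of ?\<nu> "\<lambda>a. - (?\<nu> a * b (\<tau> a))"] * by blast
  have "lamp a ms / lam a i * q (\<sigma> a) - q a = - b a" if a: "a \<in> A" for a
  proof -
    have "q (\<sigma> a) = lam a i / lamp a ms * (q a - b a)"
      using q(2)[OF \<sigma>(2)[OF a]] \<tau>\<sigma>[OF a] by (simp add: algebra_simps diff_divide_distrib)
    thus ?thesis using * a lam_nz[OF a, of i] by simp
  qed
  thus ?thesis using q(1) by blast
qed

lemma Ck_T_diff: "Ck k P \<Longrightarrow> k \<le> r \<Longrightarrow> Ck k (\<lambda>a x. T i P a x - P a x)"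
  by (intro Ck_fam_diff[OF UB] Ck_T)

lemma coordinate_derivatives:
  "pd [] (\<lambda>x :: real ^ 'n. x $ i) 0 = 0" "pd [m] (\<lambda>x :: real ^ 'n. x $ i) 0 = (if m = i then 1 else 0)"
proof -
  have "D_within unit_cball (\<lambda>x. x $ i) 0 = (\<lambda>v :: real ^ 'n. v $ i)"
    by (rule D_within_eq[OF UB zero_in_ball bounded_linear.has_derivative[OF bounded_linear_vec_nth has_derivative_ident]])
  thus "pd [m] (\<lambda>x :: real ^ 'n. x $ i) 0 = (if m = i then 1 else 0)" by (simp add: axis_def)
qed simp

definition jet :: "'n \<Rightarrow> ('a \<Rightarrow> real ^ 'n \<Rightarrow> real) \<Rightarrow> bool" where
  "jet i P \<longleftrightarrow> (\<forall>a\<in>A. P a 0 = 0 \<and> (\<forall>m. pd [m] (P a) 0 = (if m = i then 1 else 0)))"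

text \<open>Only jets of order less than \<open>r\<close> have to be normalised: by \<open>domination\<close>, the operator
  \<open>T\<close> is already contracting on families whose jets of order less than \<open>r\<close> vanish.\<close>

lemma approximate_linearization:
  assumes "2 \<le> d" "d \<le> r"
  shows "\<exists>P. Ck r P \<and> jet i P \<and> flat d (\<lambda>a x. T i P a x - P a x)"
  using assms
proof (induction d rule: nat_induct_at_least)
  case base
  \<comment> \<open>Order 1 lies outside \<open>resonance\<close> and is settled by hand: the only
    nonzero first derivative of the coordinate is along \<open>i\<close>, where the multiplier is
    \<open>lam a i / lam a i\<close>.\<close>
  let ?P = "\<lambda>(a :: 'a) (x :: real ^ 'n). x $ i"
  have P: "Ck r ?P" by (rule Ck_fam_linear[OF UB bounded_linear_vec_nth])
  have fl1: "flat 1 ?P" by (simp add: flat_def)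
  have "pd ms (\<lambda>x. T i ?P a x - ?P a x) 0 = 0" if "length ms < 2" "a \<in> A" for ms a
  proof -
    have "pd ms (\<lambda>x. T i ?P a x - ?P a x) 0 = pd ms (T i ?P a) 0 - pd ms (?P a) 0"
      by (rule iter_deriv_diff[OF UB Ck_T[OF P] P]) (use that r in auto)
    also have "pd ms (T i ?P a) 0 = lamp a ms / lam a i * pd ms (?P (\<sigma> a)) 0"
      by (rule pd_T_at_0[OF P order_refl flat_mono[OF fl1]]) (use that r in auto)
    finally show ?thesis
      using that coordinate_derivatives(2)[of i] lam_nz[OF that(2), of i]
      by (cases ms) auto
  qed
  thus ?case using P coordinate_derivatives[of i] by (intro exI[of _ ?P]) (auto simp: jet_def flat_def)
next
  case (Suc d)
  then obtain P where P: "Ck r P" "jet i P" "flat d (\<lambda>a x. T i P a x - P a x)" by auto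
  define g where "g = (\<lambda>a x. T i P a x - P a x)"
  have g: "Ck r g" "flat d g" using Ck_T_diff[OF P(1)] P(3) by (auto simp: g_def)
  \<comment> \<open>The unknown coefficients are indexed by multisets, as monomials are, but
    derivatives by lists; \<open>lo\<close> picks an ordering.\<close>
  define lo where "lo k = (SOME ms. mset ms = k)" for k :: "'n multiset"
  have lo: "mset (lo k) = k" for k unfolding lo_def using someI_ex[OF ex_mset] .
  have "\<forall>k\<in>{k. size k = d}. \<exists>q. continuous_on A q \<and>
      (\<forall>a\<in>A. lamp a (lo k) / lam a i * q (\<sigma> a) - q a = - pd (lo k) (g a) 0)"
  proof
    fix k :: "'n multiset" assume "k \<in> {k. size k = d}"
    hence len: "length (lo k) = d" by (metis lo mem_Collect_eq size_mset)
    have "continuous_on A (\<lambda>a. pd (lo k) (g a) 0)"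
      by (rule Ck_fam_continuous_param[OF Ck_fam_iter_deriv[OF g(1)]]) (use len Suc in auto)
    from cohomological_lamp[OF _ _ this] show "\<exists>q. continuous_on A q \<and>
      (\<forall>a\<in>A. lamp a (lo k) / lam a i * q (\<sigma> a) - q a = - pd (lo k) (g a) 0)"
      using len Suc by simp
  qed
  from bchoice[OF this] obtain q where q: "\<And>k. size k = d \<Longrightarrow> continuous_on A (q k)"
    "\<And>k a. size k = d \<Longrightarrow> a \<in> A \<Longrightarrow> lamp a (lo k) / lam a i * q k (\<sigma> a) - q k a = - pd (lo k) (g a) 0"
    by auto
  let ?K = "{k :: 'n multiset. size k = d}"
  have "?K \<subseteq> mset ` {ms. length ms \<le> d}"
    using lo by (metis (mono_tags, lifting) image_eqI mem_Collect_eq order_refl size_mset subsetI)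
  hence finK: "finite ?K" using finite_lists_le finite_surj by blast
  \<comment> \<open>The correction is homogeneous of degree \<open>d\<close>, so its lower jets at 0
    vanish and what was achieved below order \<open>d\<close> is preserved.\<close>
  define Q where "Q a x = (\<Sum>k\<in>?K. q k a *\<^sub>R taylor_monomial k x)" for a x
  have Q_term: "Ck r (\<lambda>a x. q k a *\<^sub>R taylor_monomial k x)" if "k \<in> ?K" for k
    by (intro Ck_fam_scaleR[OF UB] Ck_fam_const[OF UB] Ck_fam_taylor_monomial q) (use that in auto)
  have Q: "Ck r Q"
    unfolding Q_def[abs_def] by (rule Ck_fam_sum[OF UB Q_term])
  have pdQ: "pd ms (Q a) 0 = (if length ms = d then q (mset ms) a else 0)"
    if "length ms \<le> d" "a \<in> A" for ms a
  proof -
    have len: "length (map (\<lambda>m. axis m (1::real)) ms) \<le> r" using that Suc by simp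
    have "pd ms (Q a) 0 = (\<Sum>k\<in>?K. pd ms (\<lambda>x. q k a *\<^sub>R taylor_monomial k x) 0)"
      unfolding Q_def by (rule iter_deriv_sum[OF UB finK Q_term len that(2) zero_in_ball])
    also have "\<dots> = (\<Sum>k\<in>?K. if k = mset ms then q k a else 0)"
    proof (intro sum.cong refl)
      fix k assume k: "k \<in> ?K"
      have "pd ms (\<lambda>x. q k a *\<^sub>R taylor_monomial k x) 0 = q k a *\<^sub>R pd ms (taylor_monomial k) 0"
        by (rule iter_deriv_scaleR[OF UB Ck_fam_taylor_monomial[of r A k] len that(2) zero_in_ball])
      moreover have "mset ms = k" if "mset ms \<subseteq># k" "k - mset ms = {#}"
        using that by (simp add: subset_mset.antisym Diff_eq_empty_iff_mset)
      ultimately show "pd ms (\<lambda>x. q k a *\<^sub>R taylor_monomial k x) 0 = (if k = mset ms then q k a else 0)"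
        using pd_taylor_monomial[OF zero_in_ball, where ms = ms and k = k] by (auto simp: taylor_monomial_0)
    qed
    finally show ?thesis using finK by simp
  qed
  have flQ: "flat d Q" using pdQ by (simp add: flat_def)
  let ?P = "\<lambda>a x. P a x + Q a x"
  have P': "Ck r ?P" by (rule Ck_fam_add[OF UB P(1) Q])
  have defect: "(\<lambda>x. T i ?P a x - ?P a x) = (\<lambda>x. g a x + (T i Q a x - Q a x))" for a
    by (auto simp: T_def g_def add_divide_distrib)
  have "flat (Suc d) (\<lambda>a x. T i ?P a x - ?P a x)"
    unfolding flat_def defect
  proof (intro allI impI)
    fix ms :: "'n list" and a assume ms: "length ms < Suc d" and a: "a \<in> A"
    have len: "length (map (\<lambda>m. axis m (1::real)) ms) \<le> r" using ms Suc by simp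
    have "pd ms (\<lambda>x. g a x + (T i Q a x - Q a x)) 0 = pd ms (g a) 0 + pd ms (\<lambda>x. T i Q a x - Q a x) 0"
      by (rule iter_deriv_add[OF UB g(1) Ck_T_diff[OF Q order_refl] len a zero_in_ball])
    also have "pd ms (\<lambda>x. T i Q a x - Q a x) 0 = pd ms (T i Q a) 0 - pd ms (Q a) 0"
      by (rule iter_deriv_diff[OF UB Ck_T[OF Q order_refl] Q len a zero_in_ball])
    also have "pd ms (T i Q a) 0 = lamp a ms / lam a i * pd ms (Q (\<sigma> a)) 0"
      by (rule pd_T_at_0[OF Q order_refl flat_mono[OF flQ] _ a]) (use ms len in auto)
    finally have eq: "pd ms (\<lambda>x. g a x + (T i Q a x - Q a x)) 0 =
        pd ms (g a) 0 + (lamp a ms / lam a i * pd ms (Q (\<sigma> a)) 0 - pd ms (Q a) 0)" .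
    show "pd ms (\<lambda>x. g a x + (T i Q a x - Q a x)) 0 = 0"
    proof (cases "length ms = d")
      case True
      \<comment> \<open>The equation was solved for the ordering \<open>lo\<close> only; symmetry of
        the derivatives extends it to every list.\<close>
      have "pd (lo (mset ms)) (g a) 0 = pd ms (g a) 0"
      proof (rule iter_deriv_perm[where k = r and A = "{0::real}"])
        show "Ck_fam r {0::real} unit_cball (\<lambda>_. g a)"
          using Ck_fam_imp_Cr_on[OF g(1) a] Cr_on_iff_Ck_fam by blast
        show "interior unit_cball \<noteq> ({} :: (real ^ 'n) set)" by simp
        show "mset (map (\<lambda>m. axis m (1::real)) (lo (mset ms))) = mset (map (\<lambda>m. axis m 1) ms)"
          by (simp add: lo)
        show "length (map (\<lambda>m. axis m (1::real)) (lo (mset ms))) \<le> r"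
          using len by (metis length_map lo size_mset)
      qed auto
      thus ?thesis unfolding eq using q(2)[of "mset ms" a] True ms a \<sigma>(2)[OF a]
        by (simp add: pdQ lamp_perm[OF lo])
    next
      case False
      thus ?thesis unfolding eq using ms a \<sigma>(2)[OF a] flatD[OF g(2), of ms a] by (simp add: pdQ)
    qed
  qed
  moreover have "jet i ?P"
    unfolding jet_def
  proof (intro ballI conjI allI)
    fix a m assume a: "a \<in> A"
    show "P a 0 + Q a 0 = 0" using P(2) a pdQ[of "[]" a] Suc by (simp add: jet_def)
    have "pd [m] (\<lambda>x. P a x + Q a x) 0 = pd [m] (P a) 0 + pd [m] (Q a) 0"
      by (rule iter_deriv_add[OF UB P(1) Q _ a zero_in_ball]) (use r in auto)
    thus "pd [m] (\<lambda>x. P a x + Q a x) 0 = (if m = i then 1 else 0)"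
      using P(2) a pdQ[of "[m]" a] Suc by (simp add: jet_def)
  qed
  ultimately show ?case using P' by blast
qed

text \<open>Successive iterates of \<open>T\<close> on \<open>P\<close> differ by iterates on the
  flat defect \<open>g\<close>, so they converge geometrically with all derivatives up to order
  \<open>r\<close>. The limit is a fixed point of \<open>T\<close>, which is the conjugacy equation
  for this coordinate.\<close>

lemma scalar_linearization_exists:
  "\<exists>\<eta>. Ck r \<eta> \<and> jet i \<eta> \<and> (\<forall>a\<in>A. \<forall>x\<in>unit_cball. \<eta> (\<sigma> a) (f a x) = lam a i * \<eta> a x)"
proof -
  let ?B = "unit_cball :: (real ^ 'n) set"
  obtain P where P: "Ck r P" "jet i P" "flat r (\<lambda>a x. T i P a x - P a x)"
    using approximate_linearization[OF r order_refl] by blast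
  define g where "g = (\<lambda>a x. T i P a x - P a x)"
  have g: "Ck r g" "flat r g" using Ck_T_diff[OF P(1)] P(3) by (auto simp: g_def)
  have step: "(\<lambda>a x. (T i ^^ Suc n) P a x - (T i ^^ n) P a x) = (T i ^^ n) g" for n
    unfolding g_def T_pow_diff funpow_Suc_right by simp
  have pd_step: "pd ms ((T i ^^ Suc n) P a) x - pd ms ((T i ^^ n) P a) x = pd ms ((T i ^^ n) g a) x"
    if "length ms \<le> r" "a \<in> A" "x \<in> ?B" for ms a x n
    using iter_deriv_diff[OF UB Ck_T_pow[OF P(1) order_refl, of "Suc n" i] Ck_T_pow[OF P(1) order_refl, of n i], of
        "map (\<lambda>m. axis m 1) ms" a x] that fun_cong[OF step[of n], of a] by simp
  obtain N M \<theta> where \<theta>: "0 \<le> \<theta>" "\<theta> < 1"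
    and M: "\<And>n vs a x. length vs \<le> r \<Longrightarrow> a \<in> A \<Longrightarrow> x \<in> unit_cball \<Longrightarrow>
      \<bar>pd vs ((T i ^^ (N + n)) g a) x\<bar> \<le> M * \<theta> ^ n"
    using T_pow_bound[OF g, where i = i] by metis
  \<comment> \<open>The geometric bound only starts after \<open>N\<close> iterations.\<close>
  define h where "h n = (T i ^^ (N + n)) P" for n
  have h: "Ck r (h n)" for n unfolding h_def by (rule Ck_T_pow[OF P(1) order_refl])
  have "\<exists>l. uniform_limit (A \<times> ?B) (\<lambda>n (a, x). iter_deriv ?B (h n a) bs x) l sequentially"
    if bs: "set bs \<subseteq> Basis" "length bs \<le> r" for bs
  proof -
    obtain ms where ms: "bs = map (\<lambda>m. axis m 1) ms" using Basis_list_axis[OF bs(1)] .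
    show ?thesis
    proof (rule uniform_limit_geometric[OF _ \<theta>, of "A \<times> ?B" "\<lambda>n (a, x). iter_deriv ?B (h n a) bs x" M])
      fix n and p :: "'a \<times> (real ^ 'n)" assume "p \<in> A \<times> ?B"
      then obtain a x where p: "p = (a, x)" "a \<in> A" "x \<in> ?B" by auto
      have "pd ms (h (Suc n) a) x - pd ms (h n a) x = pd ms ((T i ^^ (N + n)) g a) x"
        using pd_step[of ms a x "N + n"] p bs ms unfolding h_def by simp
      thus "norm ((case p of (a, x) \<Rightarrow> iter_deriv ?B (h (Suc n) a) bs x) -
          (case p of (a, x) \<Rightarrow> iter_deriv ?B (h n a) bs x)) \<le> M * \<theta> ^ n"
        using M[of ms a x n] p bs ms by simp
    qed blast
  qed
  then obtain L where L: "\<And>bs. set bs \<subseteq> Basis \<Longrightarrow> length bs \<le> r \<Longrightarrow>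
      uniform_limit (A \<times> ?B) (\<lambda>n (a, x). iter_deriv ?B (h n a) bs x) (L bs) sequentially" by metis
  define l where "l bs a x = L bs (a, x)" for bs a x
  have lim: "uniform_limit (A \<times> ?B) (\<lambda>n (a, x). iter_deriv ?B (h n a) bs x) (\<lambda>(a, x). l bs a x) sequentially"
    if "set bs \<subseteq> Basis" "length bs \<le> r" for bs
    using L[OF that] by (simp add: l_def)
  have "Ck r (l []) \<and> (\<forall>bs. set bs \<subseteq> Basis \<longrightarrow> length bs \<le> r \<longrightarrow>
      (\<forall>a\<in>A. \<forall>x\<in>?B. iter_deriv ?B (l [] a) bs x = l bs a x))"
    by (rule Ck_fam_uniform_limit[OF UB convex_cball h lim])
  hence \<eta>: "Ck r (l [])" and pd_l: "\<And>bs a x. set bs \<subseteq> Basis \<Longrightarrow> length bs \<le> r \<Longrightarrow> a \<in> A \<Longrightarrow> x \<in> ?B \<Longrightarrow>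
      iter_deriv ?B (l [] a) bs x = l bs a x" by auto
  have conv: "(\<lambda>n. pd ms (h n a) x) \<longlonglongrightarrow> pd ms (l [] a) x"
    if "length ms \<le> r" "a \<in> A" "x \<in> ?B" for ms a x
  proof -
    have bs: "set (map (\<lambda>m. axis m 1) ms) \<subseteq> (Basis :: (real ^ 'n) set)" "length (map (\<lambda>m. axis m (1::real)) ms) \<le> r"
      using that(1) by (auto simp: axis_in_Basis_iff)
    show ?thesis using tendsto_uniform_limitI[OF lim[OF bs], of "(a, x)"] pd_l[OF bs that(2,3)] that by simp
  qed
  \<comment> \<open>Iterates of \<open>g\<close> stay flat, so the jets of order below
    \<open>r\<close> are constant along the sequence and the normalisation \<open>jet\<close>
    survives in the limit.\<close>
  have pd_0: "pd ms (l [] a) 0 = pd ms (P a) 0" if "length ms < r" "a \<in> A" for ms a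
  proof -
    have "pd ms ((T i ^^ n) P a) 0 = pd ms (P a) 0" for n
    proof (induction n)
      case (Suc n)
      have "flat r ((T i ^^ n) g)" by (rule flat_T_pow[OF g(1) order_refl g(2)]) simp
      from flatD[OF this that] show ?case using pd_step[of ms a 0 n] that Suc by simp
    qed simp
    hence "(\<lambda>n. pd ms (h n a) 0) = (\<lambda>_. pd ms (P a) 0)" by (simp add: h_def)
    with conv[of ms a 0] that show ?thesis by (simp add: LIMSEQ_const_iff)
  qed
  have "jet i (l [])"
    using P(2) pd_0[of "[]"] pd_0[of "[_]"] r by (simp add: jet_def)
  moreover have "l [] (\<sigma> a) (f a x) = lam a i * l [] a x" if a: "a \<in> A" and x: "x \<in> ?B" for a x
  proof -
    have "(\<lambda>n. h n (\<sigma> a) (f a x) / lam a i) \<longlonglongrightarrow> l [] (\<sigma> a) (f a x) / lam a i"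
      using conv[of "[]" "\<sigma> a" "f a x"] \<sigma>(2)[OF a] f_ball[OF a x] lam_nz[OF a] by (intro tendsto_intros) auto
    moreover have "(\<lambda>n. h n (\<sigma> a) (f a x) / lam a i) = (\<lambda>n. h (Suc n) a x)"
      by (simp add: h_def T_def)
    moreover have "(\<lambda>n. h (Suc n) a x) \<longlonglongrightarrow> l [] a x"
      using conv[of "[]" a x] a x by (intro LIMSEQ_Suc) auto
    ultimately have "l [] (\<sigma> a) (f a x) / lam a i = l [] a x" using LIMSEQ_unique by metis
    thus ?thesis using lam_nz[OF a, of i] by (simp add: field_simps)
  qed
  ultimately show ?thesis using \<eta> by blast
qed

text \<open>The value and gradient of \<open>u\<close> vanish at 0. Each next order of its jet
  solves a homogeneous cohomological equation and vanishes too, up to \<open>flat r\<close>; then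
  \<open>u\<close>, being fixed by \<open>T\<close>, is subject to the geometric decay of the
  iterates and is 0.\<close>

lemma scalar_linearization_unique:
  assumes u: "Ck r u" and fl: "flat 2 u"
    and eq: "\<And>a x. a \<in> A \<Longrightarrow> x \<in> unit_cball \<Longrightarrow> u (\<sigma> a) (f a x) = lam a i * u a x"
    and a: "a \<in> A" and x: "x \<in> unit_cball"
  shows "u a x = 0"
proof -
  have Tu: "T i u a x = u a x" if "a \<in> A" "x \<in> unit_cball" for a x
    using eq[OF that] lam_nz[OF that(1)] by (simp add: T_def)
  have "flat d u" if "2 \<le> d" "d \<le> r" for d
    using that
  proof (induction d rule: nat_induct_at_least)
    case base
    show ?case by (rule fl)
  next
    case (Suc d)
    have "pd ms (u a) 0 = 0" if ms: "length ms < Suc d" and a: "a \<in> A" for ms a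
    proof (cases "length ms = d")
      case True
      have rec: "pd ms (u a) 0 = lamp a ms / lam a i * pd ms (u (\<sigma> a)) 0" if "a \<in> A" for a
      proof -
        have "pd ms (T i u a) 0 = lamp a ms / lam a i * pd ms (u (\<sigma> a)) 0"
          by (rule pd_T_at_0[OF u order_refl _ _ that]) (use True Suc in auto)
        thus ?thesis using iter_deriv_cong[of unit_cball "T i u a" "u a" 0] Tu[OF that] by simp
      qed
      have cont: "continuous_on A (\<lambda>a. pd ms (u a) 0)"
        by (rule Ck_fam_continuous_param[OF Ck_fam_iter_deriv[OF u]]) (use True Suc in auto)
      have "length ms \<noteq> 1" "length ms < r" using True Suc by auto
      from lamp_div_cases[OF this, of i] show ?thesis
      proof
        assume "\<forall>a\<in>A. \<bar>lamp a ms / lam a i\<bar> < 1"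
        thus ?thesis
          by (intro cohomological_unique[OF A \<sigma>_image _ cont rec a]) auto
      next
        assume *: "\<forall>a\<in>A. lamp a ms \<noteq> 0 \<and> \<bar>lam (\<tau> a) i / lamp (\<tau> a) ms\<bar> < 1"
        \<comment> \<open>The same recursion solved for its right-hand side and shifted by
          \<open>\<tau>\<close>, to be contracting backwards.\<close>
        have rec': "pd ms (u a) 0 = lam (\<tau> a) i / lamp (\<tau> a) ms * pd ms (u (\<tau> a)) 0" if "a \<in> A" for a
          using rec[OF \<tau>(2)[OF that]] \<sigma>\<tau>[OF that] * \<tau>(2)[OF that] lam_nz[OF \<tau>(2)[OF that], of i]
          by simp
        have "\<tau> ` A \<subseteq> A" using \<tau> by auto
        thus ?thesis by (rule cohomological_unique[OF A _ _ cont rec' a]) (use * in blast)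
      qed
    next
      case False
      thus ?thesis using Suc ms a by (simp add: flat_def)
    qed
    thus ?case by (simp add: flat_def)
  qed
  hence flr: "flat r u" using r by simp
  have pow: "(T i ^^ n) u a x = u a x" if "a \<in> A" "x \<in> unit_cball" for n a x
    using that
  proof (induction n arbitrary: a x)
    case (Suc n)
    thus ?case using \<sigma>(2) f_ball Tu[OF Suc.prems] by (simp add: T_def)
  qed simp
  obtain N M \<theta> where \<theta>: "0 \<le> \<theta>" "\<theta> < 1"
    and M: "\<And>n vs a x. length vs \<le> r \<Longrightarrow> a \<in> A \<Longrightarrow> x \<in> unit_cball \<Longrightarrow>
      \<bar>pd vs ((T i ^^ (N + n)) u a) x\<bar> \<le> M * \<theta> ^ n"
    using T_pow_bound[OF u flr, where i = i] by metis
  have "\<bar>u a x\<bar> \<le> M * \<theta> ^ n" for n using M[of "[]" a x n] a x pow by simp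
  moreover have "(\<lambda>n. M * \<theta> ^ n) \<longlonglongrightarrow> M * 0"
    by (intro tendsto_intros LIMSEQ_realpow_zero \<theta>)
  ultimately have "\<bar>u a x\<bar> \<le> M * 0" by (intro LIMSEQ_le_const) auto
  thus ?thesis by simp
qed

subsection \<open>Linearizing diffeomorphisms\<close>

text \<open>After \<open>N\<close> steps the dynamics brings every pair of points within
  \<open>\<rho>\<close> of 0; the property holds there and is pulled back step by step. Pairs are
  used for injectivity, and the diagonal for statements about one point.\<close>

lemma propagate:
  assumes "\<rho> > 0"
    and near: "\<And>a x y. a \<in> A \<Longrightarrow> x \<in> unit_cball \<Longrightarrow> y \<in> unit_cball \<Longrightarrow>
      norm x \<le> \<rho> \<Longrightarrow> norm y \<le> \<rho> \<Longrightarrow> Q a x y"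
    and step: "\<And>a x y. a \<in> A \<Longrightarrow> x \<in> unit_cball \<Longrightarrow> y \<in> unit_cball \<Longrightarrow>
      Q (\<sigma> a) (f a x) (f a y) \<Longrightarrow> Q a x y"
    and a: "a \<in> A" and xy: "x \<in> unit_cball" "y \<in> unit_cball"
  shows "Q a x y"
proof -
  obtain \<kappa> where \<kappa>: "0 \<le> \<kappa>" "\<kappa> < 1" "\<And>a x. a \<in> A \<Longrightarrow> x \<in> unit_cball \<Longrightarrow> norm (f a x) \<le> \<kappa> * norm x"
    using contraction_rate by metis
  obtain N where N: "\<kappa> ^ N < \<rho>" using real_arch_pow_inv[OF \<open>\<rho> > 0\<close> \<kappa>(2)] by blast
  have "Q a x y" if "a \<in> A" "norm x \<le> s" "norm y \<le> s" "s \<le> 1" "0 \<le> s" "\<kappa> ^ n * s \<le> \<rho>" for n s a x y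
    using that
  proof (induction n arbitrary: s a x y)
    case 0
    thus ?case by (intro near) auto
  next
    case (Suc n)
    have xy: "x \<in> unit_cball" "y \<in> unit_cball" using Suc.prems by auto
    have le: "norm (f a x) \<le> \<kappa> * s" "norm (f a y) \<le> \<kappa> * s"
      using \<kappa>(3)[OF Suc.prems(1) xy(1)] \<kappa>(3)[OF Suc.prems(1) xy(2)]
        mult_left_mono[OF Suc.prems(2) \<kappa>(1)] mult_left_mono[OF Suc.prems(3) \<kappa>(1)] by linarith+
    have "Q (\<sigma> a) (f a x) (f a y)"
      by (rule Suc.IH[OF \<sigma>(2)[OF Suc.prems(1)] le])
        (use Suc.prems mult_mono[of \<kappa> 1 s 1] \<kappa> in \<open>auto simp: mult_ac\<close>)
    thus ?case by (rule step[OF Suc.prems(1) xy])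
  qed
  from this[of a x 1 y N] show ?thesis using a xy N by simp
qed

abbreviation "Lam a \<equiv> D_ball (f a) 0"

lemma bounded_linear_Lam: "a \<in> A \<Longrightarrow> bounded_linear (Lam a)"
  using Ck_fam_has_derivative[OF f _ _ zero_in_ball] r has_derivative_bounded_linear by force

text \<open>Near 0 the map is close to the identity in $C^1$, on a radius uniform in
  \<open>a\<close>; the conjugacy with the injective \<open>f a\<close> extends injectivity of the
  map and of its derivative to the ball, and \<open>embedding\<close> supplies the smooth
  inverse.\<close>

lemma conjugacy_diffeo:
  fixes h :: "'a \<Rightarrow> real ^ 'n \<Rightarrow> real ^ 'n"
  assumes h: "Ck_fam r A unit_cball h"
    and D0: "\<And>a. a \<in> A \<Longrightarrow> D_ball (h a) 0 = id"
    and conj: "\<And>a x. a \<in> A \<Longrightarrow> x \<in> unit_cball \<Longrightarrow> h (\<sigma> a) (f a x) = Lam a (h a x)"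
    and a: "a \<in> A"
  shows "Cr_diffeo_into r unit_cball (h a)"
proof -
  let ?B = "unit_cball :: (real ^ 'n) set"
  have h1: "Ck_fam (Suc (r - 1)) A ?B h" using h r by simp
  have diff: "h a differentiable_on ?B" if "a \<in> A" for a
    using Ck_fam_differentiable[OF h1 _ that] by simp
  \<comment> \<open>With \<open>CARD('n)\<close> columns each off by
    \<open>1 / (2 * CARD('n))\<close>, the derivative is within 1/2 of the identity.\<close>
  have "\<exists>d>0. \<forall>m\<in>(UNIV :: 'n set). \<forall>a\<in>A. \<forall>x\<in>?B. norm x \<le> d \<longrightarrow>
      dist (D_ball (h a) x (axis m 1)) (D_ball (h a) 0 (axis m 1)) < 1 / (2 * CARD('n))"
    by (rule finite_common_radius[OF finite], rule uniformly_close_to_0[OF A])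
      (auto intro: Ck_fam_continuous[OF Ck_fam_D[OF h1]])
  then obtain d where d: "d > 0" "\<And>m a x. a \<in> A \<Longrightarrow> x \<in> ?B \<Longrightarrow> norm x \<le> d \<Longrightarrow>
      dist (D_ball (h a) x (axis m 1)) (D_ball (h a) 0 (axis m 1)) < 1 / (2 * CARD('n))" by blast
  define \<rho> where "\<rho> = min d 1"
  have \<rho>: "\<rho> > 0" "\<rho> \<le> 1" "\<rho> \<le> d" using d by (auto simp: \<rho>_def)
  have close: "norm (D_ball (h a) x v - v) \<le> 1 / 2 * norm v" if a: "a \<in> A" and x: "norm x \<le> \<rho>" for a x v
  proof -
    have x': "x \<in> ?B" using x \<rho> by auto
    have "D_ball (h a) x v - v = (\<Sum>m\<in>UNIV. v $ m *\<^sub>R (D_ball (h a) x (axis m 1) - axis m 1))"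
      unfolding D_within_axis_sum[OF diff[OF a] x', of v]
      by (simp add: scaleR_diff_right sum_subtractf basis_expansion flip: scalar_mult_eq_scaleR)
    also have "norm \<dots> \<le> (\<Sum>m\<in>(UNIV :: 'n set). norm v * (1 / (2 * CARD('n))))"
    proof (rule sum_norm_le)
      fix m
      have "norm (D_ball (h a) x (axis m 1) - axis m 1) \<le> 1 / (2 * CARD('n))"
        using d(2)[OF a x', of m] x \<rho> D0[OF a] by (simp add: dist_norm)
      thus "norm (v $ m *\<^sub>R (D_ball (h a) x (axis m 1) - axis m 1)) \<le> norm v * (1 / (2 * CARD('n)))"
        unfolding norm_scaleR using component_le_norm_cart[of v m] by (intro mult_mono) auto
    qed
    finally show ?thesis by simp
  qed
  \<comment> \<open>Near 0 the difference of \<open>h a\<close> and the identity is Lipschitz with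
    constant 1/2. Elsewhere, equal values of \<open>h a\<close> give equal values of
    \<open>h (\<sigma> a)\<close> at the images under \<open>f a\<close>.\<close>
  have inj: "h a x = h a y \<longrightarrow> x = y" if "a \<in> A" "x \<in> ?B" "y \<in> ?B" for a x y
  proof (rule propagate[OF \<rho>(1) _ _ that])
    fix a and x y :: "real ^ 'n" assume a: "a \<in> A" and xy: "norm x \<le> \<rho>" "norm y \<le> \<rho>"
    have "norm ((h a x - x) - (h a y - y)) \<le> 1 / 2 * norm (x - y)"
    proof (rule differentiable_bound[where S = "cball 0 \<rho>"])
      fix z assume z: "z \<in> cball (0 :: real ^ 'n) \<rho>"
      have sub: "cball 0 \<rho> \<subseteq> ?B" using \<rho> by auto
      have "(h a has_derivative D_ball (h a) z) (at z within cball 0 \<rho>)"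
        by (rule has_derivative_subset[OF has_derivative_D_within[OF diff[OF a]] sub]) (use z sub in blast)
      thus "((\<lambda>x. h a x - x) has_derivative (\<lambda>v. D_ball (h a) z v - v)) (at z within cball 0 \<rho>)"
        by (intro has_derivative_diff has_derivative_ident)
      show "onorm (\<lambda>v. D_ball (h a) z v - v) \<le> 1 / 2"
        by (rule onorm_bound) (use close[OF a] z in auto)
    qed (use xy in auto)
    thus "h a x = h a y \<longrightarrow> x = y" by (auto simp: norm_minus_commute)
  next
    fix a and x y :: "real ^ 'n" assume a: "a \<in> A" and xy: "x \<in> ?B" "y \<in> ?B"
      and IH: "h (\<sigma> a) (f a x) = h (\<sigma> a) (f a y) \<longrightarrow> f a x = f a y"
    show "h a x = h a y \<longrightarrow> x = y"
      using IH conj[OF a xy(1)] conj[OF a xy(2)] inj_onD[OF f_inj[OF a] _ xy] by auto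
  qed
  \<comment> \<open>The differentiated conjugacy sends a kernel vector at \<open>x\<close> to one at
    \<open>f a x\<close>, through the injective derivative of \<open>f a\<close>.\<close>
  have D_inj: "\<forall>v. D_ball (h a) x v = 0 \<longrightarrow> v = 0" if "a \<in> A" "x \<in> ?B" for a x
  proof (rule propagate[OF \<rho>(1) _ _ that that(2)])
    fix a and x :: "real ^ 'n" assume ax: "a \<in> A" "norm x \<le> \<rho>"
    show "\<forall>v. D_ball (h a) x v = 0 \<longrightarrow> v = 0"
    proof (intro allI impI)
      fix v assume "D_ball (h a) x v = 0"
      hence "norm (0 - v) \<le> 1 / 2 * norm v" using close[OF ax, of v] by (simp only:)
      thus "v = 0" by simp
    qed
  next
    fix a and x :: "real ^ 'n" assume a: "a \<in> A" and x: "x \<in> ?B" and IH: "\<forall>v. D_ball (h (\<sigma> a)) (f a x) v = 0 \<longrightarrow> v = 0"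
    show "\<forall>v. D_ball (h a) x v = 0 \<longrightarrow> v = 0"
    proof (intro allI impI)
      fix v assume v: "D_ball (h a) x v = 0"
      have "((\<lambda>x. h (\<sigma> a) (f a x)) has_derivative (\<lambda>v. D_ball (h (\<sigma> a)) (f a x) (D_ball (f a) x v)))
          (at x within ?B)"
        by (rule has_derivative_comp_f[OF diff[OF \<sigma>(2)[OF a]] a x])
      hence "((\<lambda>x. Lam a (h a x)) has_derivative (\<lambda>v. D_ball (h (\<sigma> a)) (f a x) (D_ball (f a) x v)))
          (at x within ?B)"
        by (subst has_derivative_within_cong[OF conj[OF a, symmetric] x])
      moreover have "((\<lambda>x. Lam a (h a x)) has_derivative (\<lambda>v. Lam a (D_ball (h a) x v))) (at x within ?B)"
        by (rule bounded_linear.has_derivative[OF bounded_linear_Lam[OF a] has_derivative_D_within[OF diff[OF a] x]])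
      ultimately have "D_ball (h (\<sigma> a)) (f a x) (D_ball (f a) x v) = Lam a (D_ball (h a) x v)"
        using unique_derivD[OF UB x] by metis
      also have "\<dots> = 0" unfolding v using D_f_0[OF a] by (simp add: vec_eq_iff)
      finally have "D_ball (f a) x v = 0" using IH by blast
      thus "v = 0" by (rule D_f_inj[OF a x])
    qed
  qed
  have "embedding unit_cball (h a) r"
  proof
    show "Ck_fam r {0::real} unit_cball (\<lambda>_. h a)"
      using Ck_fam_imp_Cr_on[OF h a] Cr_on_iff_Ck_fam by blast
    show "inj_on (h a) unit_cball" using inj[OF a] by (auto intro: inj_onI)
  qed (use UB r D_inj[OF a] in auto)
  thus ?thesis by (rule embedding.Cr_diffeo_into)
qed

section \<open>Passage between the coordinates and the linearization\<close>

lemma linearizes_component: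
  assumes "linearizes r A \<sigma> f h"
  shows "Ck_fam r A unit_cball h" "Ck r (\<lambda>a x. h a x $ i)" "jet i (\<lambda>a x. h a x $ i)"
    "\<And>a x. a \<in> A \<Longrightarrow> x \<in> unit_cball \<Longrightarrow> h (\<sigma> a) (f a x) $ i = lam a i * h a x $ i"
proof -
  show h: "Ck_fam r A unit_cball h"
    using assms Cr_families_imp_Ck_fam[OF UB compact_cball] unfolding linearizes_def by blast
  thus "Ck r (\<lambda>a x. h a x $ i)" by (rule Ck_fam_nth[OF UB])
  show "jet i (\<lambda>a x. h a x $ i)"
    unfolding jet_def
  proof (intro ballI conjI allI)
    fix a m assume a: "a \<in> A"
    show "h a 0 $ i = 0" using assms a by (simp add: linearizes_def)
    have "(h a has_derivative D_ball (h a) 0) (at 0 within unit_cball)"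
      by (rule Ck_fam_has_derivative[OF h _ a]) (use r in auto)
    moreover have "D_ball (h a) 0 = id" using assms a by (simp add: linearizes_def)
    ultimately have "(h a has_derivative id) (at 0 within unit_cball)" by simp
    from bounded_linear.has_derivative[OF bounded_linear_vec_nth this]
    have "((\<lambda>x. h a x $ i) has_derivative (\<lambda>v. v $ i)) (at 0 within unit_cball)" by simp
    from D_within_eq[OF UB zero_in_ball this]
    show "pd [m] (\<lambda>x. h a x $ i) 0 = (if m = i then 1 else 0)" by (simp add: axis_def)
  qed
  show "h (\<sigma> a) (f a x) $ i = lam a i * h a x $ i" if "a \<in> A" "x \<in> unit_cball" for a x
    using assms that D_f_0[OF that(1)] by (simp add: linearizes_def)
qed

text \<open>In each coordinate both solutions have the same value and gradient at 0, so their
  difference satisfies \<open>flat 2\<close> and the scalar uniqueness applies.\<close>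

lemma linearizes_unique:
  assumes h: "linearizes r A \<sigma> f h" and h': "linearizes r A \<sigma> f h'"
    and a: "a \<in> A" and x: "x \<in> unit_cball"
  shows "h' a x = h a x"
proof -
  have "h' a x $ i - h a x $ i = 0" for i
  proof (rule scalar_linearization_unique[where u = "\<lambda>a x. h' a x $ i - h a x $ i" and i = i, OF _ _ _ a x])
    note c = linearizes_component(2-4)[OF h, where i = i] and c' = linearizes_component(2-4)[OF h', where i = i]
    show "Ck r (\<lambda>a x. h' a x $ i - h a x $ i)" by (rule Ck_fam_diff[OF UB c'(1) c(1)])
    show "flat 2 (\<lambda>a x. h' a x $ i - h a x $ i)"
      unfolding flat_def
    proof (intro allI impI)
      fix ms :: "'n list" and a assume ms: "length ms < 2" and a: "a \<in> A"
      have "pd ms (\<lambda>x. h' a x $ i - h a x $ i) 0 = pd ms (\<lambda>x. h' a x $ i) 0 - pd ms (\<lambda>x. h a x $ i) 0"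
        by (rule iter_deriv_diff[OF UB c'(1) c(1) _ a zero_in_ball]) (use ms r in auto)
      also have "\<dots> = 0"
      proof (cases ms)
        case Nil
        thus ?thesis using c(2) c'(2) a by (simp add: jet_def)
      next
        case (Cons m ms')
        hence ms_eq: "ms = [m]" using ms by simp
        show ?thesis unfolding ms_eq
          using bspec[OF c(2)[unfolded jet_def] a] bspec[OF c'(2)[unfolded jet_def] a]
          by (simp del: iter_deriv.simps list.map)
      qed
      finally show "pd ms (\<lambda>x. h' a x $ i - h a x $ i) 0 = 0" .
    qed
    show "h' (\<sigma> a) (f a x) $ i - h (\<sigma> a) (f a x) $ i = lam a i * (h' a x $ i - h a x $ i)"
      if "a \<in> A" "x \<in> unit_cball" for a x
      using c(3)[OF that] c'(3)[OF that] by (simp add: right_diff_distrib)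
  qed
  thus ?thesis by (simp add: vec_eq_iff)
qed

lemma linearizes_exists: "\<exists>h. linearizes r A \<sigma> f h"
proof -
  have "\<forall>i. \<exists>\<eta>. Ck r \<eta> \<and> jet i \<eta> \<and> (\<forall>a\<in>A. \<forall>x\<in>unit_cball. \<eta> (\<sigma> a) (f a x) = lam a i * \<eta> a x)"
    using scalar_linearization_exists by blast
  then obtain \<eta> where \<eta>: "\<And>i. Ck r (\<eta> i)" "\<And>i. jet i (\<eta> i)"
    "\<And>i a x. a \<in> A \<Longrightarrow> x \<in> unit_cball \<Longrightarrow> \<eta> i (\<sigma> a) (f a x) = lam a i * \<eta> i a x" by metis
  define h where "h a x = (\<chi> i. \<eta> i a x)" for a x
  have h: "Ck_fam r A unit_cball h" by (rule Ck_fam_vec[OF UB]) (simp add: h_def \<eta>(1))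
  have D0: "D_ball (h a) 0 = id" if a: "a \<in> A" for a
  proof
    fix v
    have diff: "\<eta> i a differentiable_on unit_cball" for i
      using Ck_fam_differentiable[OF \<eta>(1) _ a] r by simp
    have "(h a has_derivative D_ball (h a) 0) (at 0 within unit_cball)"
      by (rule Ck_fam_has_derivative[OF h _ a]) (use r in auto)
    hence "((\<lambda>x. h a x $ i) has_derivative (\<lambda>v. D_ball (h a) 0 v $ i)) (at 0 within unit_cball)" for i
      by (rule bounded_linear.has_derivative[OF bounded_linear_vec_nth])
    moreover have "(\<lambda>x. h a x $ i) = \<eta> i a" for i by (simp add: h_def)
    ultimately have "(\<eta> i a has_derivative (\<lambda>v. D_ball (h a) 0 v $ i)) (at 0 within unit_cball)" for i
      by metis
    from D_within_eq[OF UB zero_in_ball this]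
    have "D_ball (h a) 0 v $ i = D_within unit_cball (\<eta> i a) 0 v" for i by simp
    also have "\<dots> i = (\<Sum>m\<in>UNIV. v $ m * pd [m] (\<eta> i a) 0)" for i
      using D_within_axis_sum[OF diff zero_in_ball, of i v] by simp
    also have "\<dots> i = v $ i" for i
      using \<eta>(2)[of i] a unfolding jet_def
      by (simp del: iter_deriv.simps list.map add: if_distrib[of "\<lambda>c. _ * c"] cong: if_cong)
    finally show "D_ball (h a) 0 v = id v" by (simp add: vec_eq_iff)
  qed
  have conj: "h (\<sigma> a) (f a x) = Lam a (h a x)" if "a \<in> A" "x \<in> unit_cball" for a x
    using \<eta>(3)[OF that] D_f_0[OF that(1)] by (simp add: h_def vec_eq_iff)
  have "h a 0 = 0" if "a \<in> A" for a
    using \<eta>(2) that by (simp add: h_def vec_eq_iff jet_def)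
  moreover have "h \<in> Cr_families r A unit_cball"
    by (rule Ck_fam_imp_Cr_families[OF UB compact_cball _ h]) auto
  ultimately show ?thesis
    unfolding linearizes_def using conjugacy_diffeo[OF h D0 conj] D0 conj by blast
qed

end

section \<open>From powers of eigenvalues to products along lists\<close>

lemma eigval_power_count:
  "eigval_power f a (count (mset ms)) = prod_list (map (eigval f a) ms)"
proof (induction ms)
  case (Cons m ms)
  have "eigval_power f a (count (mset (m # ms))) =
      (\<Prod>i\<in>UNIV. (if i = m then eigval f a i else 1) * eigval f a i ^ count (mset ms) i)"
    unfolding eigval_power_def by (intro prod.cong) auto
  also have "\<dots> = eigval f a m * eigval_power f a (count (mset ms))"
    by (simp add: prod.distrib eigval_power_def)
  finally show ?case using Cons.IH by (simp only: list.map prod_list.Cons)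
qed (simp add: eigval_power_def)

lemma sum_count_mset: "sum (count (mset ms)) (UNIV :: 'n::finite set) = length ms"
proof -
  have "sum (count (mset ms)) UNIV = sum (count (mset ms)) (set_mset (mset ms))"
    by (rule sum.mono_neutral_right) (auto simp: not_in_iff)
  also have "\<dots> = size (mset ms)" by (rule size_multiset_overloaded_eq[symmetric])
  finally show ?thesis by simp
qed

text \<open>The sign dichotomy is a premise of its own because it has two sources: (H3) for a single
  admissible family, and convergence for the family that joins a sequence to its limit.\<close>

lemma contracting_familyI:
  fixes f :: "'a::metric_space \<Rightarrow> real ^ 'n \<Rightarrow> real ^ 'n"
  assumes "compact A" "homeomorphism A A \<sigma> \<tau>" "r \<ge> 2"
    and f: "Ck_fam r A unit_cball f" and H: "H1 r A f" "H2 A f" "H4 r A f"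
    and resonance: "\<And>i ms. length ms \<noteq> 1 \<Longrightarrow> length ms < r \<Longrightarrow>
      (\<forall>a\<in>A. \<bar>prod_list (map (eigval f a) ms)\<bar> < \<bar>eigval f a i\<bar>) \<or>
      (\<forall>a\<in>A. \<bar>prod_list (map (eigval f a) ms)\<bar> > \<bar>eigval f a i\<bar>)"
  shows "contracting_family A \<sigma> \<tau> r f (eigval f)"
proof
  show dom: "\<bar>prod_list (map (eigval f a) ms)\<bar> < \<bar>eigval f a i\<bar>" if "length ms = r" "a \<in> A" for i ms a
    using H(3) that sum_count_mset[of ms] unfolding H4_def
    by (metis eigval_power_count order_refl)
  \<comment> \<open>(H4) makes the modulus of the eigenvalue strictly larger than some absolute
    value, hence positive; any list of length \<open>r\<close> will do.\<close>
  show "eigval f a i \<noteq> 0" if "a \<in> A" for a i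
    using dom[of "replicate r i" a i] that by auto
  show "D_ball (f a) 0 v = (\<chi> i. eigval f a i * v $ i)" if "a \<in> A" for a v
    using H(2) that unfolding H2_def by blast
  show "v = 0" if "a \<in> A" "x \<in> unit_cball" "D_ball (f a) x v = 0" for a x v
    using Cr_diffeo_into_D_inj[OF unique_deriv_unit_cball _ _ that(2,3)] H(1) that(1) \<open>r \<ge> 2\<close>
    unfolding H1_def by force
  show "inj_on (f a) unit_cball" if "a \<in> A" for a
    using H(1) that unfolding H1_def Cr_diffeo_into_def by blast
  show "f a x \<in> unit_cball" if "a \<in> A" "x \<in> unit_cball" for a x
    using H(1) that unfolding H1_def by blast
qed (use assms in \<open>auto simp: homeomorphism_def H1_def\<close>)

lemma admissible_imp_Ck_fam: "f \<in> admissible_families r A \<Longrightarrow> Ck_fam r A unit_cball f"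
  unfolding admissible_families_def
  using Cr_families_imp_Ck_fam[OF unique_deriv_unit_cball compact_cball] by blast

text \<open>Kept as a signed real number, so that its sign can be compared along convergent
  sequences.\<close>

definition eig_gap :: "('a \<Rightarrow> real ^ 'n \<Rightarrow> real ^ 'n) \<Rightarrow> 'a \<Rightarrow> 'n \<Rightarrow> 'n list \<Rightarrow> real" where
  "eig_gap f a i ms = \<bar>eigval f a i\<bar> - \<bar>prod_list (map (eigval f a) ms)\<bar>"

lemma H3_eig_gap:
  assumes "H3 A f" "length ms \<noteq> 1" "a \<in> A" "b \<in> A"
  shows "eig_gap f a i ms \<noteq> 0" "sgn (eig_gap f a i ms) = sgn (eig_gap f b i ms)"
  using assms sum_count_mset[of ms] unfolding H3_def eig_gap_def
  by (metis eigval_power_count right_minus_eq)+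

lemma sgn_constant_cases:
  assumes "\<And>a. a \<in> A \<Longrightarrow> sgn (g a) = (s :: real)" "s \<noteq> 0"
  shows "(\<forall>a\<in>A. g a > 0) \<or> (\<forall>a\<in>A. g a < 0)"
  using assms by (cases "s > 0") (force simp: sgn_if split: if_splits)+

lemma admissible_contracting_family:
  assumes "compact A" "homeomorphism A A \<sigma> \<tau>" "r \<ge> 2" and f: "f \<in> admissible_families r A"
  shows "contracting_family A \<sigma> \<tau> r f (eigval f)"
proof (rule contracting_familyI[OF assms(1-3) admissible_imp_Ck_fam[OF f]])
  show "H1 r A f" "H2 A f" "H4 r A f" using f by (auto simp: admissible_families_def)
  have H3: "H3 A f" using f by (simp add: admissible_families_def)
  fix i and ms :: "'b list" assume ms: "length ms \<noteq> 1"
  have "(\<forall>a\<in>A. eig_gap f a i ms > 0) \<or> (\<forall>a\<in>A. eig_gap f a i ms < 0)"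
  proof (cases "A = {}")
    case False
    then obtain a0 where "a0 \<in> A" by blast
    thus ?thesis using H3_eig_gap[OF H3 ms] sgn_constant_cases[of A "\<lambda>a. eig_gap f a i ms"]
      by (metis sgn_zero_iff)
  qed simp
  thus "(\<forall>a\<in>A. \<bar>prod_list (map (eigval f a) ms)\<bar> < \<bar>eigval f a i\<bar>) \<or>
      (\<forall>a\<in>A. \<bar>prod_list (map (eigval f a) ms)\<bar> > \<bar>eigval f a i\<bar>)"
    by (simp add: eig_gap_def)
qed

lemma Ck_fam_reparam:
  fixes w :: "'b::topological_space \<Rightarrow> 'v::euclidean_space \<Rightarrow> 'w::real_inner"
  assumes U: "unique_deriv S" and w: "Ck_fam k B S w" and \<phi>: "continuous_on A \<phi>" "\<phi> ` A \<subseteq> B"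
  shows "Ck_fam k A S (\<lambda>a. w (\<phi> a))"
  using Ck_fam_compose[OF U Ck_fam_linear[OF U bounded_linear_ident] w \<phi>] by simp

subsection \<open>Continuous dependence\<close>

definition reciprocals :: "real set" where
  "reciprocals = insert 0 (range (\<lambda>n. 1 / real (Suc n)))"

definition reciprocal_index :: "real \<Rightarrow> nat" where
  "reciprocal_index = inv (\<lambda>n. 1 / real (Suc n))"

text \<open>Stated in the form to which the simplifier brings
  \<open>1 / real (Suc n)\<close>.\<close>

lemma reciprocal_index_eq [simp]: "reciprocal_index (1 / (1 + real n)) = n"
proof -
  have "inj (\<lambda>n. 1 / real (Suc n))" by (auto intro: injI)
  from inv_f_f[OF this, of n] show ?thesis by (simp add: reciprocal_index_def)
qed

lemma compact_reciprocals: "compact reciprocals"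
  unfolding reciprocals_def by (rule compact_sequence_with_limit[OF LIMSEQ_Suc[OF lim_1_over_n]])

lemma reciprocals_cases:
  assumes "t \<in> reciprocals"
  obtains "t = 0" | n where "t = 1 / real (Suc n)" "t > 0"
  using assms by (auto simp: reciprocals_def)

text \<open>Only finitely many reciprocals are at least \<open>t / 2\<close>, so a nonzero time has
  a positive distance from all others.\<close>

lemma reciprocals_isolated:
  assumes "t \<in> reciprocals" "t \<noteq> 0"
  obtains d where "d > 0" "\<And>t'. t' \<in> reciprocals \<Longrightarrow> dist t' t < d \<Longrightarrow> t' = t"
proof -
  have "t > 0" using assms by (auto simp: reciprocals_def)
  have "finite {s \<in> reciprocals. s \<ge> t / 2}"
  proof (rule finite_subset)
    show "{s \<in> reciprocals. s \<ge> t / 2} \<subseteq> (\<lambda>n. 1 / real (Suc n)) ` {..nat \<lceil>2 / t\<rceil>}"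
    proof
      fix s assume s: "s \<in> {s \<in> reciprocals. s \<ge> t / 2}"
      then obtain n where n: "s = 1 / real (Suc n)" using \<open>t > 0\<close> by (auto simp: reciprocals_def)
      have "real (Suc n) * (t / 2) \<le> 1" using s n by (simp add: field_simps)
      hence "real n \<le> 2 / t" using \<open>t > 0\<close> by (simp add: field_simps)
      hence "n \<le> nat \<lceil>2 / t\<rceil>" by linarith
      thus "s \<in> (\<lambda>n. 1 / real (Suc n)) ` {..nat \<lceil>2 / t\<rceil>}" using n by blast
    qed
  qed simp
  from finite_set_avoid[OF this, of t] obtain d where d: "d > 0"
    "\<And>s. s \<in> reciprocals \<Longrightarrow> s \<ge> t / 2 \<Longrightarrow> s \<noteq> t \<Longrightarrow> d \<le> dist t s" by auto
  show ?thesis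
  proof (rule that[of "min d (t / 2)"])
    fix t' assume t': "t' \<in> reciprocals" "dist t' t < min d (t / 2)"
    hence "t' \<ge> t / 2" using abs_ge_minus_self[of "t' - t"] by (simp add: dist_real_def)
    thus "t' = t" using d(2)[OF t'(1)] t'(2) by (force simp: dist_commute)
  qed (use d \<open>t > 0\<close> in auto)
qed

text \<open>Nonzero times are isolated, so there continuity is that of one \<open>u n\<close>. At
  time 0 the assumed rate \<open>1 / real (Suc n)\<close> is the time parameter itself: the member
  at time \<open>s\<close> is within \<open>s\<close> of the limit.\<close>

lemma continuous_on_reciprocals:
  fixes v :: "'a::metric_space \<Rightarrow> 'v::metric_space \<Rightarrow> 'w::metric_space"
  assumes v: "continuous_on (A \<times> S) (\<lambda>(a, x). v a x)"
    and u: "\<And>n. continuous_on (A \<times> S) (\<lambda>(a, x). u n a x)"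
    and close: "\<And>n a x. a \<in> A \<Longrightarrow> x \<in> S \<Longrightarrow> dist (u n a x) (v a x) \<le> 1 / real (Suc n)"
  shows "continuous_on ((A \<times> reciprocals) \<times> S) (\<lambda>((a, t), x). if t = 0 then v a x else u (reciprocal_index t) a x)"
  unfolding continuous_on_iff
proof (intro ballI allI impI)
  let ?F = "\<lambda>((a, t), x). if t = 0 then v a x else u (reciprocal_index t) a x"
  fix p and e :: real assume p: "p \<in> (A \<times> reciprocals) \<times> S" and "e > 0"
  obtain a t x where p_eq: "p = ((a, t), x)" by (metis surj_pair)
  have a: "a \<in> A" and t: "t \<in> reciprocals" and x: "x \<in> S" using p p_eq by auto
  have dist_le: "dist (b, y) (a, x) \<le> dist ((b, s), y) p" "dist s t \<le> dist ((b, s), y) p" for b s y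
  proof -
    show "dist (b, y) (a, x) \<le> dist ((b, s), y) p"
      by (simp add: p_eq dist_Pair_Pair)
    have "dist s t \<le> dist (b, s) (a, t)" using dist_snd_le[of "(b, s)" "(a, t)"] by simp
    also have "\<dots> \<le> dist ((b, s), y) p" using dist_fst_le[of "((b, s), y)" p] by (simp add: p_eq)
    finally show "dist s t \<le> dist ((b, s), y) p" .
  qed
  show "\<exists>d>0. \<forall>q\<in>(A \<times> reciprocals) \<times> S. dist q p < d \<longrightarrow> dist (?F q) (?F p) < e"
    using t
  proof (cases rule: reciprocals_cases)
    case 1
    obtain d where d: "d > 0" "\<And>b y. b \<in> A \<Longrightarrow> y \<in> S \<Longrightarrow> dist (b, y) (a, x) < d \<Longrightarrow>
        dist (v b y) (v a x) < e / 2"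
      using v a x half_gt_zero[OF \<open>e > 0\<close>] unfolding continuous_on_iff by fastforce
    have "dist (?F ((b, s), y)) (?F p) < e"
      if b: "b \<in> A" and s: "s \<in> reciprocals" and y: "y \<in> S" and dist: "dist ((b, s), y) p < min d (e / 2)" for b s y
    proof -
      have 2: "dist (v b y) (v a x) < e / 2" using d(2)[OF b y] dist dist_le(1)[of b y s] by linarith
      have "dist s t < e / 2" using dist dist_le(2)[of s b y] by linarith
      from s have "dist (?F ((b, s), y)) (v b y) < e / 2"
      proof (cases rule: reciprocals_cases)
        case (2 n)
        thus ?thesis using close[OF b y, of n] \<open>dist s t < e / 2\<close> \<open>t = 0\<close> by (simp add: dist_real_def)
      qed (use \<open>e > 0\<close> in simp)
      from dist_triangle_half_r[OF _ 2, of "?F ((b, s), y)"] this show ?thesis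
        using \<open>t = 0\<close> dist_triangle_half_l[OF _ 2[unfolded dist_commute[of "v b y"]]]
        by (simp add: p_eq dist_commute)
    qed
    thus ?thesis using d(1) \<open>e > 0\<close> by (intro exI[of _ "min d (e / 2)"]) auto
  next
    case (2 n)
    obtain d where d: "d > 0" "\<And>b y. b \<in> A \<Longrightarrow> y \<in> S \<Longrightarrow> dist (b, y) (a, x) < d \<Longrightarrow>
        dist (u n b y) (u n a x) < e"
      using u[of n] a x \<open>e > 0\<close> unfolding continuous_on_iff by fastforce
    obtain d' where d': "d' > 0" "\<And>s. s \<in> reciprocals \<Longrightarrow> dist s t < d' \<Longrightarrow> s = t"
      using reciprocals_isolated[OF t] 2 by (metis less_irrefl)
    have "dist (?F ((b, s), y)) (?F p) < e"
      if b: "b \<in> A" and s: "s \<in> reciprocals" and y: "y \<in> S" and dist: "dist ((b, s), y) p < min d d'" for b s y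
    proof -
      have "s = t" using d'(2)[OF s] dist dist_le(2)[of s b y] by linarith
      moreover have "dist (u n b y) (u n a x) < e" using d(2)[OF b y] dist dist_le(1)[of b y s] by linarith
      ultimately show ?thesis using 2 by (simp add: p_eq)
    qed
    thus ?thesis using d(1) d'(1) by (intro exI[of _ "min d d'"]) auto
  qed
qed

lemma eig_gap_tendsto:
  fixes f :: "'a::metric_space \<Rightarrow> real ^ 'n \<Rightarrow> real ^ 'n"
  assumes "\<And>m. (\<lambda>n. D_ball (g n a) 0 (axis m 1)) \<longlonglongrightarrow> D_ball (f a) 0 (axis m 1)"
  shows "(\<lambda>n. eig_gap (g n) a i ms) \<longlonglongrightarrow> eig_gap f a i ms"
proof -
  have *: "(\<lambda>n. eigval (g n) a i) \<longlonglongrightarrow> eigval f a i" for i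
    unfolding eigval_def by (intro tendsto_intros assms)
  have "(\<lambda>n. prod_list (map (eigval (g n) a) ms)) \<longlonglongrightarrow> prod_list (map (eigval f a) ms)"
    by (induction ms) (auto intro!: tendsto_intros *)
  thus ?thesis unfolding eig_gap_def by (intro tendsto_intros *)
qed

lemma homeomorphism_prod_id:
  assumes "homeomorphism A A \<sigma> \<tau>"
  shows "homeomorphism (A \<times> T) (A \<times> T) (\<lambda>(a, t). (\<sigma> a, t)) (\<lambda>(a, t). (\<tau> a, t))"
proof -
  have *: "continuous_on (A \<times> T) (\<lambda>(a, t). (\<phi> a, t))" if "continuous_on A \<phi>" for \<phi> :: "'a \<Rightarrow> 'a"
    unfolding split_beta' by (intro continuous_intros continuous_on_compose2[OF that]) auto
  show ?thesis
    using assms by (intro homeomorphismI *) (auto simp: homeomorphism_def)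
qed

lemma iter_deriv_le_family_norm:
  fixes f g :: "'a::metric_space \<Rightarrow> real ^ 'n \<Rightarrow> real ^ 'n"
  assumes "compact A" "Ck_fam r A unit_cball f" "Ck_fam r A unit_cball g"
    and bs: "set bs \<subseteq> Basis" "length bs \<le> r" and a: "a \<in> A" and x: "x \<in> unit_cball"
  shows "dist (iter_deriv unit_cball (g a) bs x) (iter_deriv unit_cball (f a) bs x) \<le>
    family_norm r A unit_cball (\<lambda>a x. g a x - f a x)"
proof -
  note U = unique_deriv_unit_cball
  have d: "Ck_fam r A unit_cball (\<lambda>a x. g a x - f a x)" by (rule Ck_fam_diff[OF U assms(3,2)])
  have "dist (iter_deriv unit_cball (g a) bs x) (iter_deriv unit_cball (f a) bs x) =
      norm (iter_deriv unit_cball (\<lambda>x. g a x - f a x) bs x)"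
    using iter_deriv_diff[OF U assms(3,2) bs(2) a x] by (simp add: dist_norm)
  also have "\<dots> \<le> Cr_norm r unit_cball (\<lambda>x. g a x - f a x)"
    by (rule norm_iter_deriv_le_Cr_norm[OF U compact_cball Ck_fam_imp_Cr_on[OF d a] bs(2) _ x])
      (use bs in auto)
  also have "\<dots> \<le> family_norm r A unit_cball (\<lambda>a x. g a x - f a x)"
    by (rule Cr_norm_le_family_norm[OF U compact_cball _ assms(1) d a]) auto
  finally show ?thesis .
qed

text \<open>A sequence of families converging to \<open>f\<close> is one family parametrised by \<open>A \<times> reciprocals\<close>, with
  \<open>f\<close> at time \<open>0\<close>. By uniqueness, its linearization restricts to the linearization of each term, and
  it depends continuously on the time.\<close>

lemma linearization_sequentially_continuous:
  fixes f :: "'a::metric_space \<Rightarrow> real ^ 'n \<Rightarrow> real ^ 'n"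
  assumes A: "compact A" "A \<noteq> {}" and hom: "homeomorphism A A \<sigma> \<tau>" and r: "r \<ge> 2"
    and f: "f \<in> admissible_families r A" and g: "\<And>n. g n \<in> admissible_families r A"
    and close: "\<And>n. family_norm r A unit_cball (\<lambda>a x. g n a x - f a x) \<le> 1 / real (Suc n)"
    and sgn: "\<And>n i ms a. length ms \<noteq> 1 \<Longrightarrow> length ms < r \<Longrightarrow> a \<in> A \<Longrightarrow>
      sgn (eig_gap (g n) a i ms) = sgn (eig_gap f a i ms)"
    and h: "linearizes r A \<sigma> f h" and k: "\<And>n. linearizes r A \<sigma> (g n) (k n)"
    and "\<epsilon> > 0"
  shows "\<exists>n. family_norm r A unit_cball (\<lambda>a x. k n a x - h a x) < \<epsilon>"
proof -
  note U = unique_deriv_unit_cball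
  let ?B = "unit_cball :: (real ^ 'n) set" and ?A = "A \<times> reciprocals"
  let ?\<sigma> = "\<lambda>(a, t :: real). (\<sigma> a, t)"
  define G where "G = (\<lambda>(a, t). if t = 0 then f a else g (reciprocal_index t) a)"
  have G0: "G (a, 0) = f a" and Gn: "G (a, 1 / real (Suc n)) = g n a" for a n
    by (auto simp: G_def)
  have f_Ck: "Ck_fam r A ?B f" and g_Ck: "Ck_fam r A ?B (g n)" for n
    using f g by (auto intro: admissible_imp_Ck_fam)
  have G_cases: "\<exists>f'\<in>admissible_families r A. G (a, t) = f' a \<and> eigval G (a, t) = eigval f' a \<and>
      (f' = f \<or> (\<exists>n. f' = g n))" for a t
    by (cases "t = 0") (auto simp: G_def eigval_def fun_eq_iff intro: f g)
  have G_Ck: "Ck_fam r ?A ?B G"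
  proof (rule Ck_fam_basis_listsI[OF U])
    show "Cr_on r ?B (G p)" if pA: "p \<in> ?A" for p
    proof -
      obtain a t where p: "p = (a, t)" "a \<in> A" using pA by auto
      obtain f' where "f' \<in> admissible_families r A" "G p = f' a" using G_cases[of a t] p by auto
      thus ?thesis using Ck_fam_imp_Cr_on[OF admissible_imp_Ck_fam p(2)] by simp
    qed
    fix bs :: "(real ^ 'n) list" assume bs: "set bs \<subseteq> Basis" "length bs \<le> r"
    have "continuous_on (?A \<times> ?B) (\<lambda>((a, t), x). if t = 0 then iter_deriv ?B (f a) bs x
        else iter_deriv ?B (g (reciprocal_index t) a) bs x)"
    proof (rule continuous_on_reciprocals)
      show "dist (iter_deriv ?B (g n a) bs x) (iter_deriv ?B (f a) bs x) \<le> 1 / real (Suc n)"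
        if "a \<in> A" "x \<in> ?B" for n a x
        using iter_deriv_le_family_norm[OF A(1) f_Ck g_Ck bs that, of n] close[of n] by linarith
    qed (rule Ck_fam_iter_deriv_0[OF f_Ck bs(2)] Ck_fam_iter_deriv_0[OF g_Ck bs(2)])+
    moreover have "(\<lambda>((a, t), x). if t = 0 then iter_deriv ?B (f a) bs x
        else iter_deriv ?B (g (reciprocal_index t) a) bs x) = (\<lambda>(p, x). iter_deriv ?B (G p) bs x)"
      by (auto simp: G_def)
    ultimately show "continuous_on (?A \<times> ?B) (\<lambda>(p, x). iter_deriv ?B (G p) bs x)" by simp
  qed
  \<comment> \<open>Pointwise hypotheses pass to \<open>G\<close>, as each \<open>G (a, t)\<close>
    belongs to an admissible family. Only the sign dichotomy compares different times; there the
    assumption \<open>sgn\<close> enters, followed by constancy in \<open>a\<close> for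
    \<open>f\<close>.\<close>
  interpret G: contracting_family ?A ?\<sigma> "\<lambda>(a, t). (\<tau> a, t)" r G "eigval G"
  proof (rule contracting_familyI[OF compact_Times[OF A(1) compact_reciprocals] homeomorphism_prod_id[OF hom] r G_Ck])
    have adm: "\<exists>f'. (H1 r A f' \<and> H2 A f' \<and> H4 r A f') \<and> G p = f' (fst p) \<and>
        eigval G p = eigval f' (fst p)" for p
      using G_cases[of "fst p" "snd p"] by (auto simp: admissible_families_def)
    have H4: "\<bar>eigval_power G p k\<bar> < \<bar>eigval G p i\<bar>" if "r \<le> sum k UNIV" "p \<in> ?A" for p k i
    proof -
      obtain f' where "H4 r A f'" "eigval G p = eigval f' (fst p)" using adm[of p] by blast
      thus ?thesis using that unfolding H4_def eigval_power_def by force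
    qed
    have "G p ` ?B \<subseteq> ?B \<and> Cr_diffeo_into r ?B (G p) \<and> (\<forall>x\<in>?B. onorm (D_ball (G p) x) < 1) \<and>
        G p 0 = 0" "\<forall>v. D_ball (G p) 0 v = (\<chi> i. eigval G p i * v $ i)" if "p \<in> ?A" for p
    proof -
      obtain f' where f': "H1 r A f'" "H2 A f'" "G p = f' (fst p)" "eigval G p = eigval f' (fst p)"
        using adm[of p] by blast
      have "fst p \<in> A" using that by auto
      thus "G p ` ?B \<subseteq> ?B \<and> Cr_diffeo_into r ?B (G p) \<and> (\<forall>x\<in>?B. onorm (D_ball (G p) x) < 1) \<and>
          G p 0 = 0" "\<forall>v. D_ball (G p) 0 v = (\<chi> i. eigval G p i * v $ i)"
        using f'(1,2) unfolding f'(3,4) H1_def H2_def by blast+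
    qed
    with H4 show "H1 r ?A G" "H2 ?A G" "H4 r ?A G"
      unfolding H1_def H2_def H4_def by blast+
    fix i and ms :: "'n list" assume ms: "length ms \<noteq> 1" "length ms < r"
    have H3: "H3 A f" using f by (simp add: admissible_families_def)
    obtain a0 where a0: "a0 \<in> A" using A(2) by blast
    have "sgn (eig_gap G p i ms) = sgn (eig_gap f a0 i ms)" if pA: "p \<in> ?A" for p
    proof -
      obtain a t where p: "p = (a, t)" "a \<in> A" using pA by auto
      obtain f' where f': "eigval G p = eigval f' a" "f' = f \<or> (\<exists>n. f' = g n)"
        using G_cases[of a t] p by auto
      have "sgn (eig_gap G p i ms) = sgn (eig_gap f' a i ms)" by (simp add: eig_gap_def f'(1))
      also have "\<dots> = sgn (eig_gap f a i ms)" using f'(2) sgn[OF ms p(2)] by auto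
      also have "\<dots> = sgn (eig_gap f a0 i ms)" by (rule H3_eig_gap(2)[OF H3 ms(1) p(2) a0])
      finally show ?thesis .
    qed
    moreover have "sgn (eig_gap f a0 i ms) \<noteq> 0"
      using H3_eig_gap(1)[OF H3 ms(1) a0 a0] by (simp add: sgn_zero_iff)
    ultimately have "(\<forall>p\<in>?A. eig_gap G p i ms > 0) \<or> (\<forall>p\<in>?A. eig_gap G p i ms < 0)"
      by (rule sgn_constant_cases)
    thus "(\<forall>p\<in>?A. \<bar>prod_list (map (eigval G p) ms)\<bar> < \<bar>eigval G p i\<bar>) \<or>
        (\<forall>p\<in>?A. \<bar>prod_list (map (eigval G p) ms)\<bar> > \<bar>eigval G p i\<bar>)"
      by (simp add: eig_gap_def)
  qed
  obtain L where L: "linearizes r ?A ?\<sigma> G L" using G.linearizes_exists by blast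
  have L_Ck: "Ck_fam r ?A ?B L" by (rule G.linearizes_component(1)[OF L])
  \<comment> \<open>The extended dynamics fixes the time, so the equation for \<open>L\<close>
    splits into one equation per time.\<close>
  have slice: "linearizes r A \<sigma> f' (\<lambda>a. L (a, t))"
    if t: "t \<in> reciprocals" and f': "\<And>a. G (a, t) = f' a" for t f'
    unfolding linearizes_def
  proof (intro conjI ballI)
    have "Ck_fam r A ?B (\<lambda>a. L (a, t))"
      by (rule Ck_fam_reparam[OF U L_Ck]) (use t in \<open>auto intro!: continuous_intros\<close>)
    thus "(\<lambda>a. L (a, t)) \<in> Cr_families r A ?B"
      by (intro Ck_fam_imp_Cr_families[OF U compact_cball]) auto
  qed (use L t in \<open>auto simp: linearizes_def simp flip: f'\<close>)
  have t_n: "1 / real (Suc n) \<in> reciprocals" for n by (auto simp: reciprocals_def)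
  have h_eq: "h a x = L (a, 0) x" if "a \<in> A" "x \<in> ?B" for a x
    using contracting_family.linearizes_unique[OF admissible_contracting_family[OF A(1) hom r f]
        slice[of 0 f] h that] G0 by (simp add: reciprocals_def)
  have k_eq: "k n a x = L (a, 1 / real (Suc n)) x" if "a \<in> A" "x \<in> ?B" for n a x
    using contracting_family.linearizes_unique[OF admissible_contracting_family[OF A(1) hom r g[of n]]
        slice[OF t_n] k that] Gn by simp
  define e where "e = \<epsilon> / (2 * real DIM(real ^ 'n) ^ r)"
  have "e > 0" using \<open>\<epsilon> > 0\<close> by (simp add: e_def)
  \<comment> \<open>Continuity in the time is uniform in \<open>a\<close> and \<open>x\<close> by
    compactness, and a common \<open>d\<close> exists as there are finitely many basis
    lists.\<close>
  have "\<exists>d>0. \<forall>bs\<in>{bs. set bs \<subseteq> (Basis :: (real ^ 'n) set) \<and> length bs \<le> r}.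
      \<forall>a\<in>A. \<forall>x\<in>?B. \<forall>t\<in>reciprocals. t < d \<longrightarrow>
        dist (iter_deriv ?B (L (a, t)) bs x) (iter_deriv ?B (L (a, 0)) bs x) < e"
  proof (rule finite_common_radius)
    show "finite {bs. set bs \<subseteq> (Basis :: (real ^ 'n) set) \<and> length bs \<le> r}"
      by (rule finite_lists_length_le) simp
    fix bs assume "bs \<in> {bs. set bs \<subseteq> (Basis :: (real ^ 'n) set) \<and> length bs \<le> r}"
    hence "uniformly_continuous_on (?A \<times> ?B) (\<lambda>(p, x). iter_deriv ?B (L p) bs x)"
      by (intro compact_uniformly_continuous Ck_fam_iter_deriv_0[OF L_Ck] compact_Times A compact_reciprocals) auto
    then obtain d where d: "d > 0" "\<And>p q. p \<in> ?A \<times> ?B \<Longrightarrow> q \<in> ?A \<times> ?B \<Longrightarrow> dist q p < d \<Longrightarrow>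
        dist (case q of (p, x) \<Rightarrow> iter_deriv ?B (L p) bs x) (case p of (p, x) \<Rightarrow> iter_deriv ?B (L p) bs x) < e"
      using \<open>e > 0\<close> unfolding uniformly_continuous_on_def by metis
    have "dist (iter_deriv ?B (L (a, t)) bs x) (iter_deriv ?B (L (a, 0)) bs x) < e"
      if "a \<in> A" "x \<in> ?B" "t \<in> reciprocals" "t < d" for a x t
      using d(2)[of "((a, 0), x)" "((a, t), x)"] that
      by (auto simp: dist_Pair_Pair reciprocals_def)
    thus "\<exists>d>0. \<forall>a\<in>A. \<forall>x\<in>?B. \<forall>t\<in>reciprocals. t < d \<longrightarrow>
        dist (iter_deriv ?B (L (a, t)) bs x) (iter_deriv ?B (L (a, 0)) bs x) < e"
      using d(1) by blast
  qed auto
  then obtain d where d: "d > 0" "\<And>bs a x t. set bs \<subseteq> Basis \<Longrightarrow> length bs \<le> r \<Longrightarrow> a \<in> A \<Longrightarrow> x \<in> ?B \<Longrightarrow>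
      t \<in> reciprocals \<Longrightarrow> t < d \<Longrightarrow> dist (iter_deriv ?B (L (a, t)) bs x) (iter_deriv ?B (L (a, 0)) bs x) < e"
    by blast
  obtain n where n: "1 / real (Suc n) < d" using nat_approx_posE[OF d(1)] by blast
  have h_Ck: "Ck_fam r A ?B h" and k_Ck: "Ck_fam r A ?B (k n)"
    using h k[of n] Cr_families_imp_Ck_fam[OF U compact_cball] by (auto simp: linearizes_def)
  have "family_norm r A ?B (\<lambda>a x. k n a x - h a x) \<le> real DIM(real ^ 'n) ^ r * e"
  proof (rule family_norm_le[OF U _ A(2) Ck_fam_diff[OF U k_Ck h_Ck]])
    fix bs :: "(real ^ 'n) list" and a x
    assume bs: "set bs \<subseteq> Basis" "length bs \<le> r" and a: "a \<in> A" and x: "x \<in> ?B"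
    have "iter_deriv ?B (\<lambda>x. k n a x - h a x) bs x = iter_deriv ?B (k n a) bs x - iter_deriv ?B (h a) bs x"
      by (rule iter_deriv_diff[OF U k_Ck h_Ck bs(2) a x])
    also have "iter_deriv ?B (k n a) bs x = iter_deriv ?B (L (a, 1 / real (Suc n))) bs x"
      by (rule iter_deriv_cong[OF k_eq[OF a] x])
    also have "iter_deriv ?B (h a) bs x = iter_deriv ?B (L (a, 0)) bs x"
      by (rule iter_deriv_cong[OF h_eq[OF a] x])
    finally show "norm (iter_deriv ?B (\<lambda>x. k n a x - h a x) bs x) \<le> e"
      using d(2)[OF bs a x t_n n] by (simp add: dist_norm)
  qed (use \<open>e > 0\<close> in auto)
  also have "\<dots> < \<epsilon>" using \<open>\<epsilon> > 0\<close> by (simp add: e_def)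
  finally show ?thesis by blast
qed

text \<open>If continuity failed at \<open>f\<close>, there would be families \<open>g n\<close>
  within \<open>1 / real (Suc n)\<close> of \<open>f\<close> whose linearizations stay away from
  that of \<open>f\<close>. It remains to make the signs of their eigenvalue gaps agree with those
  of \<open>f\<close>.\<close>

lemma linearization_continuous:
  fixes f :: "'a::metric_space \<Rightarrow> real ^ 'n \<Rightarrow> real ^ 'n"
  assumes A: "compact A" and hom: "homeomorphism A A \<sigma> \<tau>" and r: "r \<ge> 2"
    and H: "\<And>f. f \<in> admissible_families r A \<Longrightarrow> linearizes r A \<sigma> f (H f)"
    and f: "f \<in> admissible_families r A" and "\<epsilon> > 0"
  shows "\<exists>\<delta>>0. \<forall>g\<in>admissible_families r A. family_norm r A unit_cball (\<lambda>a x. g a x - f a x) < \<delta> \<longrightarrow>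
    family_norm r A unit_cball (\<lambda>a x. H g a x - H f a x) < \<epsilon>"
proof (cases "A = {}")
  case True
  \<comment> \<open>Both norms are the junk value \<open>Sup {}\<close>.\<close>
  show ?thesis using \<open>\<epsilon> > 0\<close> by (intro exI[of _ \<epsilon>]) (simp add: family_norm_def True)
next
  case False
  note U = unique_deriv_unit_cball
  show ?thesis
  proof (rule ccontr)
    assume neg: "\<not> ?thesis"
    have "\<forall>n. \<exists>g. g \<in> admissible_families r A \<and>
        family_norm r A unit_cball (\<lambda>a x. g a x - f a x) < 1 / real (Suc n) \<and>
        \<not> family_norm r A unit_cball (\<lambda>a x. H g a x - H f a x) < \<epsilon>"
    proof
      fix n
      let ?P = "\<lambda>\<delta> g. family_norm r A unit_cball (\<lambda>a x. g a x - f a x) < \<delta>"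
        and ?Q = "\<lambda>g. family_norm r A unit_cball (\<lambda>a x. H g a x - H f a x) < \<epsilon>"
      show "\<exists>g. g \<in> admissible_families r A \<and> ?P (1 / real (Suc n)) g \<and> \<not> ?Q g"
      proof (rule ccontr)
        assume "\<not> (\<exists>g. g \<in> admissible_families r A \<and> ?P (1 / real (Suc n)) g \<and> \<not> ?Q g)"
        hence "\<forall>g\<in>admissible_families r A. ?P (1 / real (Suc n)) g \<longrightarrow> ?Q g" by blast
        moreover have "1 / real (Suc n) > 0" by simp
        ultimately have "\<exists>\<delta>>0. \<forall>g\<in>admissible_families r A. ?P \<delta> g \<longrightarrow> ?Q g"
          by (intro exI[of _ "1 / real (Suc n)"] conjI)
        with neg show False by (rule notE)
      qed
    qed
    from choice[OF this] obtain g where "\<forall>n. g n \<in> admissible_families r A \<and>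
        family_norm r A unit_cball (\<lambda>a x. g n a x - f a x) < 1 / real (Suc n) \<and>
        \<not> family_norm r A unit_cball (\<lambda>a x. H (g n) a x - H f a x) < \<epsilon>" ..
    hence g: "\<And>n. g n \<in> admissible_families r A"
      "\<And>n. family_norm r A unit_cball (\<lambda>a x. g n a x - f a x) < 1 / real (Suc n)"
      "\<And>n. \<not> family_norm r A unit_cball (\<lambda>a x. H (g n) a x - H f a x) < \<epsilon>" by blast+
    \<comment> \<open>One parameter suffices: within \<open>f\<close> and within each
      \<open>g n\<close> the signs are constant by (H3), so agreement at \<open>a0\<close> is
      agreement everywhere.\<close>
    obtain a0 where a0: "a0 \<in> A" using False by blast
    have lim: "(\<lambda>n. D_ball (g n a0) 0 (axis m 1)) \<longlonglongrightarrow> D_ball (f a0) 0 (axis m 1)" for m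
    proof (rule tendsto_dist_iff[THEN iffD2], rule Lim_null_comparison[OF always_eventually])
      show "\<forall>n. norm (dist (D_ball (g n a0) 0 (axis m 1)) (D_ball (f a0) 0 (axis m 1))) \<le> 1 / real (Suc n)"
      proof
        fix n
        have "dist (iter_deriv unit_cball (g n a0) [axis m 1] 0) (iter_deriv unit_cball (f a0) [axis m 1] 0) \<le>
            family_norm r A unit_cball (\<lambda>a x. g n a x - f a x)"
          by (rule iter_deriv_le_family_norm[OF A admissible_imp_Ck_fam[OF f] admissible_imp_Ck_fam[OF g(1)]])
            (use r a0 in \<open>auto simp: axis_in_Basis_iff\<close>)
        thus "norm (dist (D_ball (g n a0) 0 (axis m 1)) (D_ball (f a0) 0 (axis m 1))) \<le> 1 / real (Suc n)"
          using g(2)[of n] by simp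
      qed
      show "(\<lambda>n. 1 / real (Suc n)) \<longlonglongrightarrow> 0" by (rule LIMSEQ_Suc[OF lim_1_over_n])
    qed
    have H3: "H3 A f" "H3 A (g n)" for n using f g(1) by (auto simp: admissible_families_def)
    \<comment> \<open>Finitely many gaps, all nonzero for \<open>f\<close>, so their signs are
      simultaneously those of the limit from some index on.\<close>
    let ?I = "(UNIV :: 'n set) \<times> {ms :: 'n list. length ms \<le> r}"
    have "\<forall>\<^sub>F n in sequentially. \<forall>(i, ms)\<in>?I. length ms \<noteq> 1 \<longrightarrow>
        sgn (eig_gap (g n) a0 i ms) = sgn (eig_gap f a0 i ms)"
    proof (intro eventually_ball_finite finite_cartesian_product finite_lists_le finite ballI, clarify)
      fix i and ms :: "'n list"
      show "\<forall>\<^sub>F n in sequentially. length ms \<noteq> 1 \<longrightarrow> sgn (eig_gap (g n) a0 i ms) = sgn (eig_gap f a0 i ms)"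
      proof (cases "length ms = 1")
        case False
        have "eig_gap f a0 i ms \<noteq> 0" by (rule H3_eig_gap(1)[OF H3(1) False a0 a0])
        from tendsto_sgn[OF eig_gap_tendsto[where g = g and f = f and a = a0, OF lim] this]
        have "(\<lambda>n. sgn (eig_gap (g n) a0 i ms)) \<longlonglongrightarrow> sgn (eig_gap f a0 i ms)" .
        from tendstoD[OF this zero_less_one]
        show ?thesis
        proof eventually_elim
          case (elim n)
          have "eig_gap (g n) a0 i ms \<noteq> 0" by (rule H3_eig_gap(1)[OF H3(2) False a0 a0])
          thus ?case using elim \<open>eig_gap f a0 i ms \<noteq> 0\<close>
            by (auto simp: sgn_if dist_real_def split: if_splits)
        qed
      qed simp
    qed
    then obtain N where N: "\<And>n i ms. n \<ge> N \<Longrightarrow> length ms \<le> r \<Longrightarrow> length ms \<noteq> 1 \<Longrightarrow>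
        sgn (eig_gap (g n) a0 i ms) = sgn (eig_gap f a0 i ms)"
      unfolding eventually_sequentially by auto
    \<comment> \<open>Discarding the first \<open>N\<close> terms only improves the rate of
      convergence, so the rate tied to the reciprocals still holds.\<close>
    have "\<exists>n. family_norm r A unit_cball (\<lambda>a x. H (g (n + N)) a x - H f a x) < \<epsilon>"
    proof (rule linearization_sequentially_continuous[OF A False hom r f g(1) _ _ H[OF f] H[OF g(1)] \<open>\<epsilon> > 0\<close>])
      show "family_norm r A unit_cball (\<lambda>a x. g (n + N) a x - f a x) \<le> 1 / real (Suc n)" for n
      proof -
        have "1 / real (Suc (n + N)) \<le> 1 / real (Suc n)" by (simp add: frac_le)
        thus ?thesis using g(2)[of "n + N"] by linarith
      qed
      show "sgn (eig_gap (g (n + N)) a i ms) = sgn (eig_gap f a i ms)"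
        if "length ms \<noteq> 1" "length ms < r" "a \<in> A" for n i ms a
        using N[of "n + N" ms i] that H3_eig_gap(2)[OF H3(1) that(1,3) a0] H3_eig_gap(2)[OF H3(2) that(1,3) a0]
        by simp
    qed
    thus False using g(3) by blast
  qed
qed

text \<open>Families are total functions, so uniqueness means equality on \<open>A\<close> and the
  ball, and continuity is asserted for every choice \<open>H\<close> of linearizations.\<close>

theorem corollary2:
  fixes A :: "'a::metric_space set" and \<sigma> :: "'a \<Rightarrow> 'a" and r :: nat
  assumes "compact A"
    and "\<exists>\<tau>. homeomorphism A A \<sigma> \<tau>"
    and "r \<ge> 2"
  shows "(\<forall>f \<in> (admissible_families r A :: ('a \<Rightarrow> real ^ 'n \<Rightarrow> real ^ 'n) set).
            \<exists>h. linearizes r A \<sigma> f h \<and>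
                (\<forall>h'. linearizes r A \<sigma> f h' \<longrightarrow> (\<forall>a\<in>A. \<forall>x\<in>unit_cball. h' a x = h a x))) \<and>
         (\<forall>H :: ('a \<Rightarrow> real ^ 'n \<Rightarrow> real ^ 'n) \<Rightarrow> 'a \<Rightarrow> real ^ 'n \<Rightarrow> real ^ 'n.
            (\<forall>f \<in> admissible_families r A. linearizes r A \<sigma> f (H f)) \<longrightarrow>
            (\<forall>f \<in> admissible_families r A. \<forall>\<epsilon>>0. \<exists>\<delta>>0. \<forall>g \<in> admissible_families r A.
               family_norm r A unit_cball (\<lambda>a x. g a x - f a x) < \<delta> \<longrightarrow>
               family_norm r A unit_cball (\<lambda>a x. H g a x - H f a x) < \<epsilon>))"
proof -
  obtain \<tau> where hom: "homeomorphism A A \<sigma> \<tau>" using assms(2) by blast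
  show ?thesis
  proof (intro conjI ballI allI impI)
    fix f :: "'a \<Rightarrow> real ^ 'n \<Rightarrow> real ^ 'n" assume "f \<in> admissible_families r A"
    then interpret contracting_family A \<sigma> \<tau> r f "eigval f"
      by (rule admissible_contracting_family[OF assms(1) hom assms(3)])
    show "\<exists>h. linearizes r A \<sigma> f h \<and>
        (\<forall>h'. linearizes r A \<sigma> f h' \<longrightarrow> (\<forall>a\<in>A. \<forall>x\<in>unit_cball. h' a x = h a x))"
      using linearizes_exists linearizes_unique by blast
  next
    fix H :: "('a \<Rightarrow> real ^ 'n \<Rightarrow> real ^ 'n) \<Rightarrow> 'a \<Rightarrow> real ^ 'n \<Rightarrow> real ^ 'n"
      and f :: "'a \<Rightarrow> real ^ 'n \<Rightarrow> real ^ 'n" and \<epsilon> :: real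
    assume "\<forall>f\<in>admissible_families r A. linearizes r A \<sigma> f (H f)" "f \<in> admissible_families r A" "0 < \<epsilon>"
    thus "\<exists>\<delta>>0. \<forall>g\<in>admissible_families r A. family_norm r A unit_cball (\<lambda>a x. g a x - f a x) < \<delta> \<longrightarrow>
        family_norm r A unit_cball (\<lambda>a x. H g a x - H f a x) < \<epsilon>"
      by (intro linearization_continuous[OF assms(1) hom assms(3)]) auto
  qed
qed

end
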